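(* Let $\widehat{\Omega}=\{r_P<0\}\subset\mathbb{C}^{d+1}$ be a limit domain obtained from the scaling construction described in the context, let $\chi_n$ be the dilations at infinity and $\widetilde{\Omega}$ the corresponding homogeneous limit domain defined in the context. Then for $(z;X)\in\widetilde{\Omega}\times\mathbb{C}^{d+1}$, \[ \lim_{n\to\infty}F_{\chi_n\widehat{\Omega}}(z;X)=F_{\widetilde{\Omega}}(z;X). \] Moreover, the convergence is uniform on compact subsets of $\widetilde{\Omega}\times\mathbb{C}^{d+1}$. Here $F_D$ is the Kobayashi metric of a domain $D$.
   Context: Scaling construction. Points of $\mathbb{C}^{d+1}$ are written $z=(z_0,z_1,\ldots,z_d)$, and $(a,{}'0)\in\mathbb{C}\times\mathbb{C}^d$. Let $\Omega\subset\mathbb{C}^{d+1}$ be a bounded pseudoconvex domain of finite type (D'Angelo) with $\mathcal{C}^\infty$ boundary whose Levi form has rank at least $d-1$ at every boundary point. Let $(u_n)\subset\Omega$ converge to $u_\infty\in\partial\Omega$, a point of type $2m$. Coordinates are chosen so that $u_\infty=0$, and $r$ is a smooth defining function of $\Omega$ on a (small) neighbourhood $W$ of $0$ with $\partial r/\partial z_0(0)=1/2$, $|\partial r/\partial z_0|\ge c>0$ on $W$, such that, with $L_0^r=\partial/\partial z_0$ and $L_j^r=\partial/\partial z_j-(\partial r/\partial z_0)^{-1}(\partial r/\partial z_j)\,\partial/\partial z_0$ for $1\le j\le d$, the matrix $(\partial\overline\partial r[L_i^r,\overline{L_j^r}])_{2\le i,j\le d}$ is positive definite on $W$ and equals the identity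 at $0$. For $x\in W$, $\Phi_x$ is Cho's special-coordinate biholomorphism of $\mathbb{C}^{d+1}$: $\Phi_x(x)=0$, $\Phi_x(x+(-\epsilon,{}'0))=(-2\epsilon\,\partial r/\partial\overline z_0(x),{}'0)$, and \[ r\circ\Phi_x^{-1}(\zeta)=r(x)+\operatorname{Re}\zeta_0+\sum_{\alpha=2}^d\sum_{\substack{j+k\le m\\ j,k>0}}\operatorname{Re}\big(b^\alpha_{j,k}(x)\zeta_1^j\overline\zeta_1^k\zeta_\alpha\big)+\sum_{\substack{j+k\le2m\\ j,k>0}}a_{j,k}(x)\zeta_1^j\overline\zeta_1^k+\sum_{\alpha=2}^d|\zeta_\alpha|^2+R(x;\zeta), \] where, with $\zeta_*=(\zeta_2,\ldots,\zeta_d)$, $R(x;\zeta)=O(|\zeta_0||\zeta|+|\zeta_*|^2|\zeta|+|\zeta_*||\zeta_1|^{m+1}+|\zeta_1|^{2m+1})$ uniformly in $x$. Put $A_\ell(x)=\max\{|a_{j,k}(x)|:j+k=\ell\}$ and $\tau(x,\delta)=\min\{(\delta/A_\ell(x))^{1/\ell}:2\le\ell\le2m\}$. For $n$ large choose $\epsilon_n>0$ with $\xi_n:=u_n+(\epsilon_n,{}'0)\in\partial\Omega$ (so $\epsilon_n\to0$), let $\Lambda_n(\zeta)=(\zeta_0/\epsilon_n,\zeta_1/\tau(\xi_n,\epsilon_n),\zeta_2/\sqrt{\epsilon_n},\ldots,\zeta_d/\sqrt{\epsilon_n})$, and set $\psi_n=\Lambda_n\circ\Phi_{\xi_n}$,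 $\Omega_n=\psi_n(\Omega)$, $r_n=\epsilon_n^{-1}r\circ\psi_n^{-1}$. Then $\psi_n(u_n)\to(-1,{}'0)$ and, after passing to a subsequence (done once and for all), $r_n\to r_P$ uniformly on compact subsets of $\mathbb{C}^{d+1}$, where $r_P(\zeta)=\operatorname{Re}\zeta_0+P(\zeta_1,\overline\zeta_1)+\sum_{\alpha=2}^d|\zeta_\alpha|^2$ and $P$ is a nonzero subharmonic real polynomial without harmonic terms, $P(0)=0$, of degree $2m'\le2m$. The limit domain is $\widehat\Omega=\{r_P<0\}$. Scaling at infinity. Let $\chi_n(z)=(n^{-1}z_0,n^{-1/(2m')}z_1,n^{-1/2}z_2,\ldots,n^{-1/2}z_d)$ where $2m'=\deg P$. Then $\chi_n\widehat\Omega=\{\rho_n<0\}$ with $\rho_n=\frac1n r_P\circ\chi_n^{-1}$, and $\rho_n\to\rho$ locally uniformly, where $\rho(z)=\operatorname{Re}z_0+P_{2m'}(z_1,\overline z_1)+\sum_{\alpha=2}^d|z_\alpha|^2$ and $P_{2m'}$ is the homogeneous part of $P$ of degree $2m'$. Set $\widetilde\Omega=\{\rho<0\}$. The Kobayashi metric is $F_D(p;X)=\inf\{|\lambda|: f\colon\Delta\to D\text{ holomorphic},f(0)=p,df_{|0}\lambda=X\}$. *)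

theory Defs
  imports
    "HOL-Complex_Analysis.Complex_Analysis"
    "HOL-Library.Landau_Symbols"
    "HOL-Library.Extended_Real"
begin

text \<open>
  Points of \<open>\<complex>\<^sup>d\<^sup>+\<^sup>1\<close> (with \<open>d \<ge> 1\<close>) are vectors of type \<open>complex ^ 'n\<close> with \<open>CARD('n) = d + 1\<close>.
  Two distinct distinguished indices \<open>i0\<close> and \<open>i1\<close> play the role of the indices 0 and 1;
  the remaining ones, \<open>- {i0, i1}\<close>, are the indices \<open>2, \<dots>, d\<close> (there are none if \<open>d = 1\<close>).
\<close>

section \<open>Calculus on complex space\<close>

primrec Ck_on :: "nat \<Rightarrow> 'a::real_normed_vector set \<Rightarrow> ('a \<Rightarrow> 'b::real_normed_vector) \<Rightarrow> bool" where
  "Ck_on 0 S f = continuous_on S f"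
| "Ck_on (Suc k) S f =
     ((\<forall>x\<in>S. f differentiable (at x)) \<and> (\<forall>v. Ck_on k S (\<lambda>x. frechet_derivative f (at x) v)))"

text \<open>Only meant for open \<open>S\<close> in finite-dimensional spaces.\<close>

definition smooth_on :: "'a::real_normed_vector set \<Rightarrow> ('a \<Rightarrow> 'b::real_normed_vector) \<Rightarrow> bool" where
  "smooth_on S f \<longleftrightarrow> (\<forall>k. Ck_on k S f)"

definition wirt :: "'n::finite \<Rightarrow> (complex ^ 'n \<Rightarrow> complex) \<Rightarrow> complex ^ 'n \<Rightarrow> complex" where
  "wirt j f x = (frechet_derivative f (at x) (axis j 1)
                 - \<i> * frechet_derivative f (at x) (axis j \<i>)) / 2"

definition wirtbar :: "'n::finite \<Rightarrow> (complex ^ 'n \<Rightarrow> complex) \<Rightarrow> complex ^ 'n \<Rightarrow> complex" where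
  "wirtbar j f x = (frechet_derivative f (at x) (axis j 1)
                    + \<i> * frechet_derivative f (at x) (axis j \<i>)) / 2"

definition dz :: "'n::finite \<Rightarrow> (complex ^ 'n \<Rightarrow> real) \<Rightarrow> complex ^ 'n \<Rightarrow> complex" where
  "dz j r = wirt j (\<lambda>x. complex_of_real (r x))"

definition levi :: "(complex ^ 'n::finite \<Rightarrow> real) \<Rightarrow> complex ^ 'n \<Rightarrow> complex ^ 'n \<Rightarrow> complex ^ 'n \<Rightarrow> complex" where
  "levi r x X Y =
     (\<Sum>j\<in>UNIV. \<Sum>k\<in>UNIV.
        wirt j (wirtbar k (\<lambda>y. complex_of_real (r y))) x * X $ j * cnj (Y $ k))"

definition holomorphic_map :: "(complex ^ 'n::finite \<Rightarrow> complex ^ 'n) \<Rightarrow> bool" where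
  "holomorphic_map f \<longleftrightarrow>
     (\<forall>z. \<exists>f'. (f has_derivative f') (at z) \<and> (\<forall>c v. f' (c *s v) = c *s f' v))"

definition biholomorphism :: "(complex ^ 'n::finite \<Rightarrow> complex ^ 'n) \<Rightarrow> bool" where
  "biholomorphism f \<longleftrightarrow> bij f \<and> holomorphic_map f \<and> holomorphic_map (inv f)"

section \<open>Smoothly bounded domains\<close>

definition local_defining_function ::
    "(complex ^ 'n::finite) set \<Rightarrow> (complex ^ 'n) set \<Rightarrow> (complex ^ 'n \<Rightarrow> real) \<Rightarrow> bool" where
  "local_defining_function \<Omega> U r \<longleftrightarrow>
     open U \<and> smooth_on U r \<and> \<Omega> \<inter> U = {x \<in> U. r x < 0} \<and>
     (\<forall>x\<in>U. frechet_derivative r (at x) \<noteq> (\<lambda>v. 0))"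

definition smooth_boundary :: "(complex ^ 'n::finite) set \<Rightarrow> bool" where
  "smooth_boundary \<Omega> \<longleftrightarrow> (\<forall>p\<in>frontier \<Omega>. \<exists>U r. p \<in> U \<and> local_defining_function \<Omega> U r)"

definition complex_tangent_space :: "(complex ^ 'n::finite \<Rightarrow> real) \<Rightarrow> complex ^ 'n \<Rightarrow> (complex ^ 'n) set" where
  "complex_tangent_space r p = {X. (\<Sum>j\<in>UNIV. dz j r p * X $ j) = 0}"

text \<open>Pseudoconvexity of a domain with smooth boundary (Levi's condition).\<close>

definition pseudoconvex :: "(complex ^ 'n::finite) set \<Rightarrow> bool" where
  "pseudoconvex \<Omega> \<longleftrightarrow>
     (\<forall>p\<in>frontier \<Omega>. \<forall>U r. p \<in> U \<longrightarrow> local_defining_function \<Omega> U r \<longrightarrow>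
        (\<forall>X\<in>complex_tangent_space r p. 0 \<le> Re (levi r p X X)))"

text \<open>The rank of a Hermitian form is the codimension of its radical.\<close>

definition levi_rank :: "(complex ^ 'n::finite \<Rightarrow> real) \<Rightarrow> complex ^ 'n \<Rightarrow> nat" where
  "levi_rank r p =
     vec.dim (complex_tangent_space r p)
     - vec.dim {X \<in> complex_tangent_space r p. \<forall>Y\<in>complex_tangent_space r p. levi r p X Y = 0}"

text \<open>The D'Angelo type: the supremum of \<open>\<nu>(r \<circ> \<gamma>) / \<nu>(\<gamma> - p)\<close> over all nonconstant germs of
  holomorphic curves \<open>\<gamma>\<close> with \<open>\<gamma>(0) = p\<close>, where \<open>\<nu>\<close> is the order of vanishing at 0.\<close>

definition vanishing_order :: "(complex \<Rightarrow> 'a::real_normed_vector) \<Rightarrow> ereal" where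
  "vanishing_order f =
     Sup {ereal (real k) | k. (\<lambda>t. norm (f t)) \<in> O[at 0](\<lambda>t. norm t ^ k)}"

definition holomorphic_curves_at :: "complex ^ 'n::finite \<Rightarrow> (complex \<Rightarrow> complex ^ 'n) set" where
  "holomorphic_curves_at p =
     {\<gamma>. \<gamma> 0 = p \<and>
          (\<exists>e>0. (\<forall>i. (\<lambda>t. \<gamma> t $ i) holomorphic_on ball 0 e) \<and> (\<exists>t\<in>ball 0 e. \<gamma> t \<noteq> p))}"

definition dangelo_type :: "(complex ^ 'n::finite \<Rightarrow> real) \<Rightarrow> complex ^ 'n \<Rightarrow> ereal" where
  "dangelo_type r p =
     (SUP \<gamma>\<in>holomorphic_curves_at p.
        vanishing_order (\<lambda>t. r (\<gamma> t)) / vanishing_order (\<lambda>t. \<gamma> t - p))"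

definition finite_type :: "(complex ^ 'n::finite) set \<Rightarrow> bool" where
  "finite_type \<Omega> \<longleftrightarrow>
     (\<forall>p\<in>frontier \<Omega>. \<forall>U r. p \<in> U \<longrightarrow> local_defining_function \<Omega> U r \<longrightarrow> dangelo_type r p < \<infinity>)"

text \<open>With \<open>d + 1 = CARD('n)\<close>, the lower bound \<open>d - 1\<close> for the rank is \<open>CARD('n) - 2\<close>.\<close>

definition levi_corank_one_domain :: "(complex ^ 'n::finite) set \<Rightarrow> bool" where
  "levi_corank_one_domain \<Omega> \<longleftrightarrow>
     open \<Omega> \<and> connected \<Omega> \<and> \<Omega> \<noteq> {} \<and> bounded \<Omega> \<and>
     smooth_boundary \<Omega> \<and> pseudoconvex \<Omega> \<and> finite_type \<Omega> \<and>
     (\<forall>p\<in>frontier \<Omega>. \<forall>U r. p \<in> U \<longrightarrow> local_defining_function \<Omega> U r \<longrightarrow>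
        CARD('n) - 2 \<le> levi_rank r p)"

section \<open>Cho's special coordinates\<close>

definition L_field :: "'n \<Rightarrow> (complex ^ 'n::finite \<Rightarrow> real) \<Rightarrow> 'n \<Rightarrow> complex ^ 'n \<Rightarrow> complex ^ 'n" where
  "L_field i0 r j x =
     (if j = i0 then axis i0 1 else axis j 1 - axis i0 (inverse (dz i0 r x) * dz j r x))"

definition mixed_upto :: "nat \<Rightarrow> (nat \<times> nat) set" where
  "mixed_upto N = {(j, k). 0 < j \<and> 0 < k \<and> j + k \<le> N}"

text \<open>Here \<open>a j k = a\<^sub>j\<^sub>,\<^sub>k(x)\<close> and \<open>b \<alpha> j k = b\<^sup>\<alpha>\<^sub>j\<^sub>,\<^sub>k(x)\<close>.\<close>

definition cho_principal_part ::
    "'n \<Rightarrow> 'n \<Rightarrow> nat \<Rightarrow> (nat \<Rightarrow> nat \<Rightarrow> complex) \<Rightarrow> ('n \<Rightarrow> nat \<Rightarrow> nat \<Rightarrow> complex)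
       \<Rightarrow> complex ^ 'n::finite \<Rightarrow> real" where
  "cho_principal_part i0 i1 m a b \<zeta> =
     Re (\<zeta> $ i0)
     + (\<Sum>\<alpha>\<in>- {i0, i1}. \<Sum>(j, k)\<in>mixed_upto m. Re (b \<alpha> j k * (\<zeta> $ i1) ^ j * cnj (\<zeta> $ i1) ^ k * \<zeta> $ \<alpha>))
     + Re (\<Sum>(j, k)\<in>mixed_upto (2 * m). a j k * (\<zeta> $ i1) ^ j * cnj (\<zeta> $ i1) ^ k)
     + (\<Sum>\<alpha>\<in>- {i0, i1}. (cmod (\<zeta> $ \<alpha>))\<^sup>2)"

definition star_norm :: "'n \<Rightarrow> 'n \<Rightarrow> complex ^ 'n::finite \<Rightarrow> real" where
  "star_norm i0 i1 \<zeta> = L2_set (\<lambda>\<alpha>. cmod (\<zeta> $ \<alpha>)) (- {i0, i1})"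

definition cho_error :: "'n \<Rightarrow> 'n \<Rightarrow> nat \<Rightarrow> complex ^ 'n::finite \<Rightarrow> real" where
  "cho_error i0 i1 m \<zeta> =
     cmod (\<zeta> $ i0) * norm \<zeta> + (star_norm i0 i1 \<zeta>)\<^sup>2 * norm \<zeta>
     + star_norm i0 i1 \<zeta> * cmod (\<zeta> $ i1) ^ (m + 1) + cmod (\<zeta> $ i1) ^ (2 * m + 1)"

text \<open>
  \<open>\<Phi> x\<close> are the special coordinates centred at \<open>x \<in> W\<close>, with coefficients \<open>a x\<close> and \<open>b x\<close>.
  The remainder \<open>R(x; \<zeta>)\<close> is the difference of \<open>r \<circ> \<Phi>\<^sub>x\<inverse>\<close> and its principal part.
  The symmetry of \<open>a\<close> says that the sum of the \<open>a\<^sub>j\<^sub>,\<^sub>k(x) \<zeta>\<^sub>1\<^sup>j cnj(\<zeta>\<^sub>1)\<^sup>k\<close> is real.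

  In the second clause the factor is \<open>\<partial>r/\<partial>z\<^sub>0(x)\<close>. If a map with the expansion below satisfied
  the clause with the conjugate factor \<open>\<partial>r/\<partial>cnj(z\<^sub>0)(x)\<close> instead, then, by holomorphy in \<open>\<epsilon>\<close> and by
  comparison of the terms of first order of \<open>r\<close> on the complex line \<open>x + (\<complex>, '0)\<close>,
  \<open>\<partial>r/\<partial>z\<^sub>0(x)\<close> would be real. So the clause below is implied by the conjugate one.
\<close>

definition cho_coordinates ::
    "'n \<Rightarrow> 'n \<Rightarrow> nat \<Rightarrow> (complex ^ 'n::finite) set \<Rightarrow> (complex ^ 'n \<Rightarrow> real)
       \<Rightarrow> (complex ^ 'n \<Rightarrow> complex ^ 'n \<Rightarrow> complex ^ 'n)
       \<Rightarrow> (complex ^ 'n \<Rightarrow> nat \<Rightarrow> nat \<Rightarrow> complex)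
       \<Rightarrow> (complex ^ 'n \<Rightarrow> 'n \<Rightarrow> nat \<Rightarrow> nat \<Rightarrow> complex) \<Rightarrow> bool" where
  "cho_coordinates i0 i1 m W r \<Phi> a b \<longleftrightarrow>
     (\<forall>x\<in>W. biholomorphism (\<Phi> x) \<and> \<Phi> x x = 0 \<and>
        (\<forall>\<epsilon>::real. \<Phi> x (x + axis i0 (- of_real \<epsilon>)) = axis i0 (- 2 * of_real \<epsilon> * dz i0 r x)) \<and>
        (\<forall>j k. a x k j = cnj (a x j k))) \<and>
     (\<exists>C \<delta>. 0 < \<delta> \<and>
        (\<forall>x\<in>W. \<forall>\<zeta>. norm \<zeta> < \<delta> \<longrightarrow> inv (\<Phi> x) \<zeta> \<in> W \<longrightarrow>
           \<bar>r (inv (\<Phi> x) \<zeta>) - (r x + cho_principal_part i0 i1 m (a x) (b x) \<zeta>)\<bar>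
             \<le> C * cho_error i0 i1 m \<zeta>))"

definition A_max :: "(nat \<Rightarrow> nat \<Rightarrow> complex) \<Rightarrow> nat \<Rightarrow> real" where
  "A_max a l = Max {cmod (a j k) | j k. 0 < j \<and> 0 < k \<and> j + k = l}"

text \<open>Indices \<open>l\<close> with \<open>A\<^sub>l = 0\<close> contribute \<open>(\<delta>/0)\<^bsup>1/l\<^esup> = \<infinity>\<close> to the minimum, so they are left out.\<close>

definition tau :: "nat \<Rightarrow> (nat \<Rightarrow> nat \<Rightarrow> complex) \<Rightarrow> real \<Rightarrow> real" where
  "tau m a \<delta> = Min {(\<delta> / A_max a l) powr (1 / real l) | l. 2 \<le> l \<and> l \<le> 2 * m \<and> A_max a l \<noteq> 0}"

definition scaling_map :: "'n \<Rightarrow> 'n \<Rightarrow> real \<Rightarrow> real \<Rightarrow> complex ^ 'n::finite \<Rightarrow> complex ^ 'n" where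
  "scaling_map i0 i1 \<epsilon> t \<zeta> =
     (\<chi> i. if i = i0 then \<zeta> $ i / of_real \<epsilon>
           else if i = i1 then \<zeta> $ i / of_real t
           else \<zeta> $ i / of_real (sqrt \<epsilon>))"

section \<open>Real polynomials in \<open>t\<close> and its conjugate\<close>

text \<open>\<open>c j k\<close> is the coefficient of \<open>t\<^sup>j cnj(t)\<^sup>k\<close>.\<close>

definition real_bipoly :: "(nat \<Rightarrow> nat \<Rightarrow> complex) \<Rightarrow> bool" where
  "real_bipoly c \<longleftrightarrow> finite {(j, k). c j k \<noteq> 0} \<and> (\<forall>j k. c k j = cnj (c j k))"

definition bipoly_eval :: "(nat \<Rightarrow> nat \<Rightarrow> complex) \<Rightarrow> complex \<Rightarrow> real" where
  "bipoly_eval c t = Re (\<Sum>(j, k)\<in>{(j, k). c j k \<noteq> 0}. c j k * t ^ j * cnj t ^ k)"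

definition bipoly_degree :: "(nat \<Rightarrow> nat \<Rightarrow> complex) \<Rightarrow> nat" where
  "bipoly_degree c = Max {j + k | j k. c j k \<noteq> 0}"

definition homogeneous_part :: "nat \<Rightarrow> (nat \<Rightarrow> nat \<Rightarrow> complex) \<Rightarrow> nat \<Rightarrow> nat \<Rightarrow> complex" where
  "homogeneous_part N c = (\<lambda>j k. if j + k = N then c j k else 0)"

definition no_harmonic_terms :: "(nat \<Rightarrow> nat \<Rightarrow> complex) \<Rightarrow> bool" where
  "no_harmonic_terms c \<longleftrightarrow> (\<forall>j>0. c j 0 = 0 \<and> c 0 j = 0)"

text \<open>Subharmonicity, for continuous functions.\<close>

definition subharmonic_on :: "complex set \<Rightarrow> (complex \<Rightarrow> real) \<Rightarrow> bool" where
  "subharmonic_on U f \<longleftrightarrow> continuous_on U f \<and>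
     (\<forall>z R. 0 < R \<longrightarrow> cball z R \<subseteq> U \<longrightarrow>
        f z \<le> integral {0..2 * pi} (\<lambda>\<theta>. f (z + of_real R * cis \<theta>)) / (2 * pi))"

definition model_function ::
    "'n \<Rightarrow> 'n \<Rightarrow> (nat \<Rightarrow> nat \<Rightarrow> complex) \<Rightarrow> complex ^ 'n::finite \<Rightarrow> real" where
  "model_function i0 i1 c z =
     Re (z $ i0) + bipoly_eval c (z $ i1) + (\<Sum>\<alpha>\<in>- {i0, i1}. (cmod (z $ \<alpha>))\<^sup>2)"

definition model_domain :: "'n \<Rightarrow> 'n \<Rightarrow> (nat \<Rightarrow> nat \<Rightarrow> complex) \<Rightarrow> (complex ^ 'n::finite) set" where
  "model_domain i0 i1 c = {z. model_function i0 i1 c z < 0}"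

section \<open>The scaling construction\<close>

definition psi ::
    "'n \<Rightarrow> 'n \<Rightarrow> nat \<Rightarrow> (complex ^ 'n::finite \<Rightarrow> complex ^ 'n \<Rightarrow> complex ^ 'n)
       \<Rightarrow> (complex ^ 'n \<Rightarrow> nat \<Rightarrow> nat \<Rightarrow> complex)
       \<Rightarrow> (nat \<Rightarrow> complex ^ 'n) \<Rightarrow> (nat \<Rightarrow> real) \<Rightarrow> nat \<Rightarrow> complex ^ 'n \<Rightarrow> complex ^ 'n" where
  "psi i0 i1 m \<Phi> a u \<epsilon> n =
     (let \<xi> = u n + axis i0 (of_real (\<epsilon> n))
      in scaling_map i0 i1 (\<epsilon> n) (tau m (a \<xi>) (\<epsilon> n)) \<circ> \<Phi> \<xi>)"

text \<open>
  The sequence \<open>s\<close> selects the subsequence, and \<open>c\<close> is the coefficient family of \<open>P\<close>.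
  Since \<open>r\<close> is meaningful on \<open>W\<close> only, \<open>r\<^sub>n\<close> is meaningful on \<open>\<psi>\<^sub>n(W)\<close>; locally uniform
  convergence on the whole space includes that these sets eventually contain each compact set.
\<close>

locale scaling_construction =
  fixes i0 i1 :: "'n::finite"
    and \<Omega> :: "(complex ^ 'n) set"
    and u :: "nat \<Rightarrow> complex ^ 'n"
    and m :: nat
    and W :: "(complex ^ 'n) set"
    and r :: "complex ^ 'n \<Rightarrow> real"
    and \<Phi> :: "complex ^ 'n \<Rightarrow> complex ^ 'n \<Rightarrow> complex ^ 'n"
    and a :: "complex ^ 'n \<Rightarrow> nat \<Rightarrow> nat \<Rightarrow> complex"
    and b :: "complex ^ 'n \<Rightarrow> 'n \<Rightarrow> nat \<Rightarrow> nat \<Rightarrow> complex"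
    and \<epsilon> :: "nat \<Rightarrow> real"
    and s :: "nat \<Rightarrow> nat"
    and c :: "nat \<Rightarrow> nat \<Rightarrow> complex"
    and m' :: nat
  assumes indices: "i0 \<noteq> i1"
    and domain: "levi_corank_one_domain \<Omega>"
    and sequence: "\<And>n. u n \<in> \<Omega>" "u \<longlonglongrightarrow> 0" "0 \<in> frontier \<Omega>"
    and defining: "0 \<in> W" "local_defining_function \<Omega> W r"
    and type_at_0: "dangelo_type r 0 = ereal (2 * real m)"
    and dz_at_0: "dz i0 r 0 = 1 / 2"
    and dz_bound: "\<exists>\<kappa>>0. \<forall>x\<in>W. \<kappa> \<le> cmod (dz i0 r x)"
    and levi_posdef:
      "\<And>x v. x \<in> W \<Longrightarrow> \<exists>\<alpha>\<in>- {i0, i1}. v \<alpha> \<noteq> 0 \<Longrightarrow>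
         (\<Sum>i\<in>- {i0, i1}. \<Sum>j\<in>- {i0, i1}.
            v i * cnj (v j) * levi r x (L_field i0 r i x) (L_field i0 r j x)) \<in> {q \<in> \<real>. 0 < Re q}"
    and levi_at_0:
      "\<And>i j. i \<in> - {i0, i1} \<Longrightarrow> j \<in> - {i0, i1} \<Longrightarrow>
         levi r 0 (L_field i0 r i 0) (L_field i0 r j 0) = (if i = j then 1 else 0)"
    and cho: "cho_coordinates i0 i1 m W r \<Phi> a b"
    and eps: "\<forall>\<^sub>F n in sequentially. 0 < \<epsilon> n \<and> u n + axis i0 (of_real (\<epsilon> n)) \<in> frontier \<Omega>"
      "\<epsilon> \<longlonglongrightarrow> 0"
    and subsequence: "strict_mono s"
    and limit:
      "\<And>K. compact K \<Longrightarrow>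
         (\<forall>\<^sub>F k in sequentially. K \<subseteq> psi i0 i1 m \<Phi> a u \<epsilon> (s k) ` W) \<and>
         uniform_limit K (\<lambda>k \<zeta>. r (inv (psi i0 i1 m \<Phi> a u \<epsilon> (s k)) \<zeta>) / \<epsilon> (s k))
           (model_function i0 i1 c) sequentially"
    and P_polynomial: "real_bipoly c" "\<exists>j k. c j k \<noteq> 0" "c 0 0 = 0" "no_harmonic_terms c"
    and P_degree: "bipoly_degree c = 2 * m'" "m' \<le> m"
    and P_subharmonic: "subharmonic_on UNIV (bipoly_eval c)"

section \<open>Scaling at infinity and the Kobayashi metric\<close>

definition dilation :: "'n \<Rightarrow> 'n \<Rightarrow> nat \<Rightarrow> nat \<Rightarrow> complex ^ 'n::finite \<Rightarrow> complex ^ 'n" where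
  "dilation i0 i1 m' n z =
     (\<chi> i. if i = i0 then of_real (real n powr (- 1)) * z $ i
           else if i = i1 then of_real (real n powr (- 1 / (2 * real m'))) * z $ i
           else of_real (real n powr (- 1 / 2)) * z $ i)"

definition kobayashi_metric :: "(complex ^ 'n::finite) set \<Rightarrow> complex ^ 'n \<Rightarrow> complex ^ 'n \<Rightarrow> real" where
  "kobayashi_metric D p X =
     Inf {cmod l | l f. (\<forall>i. (\<lambda>t. f t $ i) holomorphic_on ball 0 1) \<and> f ` ball 0 1 \<subseteq> D \<and>
                        f 0 = p \<and> (\<forall>i. deriv (\<lambda>t. f t $ i) 0 * l = X $ i)}"

end

theory Submission
  imports Defs
begin

text \<open>
  Upper semicontinuity of the metric follows by perturbing a slightly shrunk disc. Lower semicontinuity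
  needs that discs \<open>f\<close> in the domains \<open>{Re z\<^sub>0 + P\<^sub>n(z\<^sub>1) + |z\<^sub>*|\<^sup>2 < 0}\<close> with centres in a compact set form a
  normal family; limits of such discs stay inside the limit domain by the maximum principle.

  Normality rests on a bound for \<open>f\<^sub>1'\<close>. The function \<open>v = Re f\<^sub>0 + P\<^sub>n(f\<^sub>1) + |f\<^sub>*|\<^sup>2\<close> is negative and
  subharmonic on the disc, so it is not too negative at some point near any given one. At a point
  maximising a weighted \<open>|f\<^sub>1'|\<close>, on a small disc, \<open>f\<^sub>1\<close> is close to an affine map \<open>b + A w\<close>. By compactness
  of the set of normalised subharmonic polynomials without harmonic terms, the mean of \<open>P\<^sub>n(f\<^sub>1)\<close> over the
  boundary of this disc exceeds its central value by a multiple of the largest mixed coefficient of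
  \<open>P\<^sub>n(b + A w)\<close>, hence by a multiple of \<open>|A|\<close> to the power \<open>2m'\<close>, as the coefficients of top degree do not depend
  on \<open>b\<close>. Since \<open>v < 0\<close>, this bounds \<open>A\<close>. Then \<open>f\<^sub>1\<close>, \<open>f\<^sub>0\<close> (by Borel--Caratheodory) and \<open>f\<^sub>*\<close> are locally bounded.
\<close>

section \<open>Circle means of polynomials in \<open>w\<close> and its conjugate\<close>

text \<open>The model domains are unbounded, so Montel's theorem needs a bound on the discs that is
  uniform in \<open>n\<close>. The lower coefficients of \<open>P_n\<close> change with
  \<open>n\<close>, but those of degree \<open>2 * m'\<close> are fixed by the dilations, and they
  include a mixed one because \<open>P\<close> has no harmonic terms. The estimates for discs are
  therefore tied to a lower bound for the modulus of one mixed coefficient of top degree. Sub-mean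
  inequalities are proved together with their equality case, which the compactness argument needs.
  Both follow from differentiating circle means twice in the logarithm of the radius: a polynomial
  in a holomorphic \<open>f\<close> and its conjugate is a finite sum of products
  \<open>g * cnj h\<close> with \<open>g\<close> and \<open>h\<close> holomorphic, so no general
  potential theory is involved. Uniform convergence on compact sets comes from letting point and
  vector vary with \<open>n\<close> in the pointwise statement.\<close>

definition bieval :: "nat \<Rightarrow> (nat \<Rightarrow> nat \<Rightarrow> complex) \<Rightarrow> complex \<Rightarrow> real" where
  "bieval N q w = Re (\<Sum>j\<le>N. \<Sum>k\<le>N. q j k * w ^ j * cnj w ^ k)"

text \<open>The derivative \<open>\<partial>\<^sup>2/\<partial>w\<partial>cnj(w)\<close> of the polynomial \<open>bieval N q\<close>.\<close>

definition bilap :: "nat \<Rightarrow> (nat \<Rightarrow> nat \<Rightarrow> complex) \<Rightarrow> complex \<Rightarrow> real" where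
  "bilap N q w = Re (\<Sum>j\<le>N. \<Sum>k\<le>N. q j k * (of_nat j * w ^ (j - 1)) * cnj (of_nat k * w ^ (k - 1)))"

section \<open>Logarithmic polar coordinates\<close>

definition expcis :: "real \<Rightarrow> real \<Rightarrow> complex" where
  "expcis x \<theta> = of_real (exp x) * cis \<theta>"

lemma norm_expcis [simp]: "norm (expcis x \<theta>) = exp x"
  by (simp add: expcis_def norm_mult)

lemma expcis_nonzero [simp]: "expcis x \<theta> \<noteq> 0"
  by (simp add: expcis_def)

lemma expcis_0 [simp]: "expcis 0 \<theta> = cis \<theta>"
  by (simp add: expcis_def)

lemma continuous_on_expcis [continuous_intros]:
  "continuous_on S f \<Longrightarrow> continuous_on S g \<Longrightarrow> continuous_on S (\<lambda>x. expcis (f x) (g x))"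
  unfolding expcis_def cis_conv_exp by (intro continuous_intros)

text \<open>In logarithmic polar coordinates the radial derivative of a holomorphic \<open>g\<close>
  is the Euler operator \<open>z * g' z\<close>, and the angular one is \<open>\<i>\<close> times
  it. No powers of the radius appear, and the operator can be iterated.\<close>

lemma expcis_radius_derivative:
  "((\<lambda>x. expcis x \<theta>) has_vector_derivative expcis x \<theta>) (at x within S)"
proof -
  have "((\<lambda>x. of_real (exp x) :: complex) has_vector_derivative of_real (exp x)) (at x within S)"
    using has_field_derivative_at_within[OF DERIV_exp[of x]]
    by (intro has_vector_derivative_of_real) (simp add: has_real_derivative_iff_has_vector_derivative)
  then show ?thesis
    unfolding expcis_def by (rule has_vector_derivative_mult_left)
qed

lemma expcis_angle_derivative:
  "((\<lambda>\<theta>. expcis x \<theta>) has_vector_derivative \<i> * expcis x \<theta>) (at \<theta> within S)"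
proof -
  have "(cis has_vector_derivative \<i> * cis \<theta>) (at \<theta> within S)"
  proof -
    have "((\<lambda>t. exp (\<i> * of_real t)) has_vector_derivative \<i> * exp (\<i> * of_real \<theta>)) (at \<theta> within S)"
      by (rule derivative_eq_intros has_vector_derivative_real_field | simp)+
    then show ?thesis by (simp add: cis_conv_exp[abs_def])
  qed
  from has_vector_derivative_mult_right[OF this, of "of_real (exp x)"]
  show ?thesis
    unfolding expcis_def by (simp add: algebra_simps)
qed

lemma has_vector_derivative_compose_holo:
  assumes "(p has_vector_derivative p') (at x within S)" "(g has_field_derivative g') (at (p x))"
  shows "((\<lambda>x. g (p x)) has_vector_derivative p' * g') (at x within S)"
  using field_vector_diff_chain_within[OF assms(1) has_field_derivative_at_within[OF assms(2)]]
  by (simp add: o_def)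

text \<open>Differentiation gives the integrals of \<open>z * g' z * cnj (h z)\<close> and of
  \<open>g z * cnj (z * h' z)\<close>. They agree by integration by parts over the circle, so the
  derivative is twice either one. Having both forms lets a second derivative put one Euler operator
  on each factor.\<close>

lemma circle_integral_derivative:
  fixes g h g' h' :: "complex \<Rightarrow> complex"
  assumes g: "\<And>z. z \<in> ball 0 R \<Longrightarrow> (g has_field_derivative g' z) (at z)" "continuous_on (ball 0 R) g'"
    and h: "\<And>z. z \<in> ball 0 R \<Longrightarrow> (h has_field_derivative h' z) (at z)" "continuous_on (ball 0 R) h'"
    and x: "exp x < R"
  defines "I \<equiv> \<lambda>g h y. integral {0..2*pi} (\<lambda>\<theta>. g (expcis y \<theta>) * cnj (h (expcis y \<theta>)))"
  shows "(I g h has_vector_derivative 2 * I (\<lambda>z. z * g' z) h x) (at x)"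
    and "(I g h has_vector_derivative 2 * I g (\<lambda>z. z * h' z) x) (at x)"
proof -
  have R: "0 < R" using x by (rule less_trans[OF exp_gt_zero])
  let ?U = "{..<ln R}"
  have U: "y \<in> ?U \<longleftrightarrow> exp y < R" for y using R exp_less_cancel_iff[of y "ln R"] by simp
  have inb: "expcis y \<theta> \<in> ball 0 R" if "y \<in> ?U" for y \<theta> using that U by simp
  have cg: "continuous_on (ball 0 R) g" 
    by (meson DERIV_isCont continuous_at_imp_continuous_on g(1))
  have ch: "continuous_on (ball 0 R) h"
    by (meson DERIV_isCont continuous_at_imp_continuous_on h(1))
  have comp: "continuous_on S (\<lambda>p. G (expcis (u p) (v p)))" 
    if "continuous_on (ball 0 R) G" "continuous_on S u" "continuous_on S v" "\<And>p. p \<in> S \<Longrightarrow> u p \<in> ?U"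
    for G :: "complex \<Rightarrow> complex" and S :: "'z::topological_space set" and u v
    by (rule continuous_on_compose2[OF that(1)]) (use that inb in \<open>auto intro!: continuous_intros\<close>)
  let ?A = "\<lambda>y \<theta>. (expcis y \<theta> * g' (expcis y \<theta>)) * cnj (h (expcis y \<theta>))"
  let ?B = "\<lambda>y \<theta>. g (expcis y \<theta>) * cnj (expcis y \<theta> * h' (expcis y \<theta>))"
  have intA: "?A y integrable_on {0..2*pi}" if "y \<in> ?U" for y
    by (rule integrable_continuous_real) (use that in \<open>intro continuous_intros comp g h ch; simp\<close>)
  have intB: "?B y integrable_on {0..2*pi}" if "y \<in> ?U" for y
    by (rule integrable_continuous_real) (use that in \<open>intro continuous_intros comp g h cg; simp\<close>)
  have "((\<lambda>y. integral (cbox 0 (2*pi)) (\<lambda>\<theta>. g (expcis y \<theta>) * cnj (h (expcis y \<theta>))))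
      has_vector_derivative integral (cbox 0 (2*pi)) (\<lambda>\<theta>. ?B x \<theta> + ?A x \<theta>)) (at x within ?U)"
  proof (rule leibniz_rule_vector_derivative)
    fix y \<theta> assume y: "y \<in> ?U"
    show "((\<lambda>y. g (expcis y \<theta>) * cnj (h (expcis y \<theta>))) has_vector_derivative ?B y \<theta> + ?A y \<theta>) (at y within ?U)"
      using has_vector_derivative_mult[OF
          has_vector_derivative_compose_holo[OF expcis_radius_derivative g(1)[OF inb[OF y]]]
          has_vector_derivative_cnj[OF has_vector_derivative_compose_holo[OF expcis_radius_derivative h(1)[OF inb[OF y]]]]]
      by simp
    show "(\<lambda>\<theta>. g (expcis y \<theta>) * cnj (h (expcis y \<theta>))) integrable_on cbox 0 (2*pi)"
      by (rule integrable_continuous) (use y in \<open>intro continuous_intros comp cg ch; simp\<close>)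
  next
    show "continuous_on (?U \<times> cbox 0 (2*pi)) (\<lambda>(y, \<theta>). ?B y \<theta> + ?A y \<theta>)"
      unfolding split_beta by (intro continuous_intros comp g h cg ch) auto
  qed (use x U in auto)
  then have d: "(I g h has_vector_derivative integral {0..2*pi} (\<lambda>\<theta>. ?B x \<theta> + ?A x \<theta>)) (at x)"
    using x U by (simp add: I_def at_within_open[of x ?U])
  have expcis_2pi: "expcis x (2 * pi) = expcis x 0" by (simp add: expcis_def)
  \<comment> \<open>The integrand is the derivative of a function of period \<open>2 * pi\<close>,
    so its integral vanishes.\<close>
  have "((\<lambda>\<theta>. \<i> * (?A x \<theta> - ?B x \<theta>)) has_integral
      (g (expcis x (2*pi)) * cnj (h (expcis x (2*pi))) - g (expcis x 0) * cnj (h (expcis x 0)))) {0..2*pi}"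
  proof (rule fundamental_theorem_of_calculus)
    fix \<theta> :: real
    have y: "x \<in> ?U" using x U by simp
    show "((\<lambda>\<theta>. g (expcis x \<theta>) * cnj (h (expcis x \<theta>))) has_vector_derivative \<i> * (?A x \<theta> - ?B x \<theta>))
        (at \<theta> within {0..2*pi})"
      using has_vector_derivative_mult[OF
          has_vector_derivative_compose_holo[OF expcis_angle_derivative g(1)[OF inb[OF y]]]
          has_vector_derivative_cnj[OF has_vector_derivative_compose_holo[OF expcis_angle_derivative h(1)[OF inb[OF y]]]]]
      by (simp add: algebra_simps)
  qed simp
  then have "integral {0..2*pi} (\<lambda>\<theta>. \<i> * (?A x \<theta> - ?B x \<theta>)) = 0"
    unfolding expcis_2pi diff_self by (rule integral_unique)
  then have "integral {0..2*pi} (?A x) = integral {0..2*pi} (?B x)"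
    using intA[of x] intB[of x] x U by (simp add: integral_diff)
  moreover have "integral {0..2*pi} (\<lambda>\<theta>. ?B x \<theta> + ?A x \<theta>) = integral {0..2*pi} (?B x) + integral {0..2*pi} (?A x)"
    using intA[of x] intB[of x] x U by (intro integral_add) auto
  ultimately show "(I g h has_vector_derivative 2 * I (\<lambda>z. z * g' z) h x) (at x)"
    and "(I g h has_vector_derivative 2 * I g (\<lambda>z. z * h' z) x) (at x)"
    using d by (simp_all add: I_def)
qed

section \<open>Convexity of circle means in the logarithm of the radius\<close>

lemma convex_bounded_imp_derivative_nonneg:
  fixes N N1 N2 :: "real \<Rightarrow> real"
  assumes N: "\<And>x. x < X \<Longrightarrow> (N has_real_derivative N1 x) (at x)"
    and N1: "\<And>x. x < X \<Longrightarrow> (N1 has_real_derivative N2 x) (at x)"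
    and N2: "\<And>x. x < X \<Longrightarrow> 0 \<le> N2 x"
    and bd: "\<And>x. x \<le> x0 \<Longrightarrow> N x \<le> B"
    and x0: "x0 < X"
  shows "0 \<le> N1 x0"
proof (rule ccontr)
  assume "\<not> 0 \<le> N1 x0"
  then have neg: "N1 x0 < 0" by simp
  \<comment> \<open>A convex function lies above its tangent at \<open>x0\<close>. With negative
    slope this line tends to infinity as \<open>x\<close> tends to minus infinity, against the bound
    \<open>B\<close>.\<close>
  have lin: "N x0 - N1 x0 * (x0 - x) \<le> N x" if "x < x0" for x
  proof -
    have "\<exists>y>x. y < x0 \<and> N x0 - N x = (x0 - x) * N1 y"
      by (rule MVT2[OF that]) (use N x0 in auto)
    then obtain y where y: "y > x" "y < x0" "N x0 - N x = (x0 - x) * N1 y"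
      by blast
    have "N1 y \<le> N1 x0"
          proof (rule DERIV_nonneg_imp_nondecreasing[where f = N1])
      show "\<exists>d. (N1 has_real_derivative d) (at u) \<and> 0 \<le> d" if "u \<le> x0" for u
        using N1[of u] N2[of u] that x0 by (intro exI[of _ "N2 u"]) auto
    qed (use y in auto)
    then have "(x0 - x) * N1 y \<le> (x0 - x) * N1 x0"
      using that by (intro mult_left_mono) auto
    with y show ?thesis by (simp add: algebra_simps)
  qed
  define x where "x = x0 - (\<bar>B - N x0\<bar> + 1) / (- N1 x0)"
  have "x < x0" using neg by (simp add: x_def divide_pos_neg)
  have "N x0 + (\<bar>B - N x0\<bar> + 1) \<le> N x"
    using lin[OF \<open>x < x0\<close>] neg by (simp add: x_def)
  moreover have "N x \<le> B" using bd[of x] \<open>x < x0\<close> by simp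
  ultimately show False by linarith
qed

text \<open>As a function of the logarithm of the radius, \<open>V\<close> has as second derivative
  four times the integral of \<open>|z * f' z|^2 * bilap N q (f z)\<close>, so it is convex. Being
  bounded towards minus infinity it is nondecreasing, and its limit there is the central value. The
  second conclusion is the equality case: a constant mean forces the integrand of the second
  derivative to vanish.\<close>

lemma bieval_circle_mean:
  fixes f :: "complex \<Rightarrow> complex"
  assumes f: "f holomorphic_on ball 0 R"
    and lap: "\<And>z. z \<in> ball 0 R \<Longrightarrow> 0 \<le> bilap N q (f z)"
    and x: "exp x < R"
  defines "V \<equiv> \<lambda>y. integral {0..2*pi} (\<lambda>\<theta>. bieval N q (f (expcis y \<theta>)))"
  shows "2 * pi * bieval N q (f 0) \<le> V x"
    and "V x \<le> 2 * pi * bieval N q (f 0) \<Longrightarrow> y < x \<Longrightarrow> \<theta> \<in> {0..2*pi} \<Longrightarrow>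
           deriv f (expcis y \<theta>) = 0 \<or> bilap N q (f (expcis y \<theta>)) = 0"
proof -
  have R: "0 < R" using x by (rule less_trans[OF exp_gt_zero])
  define X where "X = ln R"
  have X: "y < X \<longleftrightarrow> exp y < R" for y using R exp_less_cancel_iff[of y "ln R"] by (simp add: X_def)
  have hol: "f holomorphic_on ball 0 R" "deriv f holomorphic_on ball 0 R"
    using f by (auto intro: holomorphic_deriv)
  have df: "(f has_field_derivative deriv f z) (at z)" if "z \<in> ball 0 R" for z
    using that f by (simp add: holomorphic_derivI)
  define G where "G j z = f z ^ j" for j z
  define G1 where "G1 j z = of_nat j * f z ^ (j - 1) * deriv f z" for j z
  have dG: "(G j has_field_derivative G1 j z) (at z)" if "z \<in> ball 0 R" for j z
    unfolding G_def G1_def by (rule derivative_eq_intros df that refl | simp add: that)+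
  have hG1: "G1 j holomorphic_on ball 0 R" for j
    unfolding G1_def by (intro holomorphic_intros hol)
  define H where "H j z = z * G1 j z" for j z
  have hH: "H j holomorphic_on ball 0 R" for j
    unfolding H_def by (intro holomorphic_intros hG1)
  have dH: "(H j has_field_derivative deriv (H j) z) (at z)" if "z \<in> ball 0 R" for j z
    using holomorphic_derivI[OF hH open_ball that] .
  have cont: "continuous_on (ball 0 R) (G1 j)" "continuous_on (ball 0 R) (deriv (H j))" 
     "continuous_on (ball 0 R) (G j)" "continuous_on (ball 0 R) (H j)" for j
    using hG1 hH hol by (auto intro!: holomorphic_on_imp_continuous_on holomorphic_deriv holomorphic_intros simp: G_def)
  define I where "I = (\<lambda>g h y. integral {0..2*pi} (\<lambda>\<theta>. g (expcis y \<theta>) * cnj (h (expcis y \<theta>))))"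
  have d1: "(I (G j) (G k) has_vector_derivative 2 * I (H j) (G k) y) (at y)" if "exp y < R" for j k y
    unfolding I_def
    by (rule circle_integral_derivative(1)[where R = R and g' = "G1 j" and h' = "G1 k", folded H_def]) (use dG cont that in auto)
  have d2: "(I (H j) (G k) has_vector_derivative 2 * I (H j) (H k) y) (at y)" if "exp y < R" for j k y
    unfolding I_def
    by (rule circle_integral_derivative(2)[where R = R and g' = "deriv (H j)" and h' = "G1 k", folded H_def])
       (use dG dH cont that in auto)
  have comp: "continuous_on {0..2*pi} (\<lambda>\<theta>. F (expcis y \<theta>))" 
    if "continuous_on (ball 0 R) F" "exp y < R" for F :: "complex \<Rightarrow> complex" and y
    by (rule continuous_on_compose2[OF that(1)]) (use that in \<open>auto intro!: continuous_intros\<close>)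
  have intg: "(\<lambda>\<theta>. g (expcis y \<theta>) * cnj (h (expcis y \<theta>))) integrable_on {0..2*pi}"
    if "continuous_on (ball 0 R) g" "continuous_on (ball 0 R) h" "exp y < R" for g h y
    by (rule integrable_continuous_real) (intro continuous_intros comp that)
  have sumI: "integral {0..2*pi} (\<lambda>\<theta>. Re (\<Sum>j\<le>N. \<Sum>k\<le>N. q j k * g j (expcis y \<theta>) * cnj (h k (expcis y \<theta>))))
      = Re (\<Sum>j\<le>N. \<Sum>k\<le>N. q j k * I (g j) (h k) y)"
    and intgI: "(\<lambda>\<theta>. Re (\<Sum>j\<le>N. \<Sum>k\<le>N. q j k * g j (expcis y \<theta>) * cnj (h k (expcis y \<theta>)))) integrable_on {0..2*pi}"
    if "\<And>j. continuous_on (ball 0 R) (g j)" "\<And>j. continuous_on (ball 0 R) (h j)" "exp y < R" for g h y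
  proof -
    have "((\<lambda>\<theta>. Re (\<Sum>j\<le>N. \<Sum>k\<le>N. q j k * (g j (expcis y \<theta>) * cnj (h k (expcis y \<theta>)))))
      has_integral Re (\<Sum>j\<le>N. \<Sum>k\<le>N. q j k * I (g j) (h k) y)) {0..2*pi}"
      unfolding I_def
      by (intro has_integral_Re has_integral_sum has_integral_mult_right integrable_integral intg that) auto
    then have "((\<lambda>\<theta>. Re (\<Sum>j\<le>N. \<Sum>k\<le>N. q j k * g j (expcis y \<theta>) * cnj (h k (expcis y \<theta>))))
      has_integral Re (\<Sum>j\<le>N. \<Sum>k\<le>N. q j k * I (g j) (h k) y)) {0..2*pi}"
      by (simp add: mult.assoc)
    then show "integral {0..2*pi} (\<lambda>\<theta>. Re (\<Sum>j\<le>N. \<Sum>k\<le>N. q j k * g j (expcis y \<theta>) * cnj (h k (expcis y \<theta>))))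
      = Re (\<Sum>j\<le>N. \<Sum>k\<le>N. q j k * I (g j) (h k) y)" 
      "(\<lambda>\<theta>. Re (\<Sum>j\<le>N. \<Sum>k\<le>N. q j k * g j (expcis y \<theta>) * cnj (h k (expcis y \<theta>)))) integrable_on {0..2*pi}"
      by (auto simp: integral_unique integrable_on_def)
  qed
  \<comment> \<open>The mean and its first two derivatives. \<open>N1\<close> uses the first form of
    the derivative of \<open>I\<close> and \<open>N2\<close> the second, so that \<open>N2\<close>
    pairs \<open>H j\<close> with the conjugate of \<open>H k\<close>.\<close>
  define N0 where "N0 y = Re (\<Sum>j\<le>N. \<Sum>k\<le>N. q j k * I (G j) (G k) y)" for y
  define N1 where "N1 y = Re (\<Sum>j\<le>N. \<Sum>k\<le>N. q j k * (2 * I (H j) (G k) y))" for y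
  define N2 where "N2 y = Re (\<Sum>j\<le>N. \<Sum>k\<le>N. q j k * (2 * (2 * I (H j) (H k) y)))" for y
  have VN0: "V y = N0 y" if "exp y < R" for y
    using sumI[of G G y] that cont by (simp add: V_def N0_def bieval_def G_def)
  let ?L = "\<lambda>y \<theta>. (exp y)\<^sup>2 * (cmod (deriv f (expcis y \<theta>)))\<^sup>2 * bilap N q (f (expcis y \<theta>))"
  \<comment> \<open>\<open>H j\<close> and \<open>H k\<close> share the factor
    \<open>z * f' z\<close>; what remains is the sum defining \<open>bilap\<close>.\<close>
  have L: "?L y \<theta> = Re (\<Sum>j\<le>N. \<Sum>k\<le>N. q j k * H j (expcis y \<theta>) * cnj (H k (expcis y \<theta>)))" for y \<theta>
  proof -
    let ?z = "expcis y \<theta>"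
    have "(\<Sum>j\<le>N. \<Sum>k\<le>N. q j k * H j ?z * cnj (H k ?z)) = ((?z * deriv f ?z) * cnj (?z * deriv f ?z)) * 
       (\<Sum>j\<le>N. \<Sum>k\<le>N. q j k * (of_nat j * f ?z ^ (j - 1)) * cnj (of_nat k * f ?z ^ (k - 1)))"
      unfolding sum_distrib_left H_def G1_def
      by (intro sum.cong refl) (simp add: algebra_simps)
    also have "(?z * deriv f ?z) * cnj (?z * deriv f ?z) = of_real ((exp y)\<^sup>2 * (cmod (deriv f ?z))\<^sup>2)"
      by (subst complex_norm_square[symmetric]) (simp add: norm_mult power_mult_distrib)
    finally show ?thesis by (simp add: bilap_def)
  qed
  have N2L: "N2 y = 4 * integral {0..2*pi} (?L y)" if "exp y < R" for y
  proof -
    have "N2 y = 4 * Re (\<Sum>j\<le>N. \<Sum>k\<le>N. q j k * I (H j) (H k) y)"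
      by (simp add: N2_def sum_distrib_left algebra_simps)
    then show ?thesis using sumI[of H H y] that cont L by simp
  qed
  have Lnn: "0 \<le> ?L y \<theta>" if "exp y < R" for y \<theta>
    using lap[of "expcis y \<theta>"] that by simp
  have deriv0: "(N0 has_real_derivative N1 y) (at y)" if "y < X" for y
    unfolding N0_def N1_def has_real_derivative_iff_has_vector_derivative
    by (rule bounded_linear.has_vector_derivative[OF bounded_linear_Re], intro has_vector_derivative_sum has_vector_derivative_mult_right d1)
       (use that X in auto)
  have deriv1: "(N1 has_real_derivative N2 y) (at y)" if "y < X" for y
    unfolding N1_def N2_def has_real_derivative_iff_has_vector_derivative
    by (rule bounded_linear.has_vector_derivative[OF bounded_linear_Re], intro has_vector_derivative_sum has_vector_derivative_mult_right d2)
       (use that X in auto)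
  have N2nn: "0 \<le> N2 y" if "y < X" for y
  proof -
    have "0 \<le> integral {0..2*pi} (?L y)"
      by (rule integral_nonneg) (use intgI[of H H y] that X cont L Lnn in auto)
    then show ?thesis using N2L[of y] that X by simp
  qed
  define v where "v z = bieval N q (f z)" for z
  have cv: "continuous_on (ball 0 R) v"
    unfolding v_def bieval_def by (intro continuous_intros holomorphic_on_imp_continuous_on f)
  have cvx: "continuous_on {0..2*pi} (\<lambda>\<theta>. v (expcis y \<theta>))" if "exp y < R" for y
    by (rule continuous_on_compose2[OF cv]) (use that in \<open>auto intro!: continuous_intros\<close>)
  have N1nn: "0 \<le> N1 y" if y: "y < X" for y
  proof -
    have "compact (v ` cball 0 (exp y))"
      by (rule compact_continuous_image[OF continuous_on_subset[OF cv] compact_cball])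
         (use y X[of y] in \<open>simp add: cball_subset_ball_iff\<close>)
    then have "bounded (v ` cball 0 (exp y))"
      by (rule compact_imp_bounded)
    then obtain B where B: "\<And>z. z \<in> cball 0 (exp y) \<Longrightarrow> norm (v z) \<le> B"
      unfolding bounded_iff by blast
    have bdd: "N0 u \<le> 2 * pi * B" if u: "u \<le> y" for u
    proof -
      have eu: "exp u < R" using X[of u] u y by simp
      have "V u \<le> integral {0..2*pi} (\<lambda>\<theta>. B)"
        unfolding V_def
      proof (rule integral_le)
        show "(\<lambda>\<theta>. bieval N q (f (expcis u \<theta>))) integrable_on {0..2*pi}"
          using cvx[OF eu] unfolding v_def by (rule integrable_continuous_real)
        show "bieval N q (f (expcis u \<theta>)) \<le> B" for \<theta>
          using B[of "expcis u \<theta>"] u unfolding v_def by simp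
      qed (auto intro: integrable_continuous_real)
      then show ?thesis using VN0[OF eu] by simp
    qed
    show ?thesis
      by (rule convex_bounded_imp_derivative_nonneg[OF deriv0 deriv1 N2nn bdd y])
  qed
  have mono: "N0 y \<le> N0 y'" if "y \<le> y'" "y' < X" for y y'
      proof (rule DERIV_nonneg_imp_nondecreasing[where f = N0])
    show "\<exists>d. (N0 has_real_derivative d) (at u) \<and> 0 \<le> d" if "u \<le> y'" for u
      using deriv0[of u] N1nn[of u] that \<open>y' < X\<close> by (intro exI[of _ "N1 u"]) auto
  qed (use that in auto)
  have lower: "2 * pi * v 0 \<le> N0 y" if y: "y < X" for y
  proof (rule field_le_epsilon)
    fix e :: real assume e: "0 < e"
    have "isCont v 0" using cv R by (simp add: continuous_on_eq_continuous_at)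
    then obtain d where d: "d > 0" "\<And>z. dist z 0 < d \<Longrightarrow> dist (v z) (v 0) < e / (2 * pi)"
      using e unfolding continuous_at_eps_delta by (auto dest!: spec[of _ "e / (2 * pi)"])
    \<comment> \<open>A circle on which \<open>v\<close> exceeds \<open>v 0 - e / (2 * pi)\<close>,
      and no larger than that of \<open>y\<close>, so that monotonicity applies.\<close>
    define u where "u = min y (ln (d / 2))"
    have u: "u \<le> y" "exp u < d" 
    proof -
      have "exp u \<le> exp (ln (d/2))" unfolding u_def by simp
      then show "exp u < d" using d(1) by simp
    qed (simp add: u_def)
    have eu: "exp u < R" using X[of u] u y by simp
    have "integral {0..2*pi} (\<lambda>\<theta>. v 0 - e / (2 * pi)) \<le> V u"
      unfolding V_def
    proof (rule integral_le)
      show "(\<lambda>\<theta>. bieval N q (f (expcis u \<theta>))) integrable_on {0..2*pi}"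
        using cvx[OF eu] unfolding v_def by (rule integrable_continuous_real)
      show "v 0 - e / (2 * pi) \<le> bieval N q (f (expcis u \<theta>))" for \<theta>
        using d(2)[of "expcis u \<theta>"] u unfolding v_def by (simp add: dist_real_def abs_less_iff)
    qed (auto intro: integrable_continuous_real)
    then have "2 * pi * v 0 - e \<le> N0 u" using VN0[OF eu] by (simp add: algebra_simps)
    also have "\<dots> \<le> N0 y" by (rule mono) (use u y in auto)
    finally show "2 * pi * v 0 \<le> N0 y + e" by simp
  qed
  show "2 * pi * bieval N q (f 0) \<le> V x"
    using lower[of x] VN0[OF x] X x by (simp add: v_def)
  show "deriv f (expcis y \<theta>) = 0 \<or> bilap N q (f (expcis y \<theta>)) = 0"
    if le: "V x \<le> 2 * pi * bieval N q (f 0)" and y: "y < x" and \<theta>: "\<theta> \<in> {0..2*pi}"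
  proof -
    have xX: "x < X" using x X by simp
    \<comment> \<open>Squeezed between the central value and the value at \<open>x\<close>, the mean
      is constant to the left of \<open>x\<close>, so both derivatives vanish there.\<close>
    have const: "N0 u = 2 * pi * v 0" if "u < x" for u
      using mono[of u x] lower[of u] le VN0[OF x] that xX by (simp add: v_def)
    have n1: "N1 u = 0" if "u < x" for u
    proof -
      have "(N0 has_real_derivative 0) (at u)"
        by (rule has_field_derivative_transform_within_open[where f = "\<lambda>_. 2 * pi * v 0" and S = "{..<x}"])
           (use that const in auto)
      then show ?thesis using DERIV_unique[OF deriv0[of u]] that xX by simp
    qed
    have "N2 y = 0"
    proof -
      have "(N1 has_real_derivative 0) (at y)"
        by (rule has_field_derivative_transform_within_open[where f = "\<lambda>_. 0" and S = "{..<x}"])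
           (use y n1 in auto)
      then show ?thesis using DERIV_unique[OF deriv1[of y]] y xX by simp
    qed
    moreover have ey: "exp y < R" using X[of y] y xX by simp
    ultimately have "integral {0..2*pi} (?L y) = 0" using N2L by simp
    moreover have "continuous_on {0..2*pi} (?L y)"
      unfolding L by (intro continuous_intros comp cont ey)
    ultimately have "?L y \<theta> = 0"
      using integral_eq_0_iff[of 0 "2*pi" "?L y"] Lnn[OF ey] \<theta> by simp
    then show ?thesis by simp
  qed
qed

lemma bieval_submean:
  fixes f :: "complex \<Rightarrow> complex"
  assumes f: "f holomorphic_on ball a R"
    and lap: "\<And>z. z \<in> ball a R \<Longrightarrow> 0 \<le> bilap N q (f z)"
    and s: "0 < s" "s < R"
  shows "2 * pi * bieval N q (f a) \<le> integral {0..2*pi} (\<lambda>\<theta>. bieval N q (f (a + of_real s * cis \<theta>)))"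
proof -
  have "(f \<circ> (\<lambda>z. a + z)) holomorphic_on ball 0 R"
    by (rule holomorphic_on_compose_gen[OF _ f]) (auto intro!: holomorphic_intros simp: dist_norm)
  from bieval_circle_mean(1)[OF this, of N q "ln s"] lap s show ?thesis
    by (simp add: expcis_def dist_norm)
qed

lemma continuous_bilap [continuous_intros]:
  "continuous_on S f \<Longrightarrow> continuous_on S (\<lambda>x. bilap N q (f x))"
  unfolding bilap_def by (intro continuous_intros)

lemma continuous_bieval [continuous_intros]:
  "continuous_on S f \<Longrightarrow> continuous_on S (\<lambda>x. bieval N q (f x))"
  unfolding bieval_def by (intro continuous_intros)

lemma bieval_uminus: "bieval N (\<lambda>j k. - q j k) w = - bieval N q w"
  by (simp add: bieval_def sum_negf)

lemma bilap_uminus: "bilap N (\<lambda>j k. - q j k) w = - bilap N q w"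
  by (simp add: bilap_def sum_negf)

text \<open>If the Laplacian were negative at \<open>w\<close>, the polynomial with coefficients
  \<open>- q j k\<close> would have positive Laplacian on a disc about \<open>w\<close>, while the
  hypothesis bounds its mean above by its central value. The equality case along the disc
  \<open>w + z\<close>, whose derivative is 1, excludes this.\<close>

lemma submean_imp_bilap_nonneg:
  assumes sub: "\<And>z R. 0 < R \<Longrightarrow>
      2 * pi * bieval N q z \<le> integral {0..2*pi} (\<lambda>\<theta>. bieval N q (z + of_real R * cis \<theta>))"
  shows "0 \<le> bilap N q w"
proof (rule ccontr)
  assume "\<not> 0 \<le> bilap N q w"
  then have neg: "0 < bilap N (\<lambda>j k. - q j k) w" by (simp add: bilap_uminus)
  have "isCont (bilap N (\<lambda>j k. - q j k)) w"
    using continuous_bilap[OF continuous_on_id, of UNIV N] by (simp add: continuous_on_eq_continuous_at)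
  then obtain d where d: "d > 0"
    "\<And>z. dist z w < d \<Longrightarrow> dist (bilap N (\<lambda>j k. - q j k) z) (bilap N (\<lambda>j k. - q j k) w) < bilap N (\<lambda>j k. - q j k) w"
    using neg unfolding continuous_at_eps_delta by blast
  have pos: "0 < bilap N (\<lambda>j k. - q j k) (w + z)" if "z \<in> ball 0 d" for z
    using d(2)[of "w + z"] that by (simp add: dist_norm abs_less_iff)
  have "integral {0..2*pi} (\<lambda>\<theta>. bieval N (\<lambda>j k. - q j k) (w + expcis (ln (d/2)) \<theta>))
      \<le> 2 * pi * bieval N (\<lambda>j k. - q j k) (w + 0)"
    using sub[of "d/2" w] d(1) by (simp add: bieval_uminus expcis_def)
  from bieval_circle_mean(2)[OF _ _ _ this, of d "ln (d/4)" 0] holomorphic_on_add[OF holomorphic_on_const[of w] holomorphic_on_ident[of "ball 0 d"]]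
  have "deriv (\<lambda>z. w + z) (expcis (ln (d/4)) 0) = 0 \<or> bilap N (\<lambda>j k. - q j k) (w + expcis (ln (d/4)) 0) = 0"
    using d(1) pos by (force simp: less_imp_le)
  moreover have "deriv (\<lambda>z. w + z) z = 1" for z
    by (rule DERIV_imp_deriv) (auto intro!: derivative_eq_intros)
  ultimately show False using pos[of "expcis (ln (d/4)) 0"] d(1) by auto
qed

section \<open>Uniqueness of coefficients\<close>

lemma coefficients_of_sum_of_powers_eq_0:
  fixes a :: "'p \<Rightarrow> complex"
  assumes "finite S" "infinite Z" and zero: "\<And>z. z \<in> Z \<Longrightarrow> (\<Sum>p\<in>S. a p * z ^ e p) = 0"
  shows "(\<Sum>p\<in>{p \<in> S. e p = i}. a p) = 0"
proof (cases "\<exists>p\<in>S. e p = i")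
  case True
  define M where "M = Max (e ` S)"
  have M: "e p \<le> M" if "p \<in> S" for p
    using that assms(1) by (simp add: M_def)
  have "(\<Sum>l\<le>M. (\<Sum>p\<in>{p \<in> S. e p = l}. a p) * z ^ l) = (\<Sum>p\<in>S. a p * z ^ e p)" for z
  proof -
    have "(\<Sum>l\<le>M. (\<Sum>p\<in>{p \<in> S. e p = l}. a p) * z ^ l) = (\<Sum>l\<le>M. \<Sum>p\<in>{p \<in> S. e p = l}. a p * z ^ e p)"
      by (intro sum.cong refl) (simp add: sum_distrib_right)
    also have "\<dots> = (\<Sum>p\<in>S. a p * z ^ e p)"
      by (rule sum.group) (use assms(1) M in auto)
    finally show ?thesis .
  qed
  then have "Z \<subseteq> {z. (\<Sum>l\<le>M. (\<Sum>p\<in>{p \<in> S. e p = l}. a p) * z ^ l) = 0}"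
    using zero by auto
  then have "infinite {z. (\<Sum>l\<le>M. (\<Sum>p\<in>{p \<in> S. e p = l}. a p) * z ^ l) = 0}"
    using \<open>infinite Z\<close> infinite_super by blast
  then show ?thesis using True M unfolding polyfun_finite_roots by auto
qed (auto intro: sum.neutral)

lemma infinite_unit_circle: "infinite {z::complex. norm z = 1}"
proof
  assume "finite {z::complex. norm z = 1}"
  then have "finite (Re ` {z::complex. norm z = 1})" by simp
  moreover have "{0..1} \<subseteq> Re ` {z::complex. norm z = 1}"
  proof
    fix x :: real assume "x \<in> {0..1}"
    then show "x \<in> Re ` {z::complex. norm z = 1}"
      by (intro image_eqI[of _ _ "Complex x (sqrt (1 - x\<^sup>2))"]) (auto simp: cmod_def abs_square_le_1)
  qed
  ultimately show False using finite_subset by (fastforce simp: infinite_Icc)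
qed

text \<open>At \<open>w = s * z\<close> with \<open>z\<close> on the unit circle a monomial is
  \<open>s ^ (j + k)\<close> times \<open>z\<close> to the power \<open>j - k\<close>. Varying
  \<open>z\<close> isolates the terms with a given difference of exponents, varying \<open>s\<close>
  those with a given sum, and the two determine the pair.\<close>

lemma bipoly_coefficients_eq_0:
  assumes zero: "\<And>w. 0 < norm w \<Longrightarrow> norm w < 1 \<Longrightarrow> (\<Sum>j\<le>N. \<Sum>k\<le>N. q j k * w ^ j * cnj w ^ k) = (0::complex)"
    and jk: "j \<le> N" "k \<le> N"
  shows "q j k = 0"
proof -
  define S where "S = {..N} \<times> {..N}"
  \<comment> \<open>The exponent of \<open>z\<close> is shifted by \<open>N\<close>; since
    \<open>snd p \<le> N\<close>, the natural subtraction is then exact.\<close>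
  define S' where "S' = {p \<in> S. N + fst p - snd p = N + j - k}"
  have fin: "finite S" "finite S'" by (auto simp: S_def S'_def)
  have "(\<Sum>p\<in>S'. q (fst p) (snd p) * of_real s ^ (fst p + snd p)) = 0" if s: "0 < s" "s < 1" for s :: real
    unfolding S'_def
  proof (rule coefficients_of_sum_of_powers_eq_0[OF fin(1) infinite_unit_circle])
    fix z :: complex assume "z \<in> {z. norm z = 1}"
    then have z: "norm z = 1" by simp
    then have zz: "z * cnj z = 1" by (simp add: complex_norm_square[symmetric])
    have "(\<Sum>p\<in>S. q (fst p) (snd p) * of_real s ^ (fst p + snd p) * z ^ (N + fst p - snd p))
        = (\<Sum>p\<in>S. z ^ N * (q (fst p) (snd p) * (of_real s * z) ^ fst p * cnj (of_real s * z) ^ snd p))"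
    proof (rule sum.cong[OF refl])
      fix p assume p: "p \<in> S"
      have "z ^ N = z ^ (N - snd p) * z ^ snd p"
        using p by (simp add: S_def flip: power_add) auto
      then have "z ^ N * z ^ fst p * cnj z ^ snd p = z ^ (N - snd p) * z ^ fst p * (z * cnj z) ^ snd p"
        by (simp add: power_mult_distrib)
      also have "\<dots> = z ^ (N + fst p - snd p)"
        using p unfolding zz by (auto simp add: S_def simp flip: power_add)
      finally show "q (fst p) (snd p) * of_real s ^ (fst p + snd p) * z ^ (N + fst p - snd p)
        = z ^ N * (q (fst p) (snd p) * (of_real s * z) ^ fst p * cnj (of_real s * z) ^ snd p)"
        by (simp add: power_mult_distrib power_add mult_ac)
    qed
    also have "\<dots> = z ^ N * (\<Sum>j\<le>N. \<Sum>k\<le>N. q j k * (of_real s * z) ^ j * cnj (of_real s * z) ^ k)"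
      unfolding S_def sum_distrib_left[symmetric] sum.cartesian_product by (simp add: case_prod_beta)
    also have "\<dots> = 0"
      using zero[of "of_real s * z"] s z by (simp add: norm_mult)
    finally show "(\<Sum>p\<in>S. q (fst p) (snd p) * of_real s ^ (fst p + snd p) * z ^ (N + fst p - snd p)) = 0" .
  qed
  then have "(\<Sum>p\<in>{p \<in> S'. fst p + snd p = j + k}. q (fst p) (snd p)) = 0"
    by (intro coefficients_of_sum_of_powers_eq_0[OF fin(2), where Z = "complex_of_real ` {0<..<1}"])
       (auto simp: finite_image_iff inj_on_def infinite_Ioo)
  moreover have "{p \<in> S'. fst p + snd p = j + k} = {(j, k)}"
    using jk by (auto simp: S'_def S_def)
  ultimately show ?thesis by simp
qed

text \<open>Real-valued polynomials of bounded total degree: the symmetry ensures that the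
  \<open>Re\<close> in \<open>bieval\<close> discards nothing, the degree bound that its range
  \<open>j, k \<le> N\<close> misses no coefficient.\<close>

definition hermitian_upto :: "nat \<Rightarrow> (nat \<Rightarrow> nat \<Rightarrow> complex) \<Rightarrow> bool" where
  "hermitian_upto N q \<longleftrightarrow> (\<forall>j k. q k j = cnj (q j k)) \<and> (\<forall>j k. N < j + k \<longrightarrow> q j k = 0)"

text \<open>By the binomial theorem a monomial \<open>(j, k)\<close> contributes to
  \<open>(p, r)\<close> only if \<open>p \<le> j\<close> and \<open>r \<le> k\<close>. For
  \<open>p + r = N\<close> only \<open>(p, r)\<close> itself is left, which makes the top
  coefficients independent of the base point \<open>b\<close>.\<close>

lemma bieval_affine:
  assumes q: "hermitian_upto N q"
  obtains q' where "hermitian_upto N q'" "\<And>w. bieval N q (b + A * w) = bieval N q' w"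
    "\<And>j k. j + k = N \<Longrightarrow> q' j k = q j k * A ^ j * cnj A ^ k"
proof -
  have qs: "N < j + k \<Longrightarrow> q j k = 0" and qh: "q k j = cnj (q j k)" for j k
    using q unfolding hermitian_upto_def by blast+
  define u where "u j p = of_nat (j choose p) * b ^ (j - p) * A ^ p" for j p
  define q' where "q' p r = (\<Sum>j\<le>N. \<Sum>k\<le>N. q j k * u j p * cnj (u k r))" for p r
  have u0: "u j p = 0" if "j < p" for j p using that by (simp add: u_def)
  have pow: "(b + A * w) ^ j = (\<Sum>p\<le>N. u j p * w ^ p)" if "j \<le> N" for j w
  proof -
    have "(b + A * w) ^ j = (\<Sum>p\<le>j. u j p * w ^ p)"
      unfolding add.commute[of b] binomial_ring u_def
      by (intro sum.cong refl) (simp add: power_mult_distrib)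
    also have "\<dots> = (\<Sum>p\<le>N. u j p * w ^ p)"
      by (rule sum.mono_neutral_left) (use that u0 in auto)
    finally show ?thesis .
  qed
  show thesis
  proof (rule that[of q'])
    have sup: "q' p r = 0" if "N < p + r" for p r
      unfolding q'_def
    proof (intro sum.neutral ballI)
      fix j k
      show "q j k * u j p * cnj (u k r) = 0"
      proof (cases "j < p \<or> k < r")
        case False
        then have "N < j + k" using that by simp
        then show ?thesis by (simp add: qs)
      qed (use u0 in auto)
    qed
    have "q' r p = cnj (q' p r)" for p r
    proof -
      have "q' r p = (\<Sum>k\<le>N. \<Sum>j\<le>N. q j k * u j r * cnj (u k p))"
        unfolding q'_def by (rule sum.swap)
      also have "\<dots> = (\<Sum>k\<le>N. \<Sum>j\<le>N. cnj (q k j * u k p * cnj (u j r)))"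
        by (intro sum.cong refl) (subst qh, simp)
      finally show ?thesis unfolding q'_def by simp
    qed
    with sup show "hermitian_upto N q'" unfolding hermitian_upto_def by blast
    show "bieval N q (b + A * w) = bieval N q' w" for w
    proof -
      have "(\<Sum>j\<le>N. \<Sum>k\<le>N. q j k * (b + A * w) ^ j * cnj (b + A * w) ^ k)
        = (\<Sum>j\<le>N. \<Sum>k\<le>N. q j k * (\<Sum>p\<le>N. u j p * w ^ p) * cnj (\<Sum>r\<le>N. u k r * w ^ r))"
        by (intro sum.cong refl) (simp flip: pow)
      also have "\<dots> = (\<Sum>j\<le>N. \<Sum>k\<le>N. \<Sum>p\<le>N. \<Sum>r\<le>N. q j k * u j p * cnj (u k r) * w ^ p * cnj w ^ r)"
        by (simp add: sum_distrib_left sum_distrib_right mult_ac)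
      also have "\<dots> = (\<Sum>j\<le>N. \<Sum>p\<le>N. \<Sum>k\<le>N. \<Sum>r\<le>N. q j k * u j p * cnj (u k r) * w ^ p * cnj w ^ r)"
        by (intro sum.cong refl sum.swap)
      also have "\<dots> = (\<Sum>p\<le>N. \<Sum>j\<le>N. \<Sum>k\<le>N. \<Sum>r\<le>N. q j k * u j p * cnj (u k r) * w ^ p * cnj w ^ r)"
        by (rule sum.swap)
      also have "\<dots> = (\<Sum>p\<le>N. \<Sum>j\<le>N. \<Sum>r\<le>N. \<Sum>k\<le>N. q j k * u j p * cnj (u k r) * w ^ p * cnj w ^ r)"
        by (intro sum.cong refl sum.swap)
      also have "\<dots> = (\<Sum>p\<le>N. \<Sum>r\<le>N. \<Sum>j\<le>N. \<Sum>k\<le>N. q j k * u j p * cnj (u k r) * w ^ p * cnj w ^ r)"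
        by (intro sum.cong refl sum.swap)
      also have "\<dots> = (\<Sum>p\<le>N. \<Sum>r\<le>N. q' p r * w ^ p * cnj w ^ r)"
        by (simp add: q'_def sum_distrib_right)
      finally show ?thesis by (simp add: bieval_def)
    qed
    show "q' p r = q p r * A ^ p * cnj A ^ r" if pr: "p + r = N" for p r
    proof -
      have z: "q j k * u j p * cnj (u k r) = 0" if "(j, k) \<noteq> (p, r)" for j k
      proof (cases "j < p \<or> k < r")
        case False
        then have "N < j + k" using that pr by auto
        then show ?thesis by (simp add: qs)
      qed (use u0 in auto)
      have "q' p r = (\<Sum>x\<in>{..N}\<times>{..N}. q (fst x) (snd x) * u (fst x) p * cnj (u (snd x) r))"
        unfolding q'_def sum.cartesian_product by (simp add: case_prod_beta)
      also have "\<dots> = (\<Sum>x\<in>{(p, r)}. q (fst x) (snd x) * u (fst x) p * cnj (u (snd x) r))"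
      proof (rule sum.mono_neutral_right)
        show "\<forall>x\<in>{..N}\<times>{..N} - {(p, r)}. q (fst x) (snd x) * u (fst x) p * cnj (u (snd x) r) = 0"
          by (intro ballI z) auto
      qed (use pr in auto)
      finally show ?thesis by (simp add: u_def)
    qed
  qed
qed

section \<open>A lower bound for the mean along almost affine discs\<close>

text \<open>Takes the place of a diagonal argument: finitely many properties, each attainable along
  a subsequence and inherited by further ones. It serves for the coefficients of polynomials and,
  later, for the components of discs.\<close>

lemma common_subsequence:
  fixes C :: "'i \<Rightarrow> (nat \<Rightarrow> nat) \<Rightarrow> bool" and s0 :: "nat \<Rightarrow> nat"
  assumes "finite I" "strict_mono s0"
    and ex: "\<And>i (s::nat \<Rightarrow> nat). i \<in> I \<Longrightarrow> strict_mono s \<Longrightarrow> \<exists>r. strict_mono r \<and> C i (s \<circ> r)"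
    and sub: "\<And>i (s::nat \<Rightarrow> nat) r. i \<in> I \<Longrightarrow> C i s \<Longrightarrow> strict_mono r \<Longrightarrow> C i (s \<circ> r)"
  shows "\<exists>r. strict_mono r \<and> (\<forall>i\<in>I. C i (s0 \<circ> r))"
  using assms(1,3,4)
proof (induction I rule: finite_induct)
  case empty
  show ?case by (rule exI[of _ "id :: nat \<Rightarrow> nat"]) (simp add: strict_mono_def)
next
  case (insert i I)
  then obtain r where r: "strict_mono r" "\<forall>j\<in>I. C j (s0 \<circ> r)"
    by (metis insertCI)
  obtain r' where r': "strict_mono r'" "C i ((s0 \<circ> r) \<circ> r')"
    using insert.prems(1)[of i "s0 \<circ> r"] strict_mono_o[OF assms(2) r(1)] by blast
  have "C j (s0 \<circ> (r \<circ> r'))" if "j \<in> insert i I" for j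
    unfolding o_assoc using that r r' insert.prems(2)[of j "s0 \<circ> r" r'] by blast
  then show ?case
    using strict_mono_o[OF r(1) r'(1)] by blast
qed

lemma bounded_complex_subsequence:
  fixes x :: "nat \<Rightarrow> complex"
  assumes "\<And>n. norm (x n) \<le> B"
  shows "\<exists>r l. strict_mono r \<and> (x \<circ> r) \<longlonglongrightarrow> l"
proof -
  have "seq_compact (cball (0::complex) B)"
    using compact_cball compact_imp_seq_compact by blast
  then show ?thesis using assms unfolding seq_compact_def by (metis mem_cball_0)
qed

lemma norm_bieval_le:
  assumes "\<And>j k. j \<le> N \<Longrightarrow> k \<le> N \<Longrightarrow> norm (q j k) \<le> M" "norm w \<le> T" "1 \<le> T"
  shows "\<bar>bieval N q w\<bar> \<le> (real N + 1)\<^sup>2 * (M * T ^ N * T ^ N)"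
proof -
  have M: "0 \<le> M" using assms(1)[of 0 0] norm_ge_zero order_trans by blast
  have p: "norm w ^ j \<le> T ^ N" if "j \<le> N" for j
  proof -
    have "norm w ^ j \<le> T ^ j" using assms by (intro power_mono) auto
    also have "\<dots> \<le> T ^ N" using assms that by (intro power_increasing) auto
    finally show ?thesis .
  qed
  have "norm (\<Sum>j\<le>N. \<Sum>k\<le>N. q j k * w ^ j * cnj w ^ k) \<le> (\<Sum>j\<le>N. \<Sum>k\<le>N. M * T ^ N * T ^ N)"
    using M p assms by (intro sum_norm_le) (auto simp: norm_mult norm_power intro!: mult_mono)
  also have "\<dots> = (real N + 1)\<^sup>2 * (M * T ^ N * T ^ N)"
    by (simp add: power2_eq_square algebra_simps)
  finally show ?thesis
    unfolding bieval_def using abs_Re_le_cmod order_trans by blast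
qed

lemma tendsto_bieval:
  assumes "\<And>j k. j \<le> N \<Longrightarrow> k \<le> N \<Longrightarrow> ((\<lambda>n. Q n j k) \<longlongrightarrow> L j k) F" "(w \<longlongrightarrow> l) F"
  shows "((\<lambda>n. bieval N (Q n) (w n)) \<longlongrightarrow> bieval N L l) F"
  unfolding bieval_def using assms by (intro tendsto_intros) auto

lemma tendsto_bilap:
  assumes "\<And>j k. j \<le> N \<Longrightarrow> k \<le> N \<Longrightarrow> ((\<lambda>n. Q n j k) \<longlongrightarrow> L j k) F"
  shows "((\<lambda>n. bilap N (Q n) w) \<longlongrightarrow> bilap N L w) F"
  unfolding bilap_def using assms by (intro tendsto_intros) auto

text \<open>The equality case for the disc \<open>f w = w\<close> makes the Laplacian vanish on the
  punctured unit disc. Its coefficients are the mixed coefficients times the positive factors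
  \<open>j * k\<close>, so uniqueness of coefficients applies.\<close>

lemma mixed_coefficients_eq_0_if_mean_le:
  assumes L: "hermitian_upto N L" "\<And>w. 0 \<le> bilap N L w"
    and mean: "integral {0..2*pi} (\<lambda>\<theta>. bieval N L (cis \<theta>)) \<le> 2 * pi * bieval N L 0"
    and jk: "1 \<le> j" "1 \<le> k"
  shows "L j k = 0"
proof -
  have Ls: "N < j + k \<Longrightarrow> L j k = 0" and Lh: "L k j = cnj (L j k)" for j k
    using L(1) unfolding hermitian_upto_def by blast+
  define L' where "L' j k = L (Suc j) (Suc k) * of_nat (Suc j) * of_nat (Suc k)" for j k
  \<comment> \<open>Shifting the index loses nothing: the term at 0 has the factor
    \<open>of_nat 0\<close>, and the one at \<open>N + 1\<close> exceeds the degree.\<close>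
  have sum_shift: "(\<Sum>j\<le>N. G j) = (\<Sum>j\<le>N. G (Suc j))" if "G 0 = 0" "G (Suc N) = 0" for G :: "nat \<Rightarrow> complex"
    using sum.atMost_Suc_shift[of G N] that by simp
  have lapsum: "(\<Sum>j\<le>N. \<Sum>k\<le>N. L j k * (of_nat j * w ^ (j - 1)) * cnj (of_nat k * w ^ (k - 1)))
      = (\<Sum>j\<le>N. \<Sum>k\<le>N. L' j k * w ^ j * cnj w ^ k)" for w
  proof -
    have "(\<Sum>j\<le>N. \<Sum>k\<le>N. L j k * (of_nat j * w ^ (j - 1)) * cnj (of_nat k * w ^ (k - 1)))
      = (\<Sum>j\<le>N. \<Sum>k\<le>N. L (Suc j) k * (of_nat (Suc j) * w ^ (Suc j - 1)) * cnj (of_nat k * w ^ (k - 1)))"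
      by (rule sum_shift) (simp_all add: Ls)
    also have "\<dots> = (\<Sum>j\<le>N. \<Sum>k\<le>N. L (Suc j) (Suc k) * (of_nat (Suc j) * w ^ (Suc j - 1)) * cnj (of_nat (Suc k) * w ^ (Suc k - 1)))"
      by (intro sum.cong refl sum_shift) (simp_all add: Ls)
    finally show ?thesis by (simp add: L'_def mult_ac del: of_nat_Suc)
  qed
  \<comment> \<open>\<open>bilap\<close> records only a real part; by Hermitian symmetry the complex
    sum is real, so it vanishes as well.\<close>
  have real: "cnj (\<Sum>j\<le>N. \<Sum>k\<le>N. L' j k * w ^ j * cnj w ^ k) = (\<Sum>j\<le>N. \<Sum>k\<le>N. L' j k * w ^ j * cnj w ^ k)" for w
  proof -
    have "(\<Sum>j\<le>N. \<Sum>k\<le>N. L' j k * w ^ j * cnj w ^ k) = (\<Sum>k\<le>N. \<Sum>j\<le>N. L' j k * w ^ j * cnj w ^ k)"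
      by (rule sum.swap)
    also have "\<dots> = (\<Sum>k\<le>N. \<Sum>j\<le>N. cnj (L' k j * w ^ k * cnj w ^ j))"
      unfolding L'_def by (intro sum.cong refl) (subst Lh, simp del: of_nat_Suc)
    finally show ?thesis by simp
  qed
  have zero: "(\<Sum>j\<le>N. \<Sum>k\<le>N. L' j k * w ^ j * cnj w ^ k) = 0" if w: "0 < norm w" "norm w < 1" for w
  proof -
    have ew: "expcis (ln (norm w)) (Arg2pi w) = w"
      using Arg2pi_eq[of w] w by (simp add: expcis_def cis_conv_exp)
    have "integral {0..2*pi} (\<lambda>\<theta>. bieval N L (expcis 0 \<theta>)) \<le> 2 * pi * bieval N L 0"
      using mean by simp
    from bieval_circle_mean(2)[where f = "\<lambda>z. z" and R = 2, OF holomorphic_on_ident L(2) _ this, of "ln (norm w)" "Arg2pi w"]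
    have "bilap N L w = 0"
      using w Arg2pi[of w] unfolding ew by (simp add: less_imp_le)
    then have "Re (\<Sum>j\<le>N. \<Sum>k\<le>N. L' j k * w ^ j * cnj w ^ k) = 0"
      by (simp only: bilap_def lapsum)
    moreover have "s = 0" if "cnj s = s" "Re s = 0" for s
      using that by (simp add: complex_eq_iff)
    ultimately show ?thesis using real[of w] by blast
  qed
  show ?thesis
  proof (cases "j + k \<le> N")
    case True
    have "L' (j - 1) (k - 1) = 0"
      by (rule bipoly_coefficients_eq_0[OF zero]) (use True in auto)
    then show ?thesis using jk by (simp add: L'_def)
  qed (simp add: Ls)
qed

text \<open>\<open>e\<close> perturbs the identity disc. Its bound \<open>c\<close> is also the
  constant of the gap proved next, so that the choice \<open>c = 1 / (n + 1)\<close> sends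
  perturbation and normalised gap to zero together.\<close>

definition perturbation_data ::
    "nat \<Rightarrow> real \<Rightarrow> (nat \<Rightarrow> nat \<Rightarrow> complex) \<Rightarrow> (complex \<Rightarrow> complex) \<Rightarrow> bool" where
  "perturbation_data N c q e \<longleftrightarrow>
     hermitian_upto N q \<and> (\<forall>w. 0 \<le> bilap N q w) \<and> (\<forall>j k. j = 0 \<or> k = 0 \<longrightarrow> q j k = 0) \<and>
     (\<exists>R>1. e holomorphic_on ball 0 R) \<and> e 0 = 0 \<and> (\<forall>t\<in>cball 0 1. norm (e t) \<le> c)"

text \<open>By compactness: if no \<open>c\<close> worked, polynomials normalised to coefficient sum
  1 would converge along a subsequence to one whose mean over the unit circle is at most its central
  value. Its mixed coefficients then vanish and it has no others, yet its coefficient sum is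
  1.\<close>

lemma mean_gap_mixed:
  "\<exists>c>0. \<forall>q e. perturbation_data N c q e \<longrightarrow>
      c * (\<Sum>j\<le>N. \<Sum>k\<le>N. norm (q j k)) \<le>
        integral {0..2*pi} (\<lambda>\<theta>. bieval N q (cis \<theta> + e (cis \<theta>))) - 2 * pi * bieval N q 0"
proof (rule ccontr)
  define B where "B c q e \<longleftrightarrow> c * (\<Sum>j\<le>N. \<Sum>k\<le>N. norm (q j k)) \<le>
        integral {0..2*pi} (\<lambda>\<theta>. bieval N q (cis \<theta> + e (cis \<theta>))) - 2 * pi * bieval N q 0" for c q e
  assume "\<not> ?thesis"
  then have neg: "\<not> (\<exists>c>0. \<forall>q e. perturbation_data N c q e \<longrightarrow> B c q e)"
    unfolding B_def .
  have "\<exists>q e. perturbation_data N (inverse (real (Suc n))) q e \<and> \<not> B (inverse (real (Suc n))) q e" for n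
  proof -
    have "0 < inverse (real (Suc n))" by simp
    with neg show ?thesis by blast
  qed
  then obtain q e where pd: "\<And>n. perturbation_data N (inverse (real (Suc n))) (q n) (e n)"
    and notB: "\<And>n. \<not> B (inverse (real (Suc n))) (q n) (e n)"
    by metis
  have less: "integral {0..2*pi} (\<lambda>\<theta>. bieval N (q n) (cis \<theta> + e n (cis \<theta>))) - 2 * pi * bieval N (q n) 0
        < inverse (real (Suc n)) * (\<Sum>j\<le>N. \<Sum>k\<le>N. norm (q n j k))" for n
    using notB[of n] unfolding B_def not_le .
  have q: "hermitian_upto N (q n)" "0 \<le> bilap N (q n) w" "j = 0 \<or> k = 0 \<Longrightarrow> q n j k = 0"
    and e: "e n 0 = 0" "t \<in> cball 0 1 \<Longrightarrow> norm (e n t) \<le> inverse (real (Suc n))" for n w j k t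
    using pd[of n] unfolding perturbation_data_def by blast+
  have "\<forall>n. \<exists>R. (1::real) < R \<and> e n holomorphic_on ball 0 R"
    using pd unfolding perturbation_data_def by blast
  then obtain R where R: "\<And>n. (1::real) < R n" and hol: "\<And>n. e n holomorphic_on ball 0 (R n)"
    by metis
  define S where "S n = (\<Sum>j\<le>N. \<Sum>k\<le>N. norm (q n j k))" for n
  \<comment> \<open>The sub-mean inequality makes the gap nonnegative, and the gap is strictly below
    a positive multiple of \<open>S n\<close>; so one may divide by \<open>S n\<close>.\<close>
  have S: "0 < S n" for n
  proof -
    have "(\<lambda>z. z + e n z) holomorphic_on ball 0 (R n)"
      by (intro holomorphic_intros hol)
    from bieval_submean[OF this q(2)[of n], of 1] R[of n] e(1)[of n]
    have "0 < inverse (real (Suc n)) * S n"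
      using less[of n] by (simp add: S_def)
    then show ?thesis by (simp add: zero_less_mult_iff)
  qed
  define Q where "Q n j k = q n j k / of_real (S n)" for n j k
  have qh: "q n k j = cnj (q n j k)" "N < j + k \<Longrightarrow> q n j k = 0" for n j k
    using q(1)[of n] unfolding hermitian_upto_def by blast+
  have Qh: "Q n k j = cnj (Q n j k)" "N < j + k \<Longrightarrow> Q n j k = 0" "j = 0 \<or> k = 0 \<Longrightarrow> Q n j k = 0" for n j k
    using qh(1)[of n k j] qh(2)[of j k n] q(3)[of j k n] by (auto simp: Q_def)
  have scale: "(\<Sum>j\<le>N. \<Sum>k\<le>N. Q n j k * x j * y k) = (\<Sum>j\<le>N. \<Sum>k\<le>N. q n j k * x j * y k) / of_real (S n)"
    for n and x y :: "nat \<Rightarrow> complex"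
    by (simp add: Q_def sum_divide_distrib)
  have evQ: "bieval N (Q n) w = bieval N (q n) w / S n" for n w
    unfolding bieval_def scale[of n "\<lambda>j. w ^ j" "\<lambda>k. cnj w ^ k"] by (rule Re_divide_of_real)
  have lapQ: "0 \<le> bilap N (Q n) w" for n w
  proof -
    have "bilap N (Q n) w = bilap N (q n) w / S n"
      unfolding bilap_def scale[of n "\<lambda>j. of_nat j * w ^ (j - 1)" "\<lambda>k. cnj (of_nat k * w ^ (k - 1))"]
      by (rule Re_divide_of_real)
    then show ?thesis using q(2) S[of n] by simp
  qed
  have SQ: "(\<Sum>j\<le>N. \<Sum>k\<le>N. norm (Q n j k)) = 1" for n
    using S[of n] by (simp add: Q_def norm_divide S_def[symmetric] sum_divide_distrib[symmetric])
  have Q1: "norm (Q n j k) \<le> 1" for n j k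
  proof (cases "j \<le> N \<and> k \<le> N")
    case True
    have "norm (Q n j k) \<le> (\<Sum>k\<le>N. norm (Q n j k))"
      using True by (intro member_le_sum) auto
    also have "\<dots> \<le> (\<Sum>j\<le>N. \<Sum>k\<le>N. norm (Q n j k))"
      using True by (intro member_le_sum[where f = "\<lambda>j. \<Sum>k\<le>N. norm (Q n j k)"] sum_nonneg) auto
    finally show ?thesis using SQ by simp
  qed (auto simp: Qh(2))
  have "\<exists>r. strict_mono r \<and> (\<forall>p\<in>{..N}\<times>{..N}. \<exists>l. (\<lambda>n. Q ((id \<circ> r) n) (fst p) (snd p)) \<longlonglongrightarrow> l)"
  proof (rule common_subsequence[where C = "\<lambda>p r. \<exists>l. (\<lambda>n. Q (r n) (fst p) (snd p)) \<longlonglongrightarrow> l"])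
    show "\<exists>r. strict_mono r \<and> (\<exists>l. (\<lambda>n. Q ((s \<circ> r) n) (fst p) (snd p)) \<longlonglongrightarrow> l)" for s :: "nat \<Rightarrow> nat" and p
      using bounded_complex_subsequence[of "\<lambda>n. Q (s n) (fst p) (snd p)" 1] Q1 by (auto simp: o_def)
    show "\<exists>l. (\<lambda>n. Q ((s \<circ> r) n) (fst p) (snd p)) \<longlonglongrightarrow> l"
      if conv: "\<exists>l. (\<lambda>n. Q (s n) (fst p) (snd p)) \<longlonglongrightarrow> l" and mono: "strict_mono r" for s r :: "nat \<Rightarrow> nat" and p
    proof -
      obtain l where "(\<lambda>n. Q (s n) (fst p) (snd p)) \<longlonglongrightarrow> l" using conv by blast
      from LIMSEQ_subseq_LIMSEQ[OF this mono] show ?thesis by (auto simp: o_def)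
    qed
  qed (auto simp: strict_mono_id)
  then obtain r where r: "strict_mono r" 
    "\<forall>p\<in>{..N}\<times>{..N}. \<exists>l. (\<lambda>n. Q (r n) (fst p) (snd p)) \<longlonglongrightarrow> l" by auto
  have "\<exists>l. (\<lambda>n. Q (r n) j k) \<longlonglongrightarrow> l" for j k
  proof (cases "j \<le> N \<and> k \<le> N")
    case True then show ?thesis using bspec[OF r(2), of "(j, k)"] by simp
  next
    case False
    then have "(\<lambda>n. Q (r n) j k) = (\<lambda>n. 0)" using Qh(2)[of j k] by auto
    then show ?thesis by auto
  qed
  then obtain L where L: "\<And>j k. (\<lambda>n. Q (r n) j k) \<longlonglongrightarrow> L j k" by metis
  have "L k j = cnj (L j k)" for j k
  proof (rule LIMSEQ_unique[OF L])
    have "(\<lambda>n. cnj (Q (r n) j k)) \<longlonglongrightarrow> cnj (L j k)" by (intro tendsto_intros L)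
    then show "(\<lambda>n. Q (r n) k j) \<longlonglongrightarrow> cnj (L j k)" unfolding Qh(1)[of _ k j] .
  qed
  moreover have L0: "L j k = 0" if "N < j + k \<or> j = 0 \<or> k = 0" for j k
    using L[of j k] that Qh(2,3) by (auto simp: LIMSEQ_const_iff)
  ultimately have herm: "hermitian_upto N L" unfolding hermitian_upto_def by blast
  have lapL: "0 \<le> bilap N L w" for w
    by (rule LIMSEQ_le_const[OF tendsto_bilap[of N "\<lambda>n. Q (r n)"]]) (auto intro: L lapQ)
  have e0: "(\<lambda>n. e (r n) t) \<longlonglongrightarrow> 0" if "t \<in> cball 0 1" for t
  proof -
    have "(\<lambda>n. e n t) \<longlonglongrightarrow> 0"
      by (rule tendsto_norm_zero_cancel, rule real_tendsto_sandwich[OF _ _ tendsto_const LIMSEQ_inverse_real_of_nat])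
         (use e(2) that in auto)
    from LIMSEQ_subseq_LIMSEQ[OF this r(1)] show ?thesis by (simp add: o_def)
  qed
  let ?I = "\<lambda>n. integral {0..2*pi} (\<lambda>\<theta>. bieval N (Q (r n)) (cis \<theta> + e (r n) (cis \<theta>)))"
  \<comment> \<open>The dominating constant is that of \<open>norm_bieval_le\<close> for
    coefficients of norm at most 1 and arguments of norm at most
    \<open>1 + 1 / (n + 1) \<le> 2\<close>.\<close>
  have "?I \<longlonglongrightarrow> integral {0..2*pi} (\<lambda>\<theta>. bieval N L (cis \<theta>))"
  proof (rule dominated_convergence(2)[where h = "\<lambda>_. (real N + 1)\<^sup>2 * (1 * 2 ^ N * 2 ^ N)"])
    have "continuous_on (cball 0 1) (e (r n))" for n
      by (rule holomorphic_on_imp_continuous_on[OF holomorphic_on_subset[OF hol]])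
         (use R in \<open>auto simp: cball_subset_ball_iff\<close>)
    then have "continuous_on {0..2*pi} (\<lambda>\<theta>. e (r n) (cis \<theta>))" for n
      by (rule continuous_on_compose2[where f = cis]) (auto intro!: continuous_intros)
    then show "(\<lambda>\<theta>. bieval N (Q (r n)) (cis \<theta> + e (r n) (cis \<theta>))) integrable_on {0..2*pi}" for n
      by (intro integrable_continuous_real continuous_intros)
    show "norm (bieval N (Q (r n)) (cis \<theta> + e (r n) (cis \<theta>))) \<le> (real N + 1)\<^sup>2 * (1 * 2 ^ N * 2 ^ N)" for n \<theta>
      unfolding real_norm_def
    proof (rule norm_bieval_le)
      have "norm (e (r n) (cis \<theta>)) \<le> inverse (real (Suc (r n)))" using e(2) by simp
      also have "\<dots> \<le> 1" by (simp add: field_simps)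
      finally show "norm (cis \<theta> + e (r n) (cis \<theta>)) \<le> 2" 
        by (intro norm_triangle_le) simp
    qed (use Q1 in auto)
    show "(\<lambda>n. bieval N (Q (r n)) (cis \<theta> + e (r n) (cis \<theta>))) \<longlonglongrightarrow> bieval N L (cis \<theta>)" for \<theta>
      using tendsto_add[OF tendsto_const[of "cis \<theta>"] e0[of "cis \<theta>"]] by (intro tendsto_bieval L) auto
  qed (auto intro: integrable_continuous_real)
  then have lim1: "(\<lambda>n. ?I n - 2 * pi * bieval N (Q (r n)) 0) \<longlonglongrightarrow> integral {0..2*pi} (\<lambda>\<theta>. bieval N L (cis \<theta>)) - 2 * pi * bieval N L 0"
    by (intro tendsto_intros tendsto_bieval L)
  have lim2: "(\<lambda>n. inverse (real (Suc (r n)))) \<longlonglongrightarrow> 0"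
    using LIMSEQ_subseq_LIMSEQ[OF LIMSEQ_inverse_real_of_nat r(1)] by (simp add: o_def)
  have "?I n - 2 * pi * bieval N (Q (r n)) 0 \<le> inverse (real (Suc (r n)))" for n
  proof -
    have "?I n = integral {0..2*pi} (\<lambda>\<theta>. bieval N (q (r n)) (cis \<theta> + e (r n) (cis \<theta>))) / S (r n)"
      unfolding evQ by simp
    then have "?I n - 2 * pi * bieval N (Q (r n)) 0 = (integral {0..2*pi} (\<lambda>\<theta>. bieval N (q (r n)) (cis \<theta> + e (r n) (cis \<theta>))) - 2 * pi * bieval N (q (r n)) 0) / S (r n)"
      by (simp add: evQ diff_divide_distrib)
    also have "\<dots> \<le> (inverse (real (Suc (r n))) * S (r n)) / S (r n)"
      using less[of "r n"] S[of "r n"] by (intro divide_right_mono) (auto simp: S_def[symmetric])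
    finally show ?thesis using S[of "r n"] by simp
  qed
  then have "integral {0..2*pi} (\<lambda>\<theta>. bieval N L (cis \<theta>)) - 2 * pi * bieval N L 0 \<le> 0"
    using LIMSEQ_le[OF lim1 lim2] by blast
  then have "L j k = 0" if "1 \<le> j" "1 \<le> k" for j k
    using mixed_coefficients_eq_0_if_mean_le[OF herm lapL _ that] by simp
  then have Lz: "L j k = 0" for j k
    using L0[of j k] by (cases "j = 0 \<or> k = 0") auto
  have "(\<lambda>n. \<Sum>j\<le>N. \<Sum>k\<le>N. norm (Q (r n) j k)) \<longlonglongrightarrow> (\<Sum>j\<le>N. \<Sum>k\<le>N. norm (L j k))"
    by (intro tendsto_intros L)
  then show False by (simp add: SQ Lz LIMSEQ_const_iff)
qed

lemma mean_gap:
  obtains c where "0 < c"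
    "\<And>q e R j k. \<lbrakk>hermitian_upto N q; \<And>w. 0 \<le> bilap N q w; 1 < R; e holomorphic_on ball 0 R; e 0 = 0;
       \<And>t. norm t \<le> 1 \<Longrightarrow> norm (e t) \<le> c; 1 \<le> j; 1 \<le> k; j \<le> N; k \<le> N\<rbrakk> \<Longrightarrow>
      c * norm (q j k) \<le> integral {0..2*pi} (\<lambda>\<theta>. bieval N q (cis \<theta> + e (cis \<theta>))) - 2 * pi * bieval N q 0"
proof -
  obtain c where c: "0 < c" and gap: "\<And>q e. perturbation_data N c q e \<Longrightarrow>
      c * (\<Sum>j\<le>N. \<Sum>k\<le>N. norm (q j k)) \<le>
        integral {0..2*pi} (\<lambda>\<theta>. bieval N q (cis \<theta> + e (cis \<theta>))) - 2 * pi * bieval N q 0"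
    using mean_gap_mixed[of N] by blast
  show thesis
  proof (rule that[OF c])
    fix q e R and j k :: nat
    assume q: "hermitian_upto N q" "\<And>w. 0 \<le> bilap N q w" and R: "(1::real) < R"
      and e: "e holomorphic_on ball 0 R" "e 0 = 0" "\<And>t. norm t \<le> 1 \<Longrightarrow> norm (e t) \<le> c"
      and jk: "1 \<le> j" "1 \<le> k" "j \<le> N" "k \<le> N"
    define m where "m j k = (if j = 0 \<or> k = 0 then 0 else q j k)" for j k
    define h where "h j k = (if j = 0 \<or> k = 0 then q j k else 0)" for j k
    have qs: "N < j + k \<Longrightarrow> q j k = 0" and qh: "q k j = cnj (q j k)" for j k
      using q(1) unfolding hermitian_upto_def by blast+
    have hm: "hermitian_upto N m" unfolding hermitian_upto_def m_def by (auto simp: qs intro: qh)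
    have split: "bieval N q w = bieval N m w + bieval N h w" for w
      unfolding bieval_def plus_complex.simps(1)[symmetric] sum.distrib[symmetric]
      by (intro arg_cong[where f = Re] sum.cong refl) (simp add: m_def h_def)
    have lap_h: "bilap N h w = 0" for w
      unfolding bilap_def by (subst sum.neutral) (auto intro!: sum.neutral simp: h_def)
    have "bilap N q w = bilap N m w" for w
      unfolding bilap_def by (intro arg_cong[where f = Re] sum.cong refl) (auto simp: m_def)
    with q(2) have lap_m: "\<forall>w. 0 \<le> bilap N m w" by simp
    define F where "F z = z + e z" for z
    have F: "F holomorphic_on ball 0 R" "F 0 = 0"
      unfolding F_def by (auto intro!: holomorphic_intros e)
    have "continuous_on (cball 0 1) F"
      by (rule holomorphic_on_imp_continuous_on[OF holomorphic_on_subset[OF F(1)]])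
         (use R in \<open>auto simp: cball_subset_ball_iff\<close>)
    then have "continuous_on {0..2*pi} (\<lambda>\<theta>. F (cis \<theta>))"
      by (rule continuous_on_compose2[where f = cis]) (auto intro!: continuous_intros)
    then have int: "(\<lambda>\<theta>. bieval N p (F (cis \<theta>))) integrable_on {0..2*pi}" for p
      by (intro integrable_continuous_real continuous_intros)
    have "2 * pi * bieval N h 0 \<le> integral {0..2*pi} (\<lambda>\<theta>. bieval N h (F (cis \<theta>)))"
      using bieval_submean[OF F(1), of N h 1] R lap_h F(2) by simp
    moreover have "integral {0..2*pi} (\<lambda>\<theta>. bieval N q (F (cis \<theta>))) =
       integral {0..2*pi} (\<lambda>\<theta>. bieval N m (F (cis \<theta>))) + integral {0..2*pi} (\<lambda>\<theta>. bieval N h (F (cis \<theta>)))"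
      unfolding split by (rule integral_add[OF int int])
    moreover have "c * (\<Sum>j\<le>N. \<Sum>k\<le>N. norm (m j k)) \<le>
        integral {0..2*pi} (\<lambda>\<theta>. bieval N m (F (cis \<theta>))) - 2 * pi * bieval N m 0"
    proof -
      have "perturbation_data N c m e"
        unfolding perturbation_data_def using hm lap_m R e by (auto simp: m_def)
      then show ?thesis unfolding F_def by (rule gap)
    qed
    moreover have "norm (q j k) \<le> (\<Sum>j\<le>N. \<Sum>k\<le>N. norm (m j k))"
    proof -
      have "norm (q j k) = norm (m j k)" using jk by (simp add: m_def)
      also have "\<dots> \<le> (\<Sum>k\<le>N. norm (m j k))"
        using jk by (intro member_le_sum) auto
      also have "\<dots> \<le> (\<Sum>j\<le>N. \<Sum>k\<le>N. norm (m j k))"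
        using jk by (intro member_le_sum[where f = "\<lambda>j. \<Sum>k\<le>N. norm (m j k)"] sum_nonneg) auto
      finally show ?thesis .
    qed
    then have "c * norm (q j k) \<le> c * (\<Sum>j\<le>N. \<Sum>k\<le>N. norm (m j k))" using c by simp
    ultimately show "c * norm (q j k) \<le> integral {0..2*pi} (\<lambda>\<theta>. bieval N q (cis \<theta> + e (cis \<theta>))) - 2 * pi * bieval N q 0"
      unfolding F_def[symmetric] using split[of 0] by (simp add: algebra_simps)
  qed
qed

section \<open>Bounds for discs in model domains\<close>

text \<open>The defining function of a model domain with the coordinates as separate arguments, so
  that the components of a disc can be treated as scalar functions.\<close>

definition disc_value ::
    "nat \<Rightarrow> (nat \<Rightarrow> nat \<Rightarrow> complex) \<Rightarrow> 'i set \<Rightarrow> complex \<Rightarrow> complex \<Rightarrow> ('i \<Rightarrow> complex) \<Rightarrow> real" where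
  "disc_value N q I w0 w1 w = Re w0 + bieval N q w1 + (\<Sum>\<alpha>\<in>I. (cmod (w \<alpha>))\<^sup>2)"

section \<open>Sub-mean inequalities along holomorphic discs\<close>

lemma circle_subset_ball:
  assumes "0 < s" "s < R"
  shows "a + of_real s * cis \<theta> \<in> ball a R"
  using assms by (simp add: dist_norm norm_mult)

lemma continuous_on_circle:
  assumes "f holomorphic_on ball a R" "0 < s" "s < R"
  shows "continuous_on S (\<lambda>\<theta>. f (a + of_real s * cis \<theta>))"
  by (rule continuous_on_compose2[OF holomorphic_on_imp_continuous_on[OF assms(1)]])
     (use circle_subset_ball[OF assms(2,3)] in \<open>auto intro!: continuous_intros simp del: mem_ball\<close>)

lemma Re_submean:
  assumes f: "f holomorphic_on ball a R" and s: "0 < s" "s < R"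
  shows "2 * pi * Re (f a) \<le> integral {0..2*pi} (\<lambda>\<theta>. Re (f (a + of_real s * cis \<theta>)))"
proof -
  define q :: "nat \<Rightarrow> nat \<Rightarrow> complex" where "q j k = (if j = 1 \<and> k = 0 then 1 else 0)" for j k
  have "bieval 1 q w = Re w" for w by (simp add: bieval_def q_def)
  moreover have "bilap 1 q w = 0" for w by (simp add: bilap_def q_def)
  ultimately show ?thesis using bieval_submean[OF f _ s, of 1 q] by simp
qed

lemma norm_square_submean:
  assumes f: "f holomorphic_on ball a R" and s: "0 < s" "s < R"
  shows "2 * pi * (cmod (f a))\<^sup>2 \<le> integral {0..2*pi} (\<lambda>\<theta>. (cmod (f (a + of_real s * cis \<theta>)))\<^sup>2)"
proof -
  define q :: "nat \<Rightarrow> nat \<Rightarrow> complex" where "q j k = (if j = 1 \<and> k = 1 then 1 else 0)" for j k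
  have "bieval 1 q w = (cmod w)\<^sup>2" for w 
    by (simp add: bieval_def q_def cmod_power2 flip: power2_eq_square)
  moreover have "bilap 1 q w = 1" for w by (simp add: bilap_def q_def)
  ultimately show ?thesis using bieval_submean[OF f _ s, of 1 q] by simp
qed

text \<open>In the second claim only the real part and the squares are replaced by their central
  values. The mean of the polynomial is kept, so that its gap can be inserted later.\<close>

lemma disc_value_circle_integral:
  assumes f: "f0 holomorphic_on ball a R" "f1 holomorphic_on ball a R" 
    "\<forall>\<alpha>\<in>I. g \<alpha> holomorphic_on ball a R" and I: "finite I" and s: "0 < s" "s < R"
  defines "z \<equiv> \<lambda>\<theta>. a + of_real s * cis \<theta>"
  shows "continuous_on {0..2*pi} (\<lambda>\<theta>. disc_value N q I (f0 (z \<theta>)) (f1 (z \<theta>)) (\<lambda>\<alpha>. g \<alpha> (z \<theta>)))"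
    and "2 * pi * (Re (f0 a) + (\<Sum>\<alpha>\<in>I. (cmod (g \<alpha> a))\<^sup>2)) + integral {0..2*pi} (\<lambda>\<theta>. bieval N q (f1 (z \<theta>)))
       \<le> integral {0..2*pi} (\<lambda>\<theta>. disc_value N q I (f0 (z \<theta>)) (f1 (z \<theta>)) (\<lambda>\<alpha>. g \<alpha> (z \<theta>)))"
proof -
  have c: "continuous_on {0..2*pi} (\<lambda>\<theta>. f0 (z \<theta>))" "continuous_on {0..2*pi} (\<lambda>\<theta>. f1 (z \<theta>))"
    "\<And>\<alpha>. \<alpha> \<in> I \<Longrightarrow> continuous_on {0..2*pi} (\<lambda>\<theta>. g \<alpha> (z \<theta>))"
    unfolding z_def using f s by (auto intro: continuous_on_circle)
  show "continuous_on {0..2*pi} (\<lambda>\<theta>. disc_value N q I (f0 (z \<theta>)) (f1 (z \<theta>)) (\<lambda>\<alpha>. g \<alpha> (z \<theta>)))"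
    unfolding disc_value_def by (intro continuous_intros c)
  have i0: "(\<lambda>\<theta>. Re (f0 (z \<theta>))) integrable_on {0..2*pi}"
    by (intro integrable_continuous_real continuous_intros c)
  have i1: "(\<lambda>\<theta>. bieval N q (f1 (z \<theta>))) integrable_on {0..2*pi}"
    by (intro integrable_continuous_real continuous_intros c)
  have i2: "(\<lambda>\<theta>. (cmod (g \<alpha> (z \<theta>)))\<^sup>2) integrable_on {0..2*pi}" if "\<alpha> \<in> I" for \<alpha>
    by (intro integrable_continuous_real continuous_intros c that)
  have "((\<lambda>\<theta>. disc_value N q I (f0 (z \<theta>)) (f1 (z \<theta>)) (\<lambda>\<alpha>. g \<alpha> (z \<theta>))) has_integral
      (integral {0..2*pi} (\<lambda>\<theta>. Re (f0 (z \<theta>))) + integral {0..2*pi} (\<lambda>\<theta>. bieval N q (f1 (z \<theta>)))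
        + (\<Sum>\<alpha>\<in>I. integral {0..2*pi} (\<lambda>\<theta>. (cmod (g \<alpha> (z \<theta>)))\<^sup>2)))) {0..2*pi}"
    unfolding disc_value_def
    by (intro has_integral_add has_integral_sum I integrable_integral i0 i1 i2)
  then have "integral {0..2*pi} (\<lambda>\<theta>. disc_value N q I (f0 (z \<theta>)) (f1 (z \<theta>)) (\<lambda>\<alpha>. g \<alpha> (z \<theta>))) =
      integral {0..2*pi} (\<lambda>\<theta>. Re (f0 (z \<theta>))) + integral {0..2*pi} (\<lambda>\<theta>. bieval N q (f1 (z \<theta>)))
        + (\<Sum>\<alpha>\<in>I. integral {0..2*pi} (\<lambda>\<theta>. (cmod (g \<alpha> (z \<theta>)))\<^sup>2))"
    by (rule integral_unique)
  moreover have "2 * pi * Re (f0 a) \<le> integral {0..2*pi} (\<lambda>\<theta>. Re (f0 (z \<theta>)))"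
    unfolding z_def by (rule Re_submean[OF f(1) s])
  moreover have "(\<Sum>\<alpha>\<in>I. 2 * pi * (cmod (g \<alpha> a))\<^sup>2) \<le> (\<Sum>\<alpha>\<in>I. integral {0..2*pi} (\<lambda>\<theta>. (cmod (g \<alpha> (z \<theta>)))\<^sup>2))"
    unfolding z_def by (intro sum_mono norm_square_submean[OF bspec[OF f(3)] s])
  moreover have "(\<Sum>\<alpha>\<in>I. 2 * pi * (cmod (g \<alpha> a))\<^sup>2) = 2 * pi * (\<Sum>\<alpha>\<in>I. (cmod (g \<alpha> a))\<^sup>2)"
    by (simp add: sum_distrib_left)
  ultimately show "2 * pi * (Re (f0 a) + (\<Sum>\<alpha>\<in>I. (cmod (g \<alpha> a))\<^sup>2)) + integral {0..2*pi} (\<lambda>\<theta>. bieval N q (f1 (z \<theta>)))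
       \<le> integral {0..2*pi} (\<lambda>\<theta>. disc_value N q I (f0 (z \<theta>)) (f1 (z \<theta>)) (\<lambda>\<alpha>. g \<alpha> (z \<theta>)))"
    by (simp add: algebra_simps)
qed

lemma disc_value_submean:
  assumes f: "f0 holomorphic_on ball a R" "f1 holomorphic_on ball a R" 
    "\<forall>\<alpha>\<in>I. g \<alpha> holomorphic_on ball a R" and I: "finite I" and s: "0 < s" "s < R"
    and lap: "\<And>w. 0 \<le> bilap N q w"
  defines "z \<equiv> \<lambda>\<theta>. a + of_real s * cis \<theta>"
  shows "2 * pi * disc_value N q I (f0 a) (f1 a) (\<lambda>\<alpha>. g \<alpha> a)
       \<le> integral {0..2*pi} (\<lambda>\<theta>. disc_value N q I (f0 (z \<theta>)) (f1 (z \<theta>)) (\<lambda>\<alpha>. g \<alpha> (z \<theta>)))"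
proof -
  have "2 * pi * bieval N q (f1 a) \<le> integral {0..2*pi} (\<lambda>\<theta>. bieval N q (f1 (z \<theta>)))"
    unfolding z_def by (rule bieval_submean[OF f(2) lap s])
  with disc_value_circle_integral(2)[OF f I s, where N = N and q = q] show ?thesis
    unfolding z_def disc_value_def by (simp add: algebra_simps)
qed

lemma norm_cis_minus_one_le: "norm (cis t - 1) \<le> \<bar>t\<bar>"
  using dist_exp_i_1[of t] abs_sin_x_le_abs_x[of "t/2"] by (simp add: cis_conv_exp)

text \<open>Over the circle through \<open>a\<close> about 0 the integral is at least
  \<open>- 2 * pi * B\<close>. Values below \<open>- 8 * B / \<tau>\<close> on a whole arc of angle
  \<open>\<tau>\<close>, and negative ones elsewhere, would make it at most \<open>- 8 * B\<close>;
  but \<open>2 * pi < 8\<close>.\<close>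

lemma disc_value_on_arc:
  assumes f: "f0 holomorphic_on ball 0 1" "f1 holomorphic_on ball 0 1" 
    "\<forall>\<alpha>\<in>I. g \<alpha> holomorphic_on ball 0 1" and I: "finite I"
    and lap: "\<And>w. 0 \<le> bilap N q w"
    and neg: "\<And>t. norm t < 1 \<Longrightarrow> disc_value N q I (f0 t) (f1 t) (\<lambda>\<alpha>. g \<alpha> t) < 0"
    and B: "0 < B" "- B \<le> disc_value N q I (f0 0) (f1 0) (\<lambda>\<alpha>. g \<alpha> 0)"
    and a: "norm a < 1" and \<tau>: "0 < \<tau>" "\<tau> \<le> 1"
  obtains a' where "norm a' = norm a" "norm (a' - a) \<le> \<tau>" 
    "- (8 * B / \<tau>) \<le> disc_value N q I (f0 a') (f1 a') (\<lambda>\<alpha>. g \<alpha> a')"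
proof -
  define v where "v t = disc_value N q I (f0 t) (f1 t) (\<lambda>\<alpha>. g \<alpha> t)" for t
  have "\<exists>\<theta>\<in>{0..\<tau>}. - (8 * B / \<tau>) \<le> v (a * cis \<theta>)"
  proof (rule ccontr)
    assume "\<not> ?thesis"
    then have low: "v (a * cis \<theta>) < - (8 * B / \<tau>)" if "\<theta> \<in> {0..\<tau>}" for \<theta> using that by force
    \<comment> \<open>Multiplication by \<open>a\<close> maps \<open>ball 0 R\<close> into the unit
      disc, and \<open>R > 1\<close> makes room for the unit circle in it.\<close>
    define R where "R = (if a = 0 then 2 else 1 / norm a)"
    have R: "1 < R" using a by (auto simp: R_def)
    have aR: "norm (a * t) < 1" if "t \<in> ball 0 R" for t
      using that by (auto simp: R_def norm_mult field_simps split: if_splits)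
    have hol: "(\<lambda>t. h (a * t)) holomorphic_on ball 0 R" if "h holomorphic_on ball 0 1" for h
    proof -
      have "(h \<circ> (\<lambda>t. a * t)) holomorphic_on ball 0 R"
        by (rule holomorphic_on_compose_gen[OF _ that]) (use aR in \<open>auto intro!: holomorphic_intros\<close>)
      then show ?thesis by (simp add: o_def)
    qed
    have "\<forall>\<alpha>\<in>I. (\<lambda>t. g \<alpha> (a * t)) holomorphic_on ball 0 R" using hol f(3) by blast
    note fa = hol[OF f(1)] hol[OF f(2)] this
    have cont: "continuous_on {0..2*pi} (\<lambda>\<theta>. v (a * cis \<theta>))"
      using disc_value_circle_integral(1)[OF fa I _ R, where N = N and q = q] by (simp add: v_def)
    have int: "(\<lambda>\<theta>. v (a * cis \<theta>)) integrable_on {0..2*pi}"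
      by (rule integrable_continuous_real[OF cont])
    have "2 * pi * v 0 \<le> integral {0..2*pi} (\<lambda>\<theta>. v (a * cis \<theta>))"
      using disc_value_submean[OF fa I _ R lap] by (simp add: v_def)
    also have "\<dots> = integral {0..\<tau>} (\<lambda>\<theta>. v (a * cis \<theta>)) + integral {\<tau>..2*pi} (\<lambda>\<theta>. v (a * cis \<theta>))"
      using \<tau> pi_gt3 Henstock_Kurzweil_Integration.integral_combine[OF _ _ int, of \<tau>] by simp
    also have "\<dots> \<le> integral {0..\<tau>} (\<lambda>\<theta>. - (8 * B / \<tau>)) + integral {\<tau>..2*pi} (\<lambda>\<theta>. 0)"
    proof (intro add_mono integral_le)
      show "(\<lambda>\<theta>. v (a * cis \<theta>)) integrable_on {0..\<tau>}" "(\<lambda>\<theta>. v (a * cis \<theta>)) integrable_on {\<tau>..2*pi}"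
        using \<tau> pi_gt3 by (auto intro!: integrable_subinterval_real[OF int])
      show "v (a * cis \<theta>) \<le> - (8 * B / \<tau>)" if "\<theta> \<in> {0..\<tau>}" for \<theta>
        using low[OF that] by simp
      show "v (a * cis \<theta>) \<le> 0" for \<theta>
        unfolding v_def by (rule less_imp_le, rule neg) (use a in \<open>simp add: norm_mult\<close>)
    qed (auto intro: integrable_continuous_real)
    also have "\<dots> = - (8 * B)" using \<tau> by simp
    finally have "2 * pi * v 0 \<le> - (8 * B)" .
    moreover have "2 * pi * - B \<le> 2 * pi * v 0"
      using B by (intro mult_left_mono) (auto simp: v_def)
    moreover have "2 * pi * B < 8 * B" using B pi_less_4 by simp
    ultimately show False by linarith
  qed
  then obtain \<theta> where \<theta>: "\<theta> \<in> {0..\<tau>}" "- (8 * B / \<tau>) \<le> v (a * cis \<theta>)" by blast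
  show thesis
  proof (rule that)
    have "norm (a * cis \<theta> - a) = norm a * norm (cis \<theta> - 1)"
      by (simp add: norm_mult[symmetric] algebra_simps)
    also have "\<dots> \<le> 1 * \<bar>\<theta>\<bar>"
      using a by (intro mult_mono norm_cis_minus_one_le) auto
    finally show "norm (a * cis \<theta> - a) \<le> \<tau>" using \<theta>(1) by simp
  qed (use \<theta>(2) in \<open>auto simp: norm_mult v_def\<close>)
qed

text \<open>Rescaled to the unit circle, \<open>f1\<close> becomes
  \<open>f1 a + A * (t + e t)\<close> with \<open>A = D * \<tau>\<close>, and the hypothesis on
  \<open>deriv f1\<close> makes \<open>e\<close> small. The gap for the polynomial re-expanded along
  \<open>f1 a + A * w\<close> is at least \<open>c\<close> times a top coefficient, of modulus
  \<open>norm (q j k) * norm A ^ N\<close>. Since the mean of the negative function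
  \<open>disc_value\<close> is at most 0, the gap is at most \<open>- 2 * pi\<close> times its
  central value.\<close>

lemma almost_affine_disc_bound:
  assumes gap: "\<And>q e R j k. \<lbrakk>hermitian_upto N q; \<And>w. 0 \<le> bilap N q w; 1 < R; e holomorphic_on ball 0 R; e 0 = 0;
       \<And>t. norm t \<le> 1 \<Longrightarrow> norm (e t) \<le> c; 1 \<le> j; 1 \<le> k; j \<le> N; k \<le> N\<rbrakk> \<Longrightarrow>
      c * norm (q j k) \<le> integral {0..2*pi} (\<lambda>\<theta>. bieval N q (cis \<theta> + e (cis \<theta>))) - 2 * pi * bieval N q 0"
    and q: "hermitian_upto N q" "\<And>w. 0 \<le> bilap N q w"
    and f: "f0 holomorphic_on ball a R" "f1 holomorphic_on ball a R" 
      "\<forall>\<alpha>\<in>I. g \<alpha> holomorphic_on ball a R" and I: "finite I"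
    and neg: "\<And>t. t \<in> ball a R \<Longrightarrow> disc_value N q I (f0 t) (f1 t) (\<lambda>\<alpha>. g \<alpha> t) < 0"
    and \<tau>: "0 < \<tau>" "\<tau> < R"
    and D: "D \<noteq> 0" "\<And>t. norm (t - a) \<le> \<tau> \<Longrightarrow> norm (deriv f1 t - D) \<le> c * norm D"
    and jk: "1 \<le> j" "1 \<le> k" "j + k = N"
  shows "c * norm (q j k) * (norm D * \<tau>) ^ N \<le> - (2 * pi * disc_value N q I (f0 a) (f1 a) (\<lambda>\<alpha>. g \<alpha> a))"
proof -
  define A where "A = D * of_real \<tau>"
  have A: "A \<noteq> 0" using D \<tau> by (simp add: A_def)
  define e where "e t = (f1 (a + of_real \<tau> * t) - f1 a) / A - t" for t
  have F: "f1 (a + of_real \<tau> * t) = f1 a + A * (t + e t)" for t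
    using A by (simp add: e_def)
  define R' where "R' = R / \<tau>"
  have R': "1 < R'" using \<tau> by (simp add: R'_def)
  have inb: "a + of_real \<tau> * t \<in> ball a R" if "t \<in> ball 0 R'" for t
    using that \<tau> by (simp add: R'_def dist_norm norm_mult field_simps)
  have fR': "(\<lambda>t. f1 (a + of_real \<tau> * t)) holomorphic_on ball 0 R'"
  proof -
    have "(f1 \<circ> (\<lambda>t. a + of_real \<tau> * t)) holomorphic_on ball 0 R'"
      by (rule holomorphic_on_compose_gen[OF _ f(2)]) (use inb in \<open>auto intro!: holomorphic_intros simp del: mem_ball\<close>)
    then show ?thesis by (simp add: o_def)
  qed
  have ehol: "e holomorphic_on ball 0 R'"
    unfolding e_def using A by (intro holomorphic_intros fR') auto
  have e0: "e 0 = 0" by (simp add: e_def)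
  have ebd: "norm (e t) \<le> c" if t: "norm t \<le> 1" for t
  proof -
    have "norm (e t - e 0) \<le> c * norm (t - 0)"
    proof (rule field_differentiable_bound[where S = "cball 0 1"])
      fix u :: complex assume "u \<in> cball 0 1"
      then have u: "norm u \<le> 1" by simp
      then have uR: "a + of_real \<tau> * u \<in> ball a R" using R' by (intro inb) simp
      have "((\<lambda>t. f1 (a + of_real \<tau> * t)) has_field_derivative deriv f1 (a + of_real \<tau> * u) * of_real \<tau>) (at u)"
        using holomorphic_derivI[OF f(2) open_ball uR] 
        by (rule DERIV_chain2[where f = f1]) (auto intro!: derivative_eq_intros)
      then show "(e has_field_derivative deriv f1 (a + of_real \<tau> * u) * of_real \<tau> / A - 1) (at u within cball 0 1)"
        unfolding e_def using A by (auto intro!: derivative_eq_intros intro: has_field_derivative_at_within)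
      have "deriv f1 (a + of_real \<tau> * u) * of_real \<tau> / A - 1 = (deriv f1 (a + of_real \<tau> * u) - D) / D"
        using D \<tau> by (simp add: A_def field_simps)
      moreover have "norm (deriv f1 (a + of_real \<tau> * u) - D) \<le> c * norm D"
        using u \<tau> by (intro D(2)) (simp add: norm_mult mult_left_le)
      ultimately show "norm (deriv f1 (a + of_real \<tau> * u) * of_real \<tau> / A - 1) \<le> c"
        using D(1) by (simp add: norm_divide divide_le_eq)
    qed (use t in auto)
    then have *: "norm (e t) \<le> c * norm t" using e0 by simp
    have "0 \<le> c * norm D" using D(2)[of a] \<tau> norm_ge_zero order_trans by (metis diff_self less_imp_le norm_zero)
    then have "0 \<le> c" using D(1) by (simp add: zero_le_mult_iff)
    then have "c * norm t \<le> c" using t by (simp add: mult_left_le)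
    with * show ?thesis by linarith
  qed
  obtain q' where q': "hermitian_upto N q'" "\<And>w. bieval N q (f1 a + A * w) = bieval N q' w"
    "\<And>j k. j + k = N \<Longrightarrow> q' j k = q j k * A ^ j * cnj A ^ k"
    using bieval_affine[OF q(1), of "f1 a" A] by blast
  \<comment> \<open>The sub-mean property survives an affine substitution, which avoids computing
    with the new coefficients.\<close>
  have lap': "0 \<le> bilap N q' w" for w
  proof (rule submean_imp_bilap_nonneg)
    fix z :: complex and R :: real assume R: "0 < R"
    have "(\<lambda>w. f1 a + A * w) holomorphic_on ball z (R + 1)" by (intro holomorphic_intros)
    from bieval_submean[OF this q(2) R] q'(2)
    show "2 * pi * bieval N q' z \<le> integral {0..2 * pi} (\<lambda>\<theta>. bieval N q' (z + of_real R * cis \<theta>))"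
      by simp
  qed
  have "c * norm (q' j k) \<le> integral {0..2*pi} (\<lambda>\<theta>. bieval N q' (cis \<theta> + e (cis \<theta>))) - 2 * pi * bieval N q' 0"
    by (rule gap[OF q'(1) lap' R' ehol e0 ebd]) (use jk in auto)
  moreover have "norm (q' j k) = norm (q j k) * (norm D * \<tau>) ^ N"
    using jk \<tau> by (simp add: q'(3) norm_mult norm_power A_def mult.assoc flip: power_add)
  moreover have "bieval N q' (cis \<theta> + e (cis \<theta>)) = bieval N q (f1 (a + of_real \<tau> * cis \<theta>))" for \<theta>
    by (simp add: F q'(2))
  moreover have "bieval N q' 0 = bieval N q (f1 a)" using q'(2)[of 0] by simp
  moreover have "2 * pi * (Re (f0 a) + (\<Sum>\<alpha>\<in>I. (cmod (g \<alpha> a))\<^sup>2)) + integral {0..2*pi} (\<lambda>\<theta>. bieval N q (f1 (a + of_real \<tau> * cis \<theta>))) \<le> 0"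
  proof -
    have "integral {0..2*pi} (\<lambda>\<theta>. disc_value N q I (f0 (a + of_real \<tau> * cis \<theta>)) (f1 (a + of_real \<tau> * cis \<theta>)) (\<lambda>\<alpha>. g \<alpha> (a + of_real \<tau> * cis \<theta>)))
        \<le> integral {0..2*pi} (\<lambda>\<theta>. 0)"
      using neg[OF circle_subset_ball[OF \<tau>]] 
      by (intro integral_le integrable_continuous_real disc_value_circle_integral(1)[OF f I \<tau>]) (auto simp: less_imp_le)
    with disc_value_circle_integral(2)[OF f I \<tau>, where N = N and q = q] show ?thesis by simp
  qed
  ultimately show ?thesis by (simp add: disc_value_def algebra_simps)
qed

section \<open>Derivative bound by an argument of Bloch type\<close>

definition admissible_disc ::
    "nat \<Rightarrow> real \<Rightarrow> (nat \<Rightarrow> nat \<Rightarrow> complex) \<Rightarrow> 'i set \<Rightarrow> (complex \<Rightarrow> complex) \<Rightarrow> (complex \<Rightarrow> complex)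
       \<Rightarrow> ('i \<Rightarrow> complex \<Rightarrow> complex) \<Rightarrow> bool" where
  "admissible_disc N B q I f0 f1 g \<longleftrightarrow>
     hermitian_upto N q \<and> (\<forall>w. 0 \<le> bilap N q w) \<and> finite I \<and>
     f0 holomorphic_on ball 0 1 \<and> f1 holomorphic_on ball 0 1 \<and> (\<forall>\<alpha>\<in>I. g \<alpha> holomorphic_on ball 0 1) \<and>
     (\<forall>t. norm t < 1 \<longrightarrow> disc_value N q I (f0 t) (f1 t) (\<lambda>\<alpha>. g \<alpha> t) < 0) \<and>
     - B \<le> disc_value N q I (f0 0) (f1 0) (\<lambda>\<alpha>. g \<alpha> 0)"

text \<open>As in the proof of Bloch's theorem, \<open>f1\<close> is almost affine near a point maximising a weighted
  derivative. The weight \<open>(r - norm a)\<^sup>2\<close>, rather than \<open>r - norm a\<close>, makes up for the loss of a factor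
  \<open>\<tau>\<close> in \<open>disc_value_on_arc\<close>.\<close>

lemma weighted_derivative_bound:
  fixes f0 f1 :: "complex \<Rightarrow> complex" and g :: "'i \<Rightarrow> complex \<Rightarrow> complex"
  assumes gap: "\<And>q e R j k. \<lbrakk>hermitian_upto N q; \<And>w. 0 \<le> bilap N q w; 1 < R; e holomorphic_on ball 0 R; e 0 = 0;
       \<And>t. norm t \<le> 1 \<Longrightarrow> norm (e t) \<le> c; 1 \<le> j; 1 \<le> k; j \<le> N; k \<le> N\<rbrakk> \<Longrightarrow>
      c * norm (q j k) \<le> integral {0..2*pi} (\<lambda>\<theta>. bieval N q (cis \<theta> + e (cis \<theta>))) - 2 * pi * bieval N q 0"
    and c: "0 < c" and jk: "1 \<le> j" "1 \<le> k" "j + k = N" and \<kappa>: "0 < \<kappa>" "\<kappa> \<le> norm (q j k)" and B: "0 < B"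
    and adm: "admissible_disc N B q I f0 f1 g"
    and r: "0 < r" "r < 1"
  defines "\<sigma> \<equiv> min (1/4) (c/16)"
  assumes t: "norm t \<le> r"
  shows "norm (deriv f1 t) * (r - norm t)\<^sup>2 \<le> 4 * max 1 (16 * pi * B / (c * \<kappa> * \<sigma> ^ (N + 1)))"
proof -
  have q: "hermitian_upto N q" "\<And>w. 0 \<le> bilap N q w" and I: "finite I"
    and f: "f0 holomorphic_on ball 0 1" "f1 holomorphic_on ball 0 1" "\<forall>\<alpha>\<in>I. g \<alpha> holomorphic_on ball 0 1"
    and neg: "\<And>t. norm t < 1 \<Longrightarrow> disc_value N q I (f0 t) (f1 t) (\<lambda>\<alpha>. g \<alpha> t) < 0"
    and v0: "- B \<le> disc_value N q I (f0 0) (f1 0) (\<lambda>\<alpha>. g \<alpha> 0)"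
    using adm unfolding admissible_disc_def by blast+
  define K where "K = 16 * pi * B / (c * \<kappa> * \<sigma> ^ (N + 1))"
  \<comment> \<open>\<open>c / 16\<close> keeps the oscillation of \<open>deriv f1\<close> within
    \<open>2 * \<tau>\<close> of \<open>a\<close> below \<open>c * norm D\<close>;
    \<open>1 / 4\<close> keeps these points within \<open>\<rho> / 2\<close> of \<open>a\<close>,
    where the second derivative is controlled.\<close>
  have \<sigma>: "0 < \<sigma>" "\<sigma> \<le> 1/4" "16 * \<sigma> \<le> c" using c by (auto simp: \<sigma>_def min_def)
  define \<phi> where "\<phi> a = norm (deriv f1 a) * (r - norm a)\<^sup>2" for a
  have hd: "deriv f1 holomorphic_on ball 0 1" using f(2) by (rule holomorphic_deriv) simp
  have "continuous_on (cball 0 r) (deriv f1)"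
    by (rule holomorphic_on_imp_continuous_on[OF holomorphic_on_subset[OF hd]])
       (use r in \<open>simp add: cball_subset_ball_iff\<close>)
  then have "continuous_on (cball 0 r) \<phi>"
    unfolding \<phi>_def by (intro continuous_intros)
  then obtain a where a: "a \<in> cball 0 r" "\<And>t. t \<in> cball 0 r \<Longrightarrow> \<phi> t \<le> \<phi> a"
    using continuous_attains_sup[of "cball 0 r" \<phi>] r by auto
  define \<delta> where "\<delta> = r - norm a"
  define D where "D = deriv f1 a"
  have \<phi>a: "\<phi> a = norm D * \<delta>\<^sup>2" by (simp add: \<phi>_def D_def \<delta>_def)
  have "\<phi> a \<le> 4 * max 1 K"
  proof (cases "D = 0 \<or> \<delta> = 0")
    case True
    then have "\<phi> a = 0" by (auto simp: \<phi>a)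
    then show ?thesis by simp
  next
    case False
    then have D: "D \<noteq> 0" and "0 < \<delta>" using a(1) unfolding \<delta>_def by auto
    moreover have "\<delta> < 1" unfolding \<delta>_def using r norm_ge_zero[of a] by linarith
    ultimately have \<delta>: "0 < \<delta>" "\<delta> < 1" by auto
    define \<rho> where "\<rho> = \<delta> / 2"
    define \<tau> where "\<tau> = \<sigma> * \<rho>"
    have \<rho>: "0 < \<rho>" "\<rho> \<le> 1" using \<delta> by (auto simp: \<rho>_def)
    have \<tau>: "0 < \<tau>" "\<tau> \<le> \<rho> / 4" using \<sigma> \<rho> by (auto simp: \<tau>_def field_simps)
    \<comment> \<open>Within \<open>\<rho> = \<delta> / 2\<close> of \<open>a\<close> the weight is
      at least a quarter of its value at \<open>a\<close>; hence the factor 4.\<close>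
    have d1: "norm (deriv f1 x) \<le> 4 * norm D" if x: "norm (x - a) \<le> \<rho>" for x
    proof -
      have nx: "norm x \<le> norm a + \<rho>" using x norm_triangle_sub[of x a] by simp
      then have "x \<in> cball 0 r" using \<delta> by (auto simp: \<rho>_def \<delta>_def field_simps)
      then have "norm (deriv f1 x) * (r - norm x)\<^sup>2 \<le> norm D * \<delta>\<^sup>2"
        using a(2)[of x] by (simp add: \<phi>a) (simp add: \<phi>_def)
      moreover have "(\<delta> / 2)\<^sup>2 \<le> (r - norm x)\<^sup>2"
        using nx \<delta> by (intro power_mono) (auto simp: \<rho>_def \<delta>_def field_simps)
      then have "norm (deriv f1 x) * (\<delta> / 2)\<^sup>2 \<le> norm (deriv f1 x) * (r - norm x)\<^sup>2"
        by (intro mult_left_mono) auto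
      ultimately have "norm (deriv f1 x) * (\<delta> / 2)\<^sup>2 \<le> norm D * \<delta>\<^sup>2" by linarith
      then show ?thesis using \<delta> by (simp add: power2_eq_square field_simps)
    qed
    have inb: "x \<in> ball 0 1" if "norm (x - a) \<le> \<rho>" for x
      using that norm_triangle_sub[of x a] \<delta> r by (auto simp: \<rho>_def \<delta>_def field_simps)
    have d2: "norm (deriv (deriv f1) x) \<le> 8 * norm D / \<rho>" if x: "norm (x - a) \<le> \<rho> / 2" for x
    proof -
      have sub: "norm (y - a) \<le> \<rho>" if "norm (x - y) \<le> \<rho> / 2" for y
        using that x norm_triangle_ineq[of "y - x" "x - a"] by (simp add: norm_minus_commute)
      \<comment> \<open>Cauchy's estimate on a circle of radius \<open>\<rho> / 2\<close>, which
        stays within \<open>\<rho>\<close> of \<open>a\<close>.\<close>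
      have "norm ((deriv ^^ 1) (deriv f1) x) \<le> fact 1 * (4 * norm D) / (\<rho> / 2) ^ 1"
      proof (rule Cauchy_inequality)
        have "cball x (\<rho> / 2) \<subseteq> ball 0 1" using sub inb by (auto simp: dist_norm simp del: mem_ball)
        then show "continuous_on (cball x (\<rho> / 2)) (deriv f1)" "deriv f1 holomorphic_on ball x (\<rho> / 2)"
          using hd ball_subset_cball holomorphic_on_subset holomorphic_on_imp_continuous_on by blast+
        show "norm (deriv f1 y) \<le> 4 * norm D" if "norm (x - y) = \<rho> / 2" for y
          using that by (intro d1 sub) simp
      qed (use \<rho> in auto)
      then show ?thesis by simp
    qed
    \<comment> \<open>The radius is \<open>2 * \<tau>\<close> because the disc used below has its
      centre at a point \<open>a'\<close> within \<open>\<tau>\<close> of \<open>a\<close>, while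
      \<open>D\<close> remains the derivative at \<open>a\<close>.\<close>
    have d3: "norm (deriv f1 x - D) \<le> c * norm D" if x: "norm (x - a) \<le> 2 * \<tau>" for x
    proof -
      have "norm (deriv f1 x - deriv f1 a) \<le> (8 * norm D / \<rho>) * norm (x - a)"
      proof (rule field_differentiable_bound[where S = "cball a (\<rho> / 2)"])
        fix y assume "y \<in> cball a (\<rho> / 2)"
        then have y: "norm (y - a) \<le> \<rho> / 2" by (simp add: dist_norm norm_minus_commute)
        show "norm (deriv (deriv f1) y) \<le> 8 * norm D / \<rho>" by (rule d2[OF y])
        have "y \<in> ball 0 1" using y \<rho> by (intro inb) simp
        from has_field_derivative_at_within[OF holomorphic_derivI[OF hd open_ball this]]
        show "(deriv f1 has_field_derivative deriv (deriv f1) y) (at y within cball a (\<rho> / 2))" .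
      qed (use x \<tau> \<rho> in \<open>auto simp: dist_norm norm_minus_commute\<close>)
      also have "\<dots> \<le> (8 * norm D / \<rho>) * (2 * \<tau>)"
        using x \<rho> by (intro mult_left_mono) auto
      also have "\<dots> = 16 * \<sigma> * norm D" using \<rho> by (simp add: \<tau>_def)
      also have "\<dots> \<le> c * norm D" using \<sigma> by (intro mult_right_mono) auto
      finally show ?thesis by (simp add: D_def)
    qed
    have na: "norm a < 1" using a(1) r by simp
    obtain a' where a': "norm a' = norm a" "norm (a' - a) \<le> \<tau>" 
      "- (8 * B / \<tau>) \<le> disc_value N q I (f0 a') (f1 a') (\<lambda>\<alpha>. g \<alpha> a')"
      using disc_value_on_arc[OF f I q(2) neg B v0 na \<tau>(1)] \<tau> \<rho> by auto
    have sub: "ball a' (1 - norm a) \<subseteq> ball 0 1"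
      using a'(1) by (auto simp: ball_subset_ball_iff)
    have fa: "f0 holomorphic_on ball a' (1 - norm a)" "f1 holomorphic_on ball a' (1 - norm a)" 
      "\<forall>\<alpha>\<in>I. g \<alpha> holomorphic_on ball a' (1 - norm a)"
      using f sub holomorphic_on_subset by blast+
    have "c * norm (q j k) * (norm D * \<tau>) ^ N \<le> - (2 * pi * disc_value N q I (f0 a') (f1 a') (\<lambda>\<alpha>. g \<alpha> a'))"
    proof (rule almost_affine_disc_bound[OF gap q fa I _ \<tau>(1) _ D _ jk])
      show "\<tau> < 1 - norm a" using \<tau> \<rho> \<delta> r by (auto simp: \<rho>_def \<delta>_def)
      show "disc_value N q I (f0 t) (f1 t) (\<lambda>\<alpha>. g \<alpha> t) < 0" if "t \<in> ball a' (1 - norm a)" for t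
        using neg sub that by auto
      show "norm (deriv f1 t - D) \<le> c * norm D" if "norm (t - a') \<le> \<tau>" for t
        using that a'(2) norm_triangle_ineq[of "t - a'" "a' - a"] by (intro d3) simp
    qed
    also have "\<dots> \<le> 16 * pi * B / \<tau>"
    proof -
      have "2 * pi * - (8 * B / \<tau>) \<le> 2 * pi * disc_value N q I (f0 a') (f1 a') (\<lambda>\<alpha>. g \<alpha> a')"
        using a'(3) by (intro mult_left_mono) auto
      then show ?thesis by simp
    qed
    finally have "c * norm (q j k) * (norm D * \<tau>) ^ N \<le> 16 * pi * B / \<tau>" .
    moreover have "c * \<kappa> * (norm D * \<tau>) ^ N \<le> c * norm (q j k) * (norm D * \<tau>) ^ N"
      using c \<kappa> \<tau> by (intro mult_right_mono) auto
    ultimately have "c * \<kappa> * (norm D * \<tau>) ^ N \<le> 16 * pi * B / \<tau>" by linarith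
    then have main: "c * \<kappa> * ((norm D * \<tau>) ^ N * \<tau>) \<le> 16 * pi * B"
      using \<tau> by (simp add: field_simps)
    \<comment> \<open>\<open>x ^ N\<close> carries \<open>\<rho> ^ (2 * N)\<close>, which is at most
      \<open>\<rho> ^ (N + 1)\<close>, the power hidden in \<open>main\<close>, because
      \<open>\<rho> \<le> 1\<close> and \<open>N \<ge> 1\<close>.\<close>
    define x where "x = norm D * \<rho>\<^sup>2"
    have x0: "0 \<le> x" by (simp add: x_def)
    have "x ^ N * \<sigma> ^ (N + 1) = norm D ^ N * \<rho> ^ (2 * N) * \<sigma> ^ (N + 1)"
      by (simp add: x_def power_mult_distrib power_mult)
    also have "\<dots> \<le> norm D ^ N * \<rho> ^ (N + 1) * \<sigma> ^ (N + 1)"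
      using jk \<rho> \<sigma> by (intro mult_right_mono mult_left_mono power_decreasing) auto
    also have "\<dots> = (norm D * \<tau>) ^ N * \<tau>"
      by (simp add: \<tau>_def power_mult_distrib)
    finally have "c * \<kappa> * (x ^ N * \<sigma> ^ (N + 1)) \<le> c * \<kappa> * ((norm D * \<tau>) ^ N * \<tau>)"
      using c \<kappa> by (intro mult_left_mono) auto
    with main have "c * \<kappa> * (x ^ N * \<sigma> ^ (N + 1)) \<le> 16 * pi * B" by linarith
    then have "x ^ N \<le> K"
      using c \<kappa> \<sigma> unfolding K_def by (subst pos_le_divide_eq) (auto simp: mult_ac)
    \<comment> \<open>Comparing \<open>x\<close> with \<open>x ^ N\<close> for \<open>x > 1\<close>
      avoids an \<open>N\<close>-th root.\<close>
    have "x \<le> max 1 K"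
    proof (cases "x \<le> 1")
      case False
      then have "x ^ 1 \<le> x ^ N" using jk by (intro power_increasing) auto
      with \<open>x ^ N \<le> K\<close> show ?thesis by simp
    qed auto
    moreover have "\<phi> a = 4 * x" by (simp add: \<phi>a x_def \<rho>_def power2_eq_square)
    ultimately show ?thesis by simp
  qed
  moreover have "\<phi> t \<le> \<phi> a" using a(2) t by simp
  ultimately show ?thesis unfolding \<phi>_def K_def by linarith
qed

lemma admissible_disc_derivative_bound:
  assumes jk: "1 \<le> j" "1 \<le> k" "j + k = N" and \<kappa>: "0 < \<kappa>" and B: "0 < B" and s: "0 \<le> s" "s < 1"
  shows "\<exists>C\<ge>0. \<forall>q (I::'i set) f0 f1 g t. admissible_disc N B q I f0 f1 g \<longrightarrow> \<kappa> \<le> norm (q j k) \<longrightarrow> norm t \<le> s \<longrightarrow>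
     norm (deriv f1 t) \<le> C"
proof -
  obtain c where c: "0 < c" and gap:
    "\<And>q e R j k. \<lbrakk>hermitian_upto N q; \<And>w. 0 \<le> bilap N q w; 1 < R; e holomorphic_on ball 0 R; e 0 = 0;
       \<And>t. norm t \<le> 1 \<Longrightarrow> norm (e t) \<le> c; 1 \<le> j; 1 \<le> k; j \<le> N; k \<le> N\<rbrakk> \<Longrightarrow>
      c * norm (q j k) \<le> integral {0..2*pi} (\<lambda>\<theta>. bieval N q (cis \<theta> + e (cis \<theta>))) - 2 * pi * bieval N q 0"
    using mean_gap[of N] by blast
  define M where "M = 4 * max 1 (16 * pi * B / (c * \<kappa> * min (1/4) (c/16) ^ (N + 1)))"
  define r where "r = (1 + s) / 2"
  have r: "0 < r" "r < 1" "s < r" using s by (auto simp: r_def)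
  show ?thesis
  proof (intro exI[of _ "M / (r - s)\<^sup>2"] conjI allI impI)
    show "0 \<le> M / (r - s)\<^sup>2" by (simp add: M_def)
    fix q and I :: "'i set" and f0 f1 g and t :: complex
    assume adm: "admissible_disc N B q I f0 f1 g" and \<kappa>q: "\<kappa> \<le> norm (q j k)" and t: "norm t \<le> s"
    have "norm (deriv f1 t) * (r - norm t)\<^sup>2 \<le> M"
      unfolding M_def by (rule weighted_derivative_bound[OF gap c jk \<kappa> \<kappa>q B adm r(1,2)]) (use t r in auto)
    moreover have "norm (deriv f1 t) * (r - s)\<^sup>2 \<le> norm (deriv f1 t) * (r - norm t)\<^sup>2"
      using t r by (intro mult_left_mono power_mono) auto
    ultimately have "norm (deriv f1 t) * (r - s)\<^sup>2 \<le> M" by linarith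
    then show "norm (deriv f1 t) \<le> M / (r - s)\<^sup>2" using r by (subst pos_le_divide_eq) auto
  qed
qed

text \<open>The estimate of Borel and Caratheodory: \<open>h / (2 * A - h)\<close> maps the unit disc to itself.\<close>

lemma norm_le_if_Re_bounded_above:
  assumes h: "h holomorphic_on ball 0 r" "h 0 = 0" and r: "0 < r" and A: "0 < A"
    and Re: "\<And>t. norm t < r \<Longrightarrow> Re (h t) < A" and t: "norm t < r"
  shows "norm (h t) \<le> 2 * A * norm t / (r - norm t)"
proof -
  define u where "u z = h (of_real r * z) / (2 * of_real A - h (of_real r * z))" for z
  have rz: "norm (of_real r * z) < r" if "norm z < 1" for z :: complex
    using that r by (simp add: norm_mult)
  have less: "norm (h z) < norm (2 * of_real A - h z)" if "norm z < r" for z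
  proof -
    have "(norm (2 * of_real A - h z))\<^sup>2 - (norm (h z))\<^sup>2 = 4 * A * (A - Re (h z))"
      unfolding cmod_power2 by (simp add: power2_eq_square algebra_simps)
    also have "\<dots> > 0" using A Re[OF that] by simp
    finally show ?thesis by (simp add: power2_less_imp_less)
  qed
  have nz: "2 * of_real A - h z \<noteq> 0" if "norm z < r" for z
    using less[OF that] by auto
  have "(h \<circ> (\<lambda>z. of_real r * z)) holomorphic_on ball 0 1"
    by (rule holomorphic_on_compose_gen[OF _ h(1)]) (use rz in \<open>auto intro!: holomorphic_intros\<close>)
  then have "u holomorphic_on ball 0 1"
    unfolding u_def o_def by (intro holomorphic_intros) (use nz rz in auto)
  moreover have "u 0 = 0" using h(2) by (simp add: u_def)
  moreover have "norm (u z) < 1" if "norm z < 1" for z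
    using less[OF rz[OF that]] nz[OF rz[OF that]] unfolding u_def by (simp add: norm_divide divide_less_eq)
  moreover have z1: "norm (t / of_real r) < 1" using t r by (simp add: norm_divide)
  ultimately have "norm (u (t / of_real r)) \<le> norm (t / of_real r)"
    by (rule Schwarz_Lemma(1))
  then have "norm (h t) / norm (2 * of_real A - h t) \<le> norm t / r"
    using r by (simp add: u_def norm_divide)
  then have "norm (h t) * r \<le> norm t * norm (2 * of_real A - h t)"
    using r nz[OF t] by (simp add: field_simps)
  also have "\<dots> \<le> norm t * (2 * A + norm (h t))"
    using A norm_triangle_ineq4[of "2 * of_real A" "h t"] by (intro mult_left_mono) (auto simp: norm_mult)
  finally have "norm (h t) * (r - norm t) \<le> 2 * A * norm t" by (simp add: algebra_simps)
  then show ?thesis using t by (subst pos_le_divide_eq) auto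
qed

text \<open>The order of the bounds is forced. A bound for \<open>f1\<close> bounds the polynomial;
  negativity then bounds \<open>Re f0\<close> from above only, which together with
  \<open>f0 0\<close> bounds \<open>f0\<close>; after that the squares are at most
  \<open>P - Re f0\<close>. The intermediate radius \<open>r\<close> leaves room for the estimate of
  Borel and Caratheodory on \<open>cball 0 s\<close>.\<close>

lemma admissible_disc_bound:
  assumes jk: "1 \<le> j" "1 \<le> k" "j + k = N" and \<kappa>: "0 < \<kappa>" and s: "0 \<le> s" "s < 1"
  shows "\<exists>C. \<forall>q (I::'i set) f0 f1 g t \<alpha>. admissible_disc N B q I f0 f1 g \<longrightarrow> \<kappa> \<le> norm (q j k) \<longrightarrow>
     (\<forall>j k. norm (q j k) \<le> M) \<longrightarrow> norm (f0 0) \<le> M \<longrightarrow> norm (f1 0) \<le> M \<longrightarrow> norm t \<le> s \<longrightarrow>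
     norm (f0 t) \<le> C \<and> norm (f1 t) \<le> C \<and> (\<alpha> \<in> I \<longrightarrow> norm (g \<alpha> t) \<le> C)"
proof -
  define r where "r = (1 + s) / 2"
  have r: "0 < r" "r < 1" "s < r" using s by (auto simp: r_def)
  \<comment> \<open>The derivative bound asks for a positive depth; enlarging \<open>B\<close> keeps
    the disc admissible.\<close>
  define B' where "B' = max 1 B"
  obtain C1 where C1: "0 \<le> C1" "\<And>q (I::'i set) f0 f1 g t. admissible_disc N B' q I f0 f1 g \<Longrightarrow> \<kappa> \<le> norm (q j k) \<Longrightarrow>
      norm t \<le> r \<Longrightarrow> norm (deriv f1 t) \<le> C1"
  proof -
    have "0 < B'" by (simp add: B'_def)
    from admissible_disc_derivative_bound[OF jk \<kappa> this less_imp_le[OF r(1)] r(2), where ?'i = 'i] that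
    show thesis by blast
  qed
  define T where "T = 1 + \<bar>M\<bar> + C1"
  define P where "P = (real N + 1)\<^sup>2 * (\<bar>M\<bar> * T ^ N * T ^ N)"
  define C0 where "C0 = \<bar>M\<bar> + 2 * (P + \<bar>M\<bar> + 1) * s / (r - s)"
  define C where "C = max T (max C0 (P + C0 + 1))"
  have T: "1 \<le> T" using C1 by (simp add: T_def)
  have P: "0 \<le> P" using T by (simp add: P_def)
  have C0: "0 \<le> C0" using P r s by (simp add: C0_def)
  show ?thesis
  proof (intro exI[of _ C] allI impI)
    fix q and I :: "'i set" and f0 f1 g and t :: complex and \<alpha>
    assume adm: "admissible_disc N B q I f0 f1 g" and \<kappa>q: "\<kappa> \<le> norm (q j k)" and
      M: "\<forall>j k. norm (q j k) \<le> M" "norm (f0 0) \<le> M" "norm (f1 0) \<le> M" and t: "norm t \<le> s"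
    have I: "finite I"
      and f: "f0 holomorphic_on ball 0 1" "f1 holomorphic_on ball 0 1"
      and neg: "\<And>t. norm t < 1 \<Longrightarrow> disc_value N q I (f0 t) (f1 t) (\<lambda>\<alpha>. g \<alpha> t) < 0"
      using adm unfolding admissible_disc_def by blast+
    have adm': "admissible_disc N B' q I f0 f1 g"
      using adm unfolding admissible_disc_def B'_def by auto
    have f1: "norm (f1 u) \<le> T" if u: "norm u \<le> r" for u
    proof -
      have "norm (f1 u - f1 0) \<le> C1 * norm (u - 0)"
      proof (rule field_differentiable_bound[where S = "cball 0 r"])
        fix y :: complex assume y: "y \<in> cball 0 r"
        then have "y \<in> ball 0 1" using r by simp
        from has_field_derivative_at_within[OF holomorphic_derivI[OF f(2) open_ball this]]
        show "(f1 has_field_derivative deriv f1 y) (at y within cball 0 r)" .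
        show "norm (deriv f1 y) \<le> C1" using C1(2)[OF adm' \<kappa>q] y by simp
      qed (use u r in auto)
      also have "\<dots> \<le> C1 * 1" using u r C1 by (intro mult_left_mono) auto
      finally show ?thesis using M(3) norm_triangle_sub[of "f1 u" "f1 0"] by (simp add: T_def)
    qed
    have Pbd: "\<bar>bieval N q (f1 u)\<bar> \<le> P" if u: "norm u \<le> r" for u
      unfolding P_def by (rule norm_bieval_le) (use M(1) f1[OF u] T in \<open>auto intro: order_trans[OF _ abs_ge_self]\<close>)
    have sq: "Re (f0 u) + (\<Sum>\<alpha>\<in>I. (cmod (g \<alpha> u))\<^sup>2) < P" if u: "norm u \<le> r" for u
      using neg[of u] Pbd[OF u] u r unfolding disc_value_def by (simp add: abs_le_iff)
    have Re: "Re (f0 u) < P" if u: "norm u \<le> r" for u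
      using sq[OF u] sum_nonneg[of I "\<lambda>\<alpha>. (cmod (g \<alpha> u))\<^sup>2"] by simp
    have f0: "norm (f0 t) \<le> C0"
    proof -
      have "norm (f0 t - f0 0) \<le> 2 * (P + \<bar>M\<bar> + 1) * norm t / (r - norm t)"
      proof (rule norm_le_if_Re_bounded_above[where h = "\<lambda>t. f0 t - f0 0"])
        have "f0 holomorphic_on ball 0 r" by (rule holomorphic_on_subset[OF f(1)]) (use r in auto)
        then show "(\<lambda>t. f0 t - f0 0) holomorphic_on ball 0 r" by (intro holomorphic_intros)
        show "Re (f0 u - f0 0) < P + \<bar>M\<bar> + 1" if "norm u < r" for u
          using Re[of u] that M(2) abs_Re_le_cmod[of "f0 0"] by simp
      qed (use r t P in auto)
      also have "\<dots> \<le> 2 * (P + \<bar>M\<bar> + 1) * s / (r - s)"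
        using t r s P by (intro frac_le mult_left_mono mult_nonneg_nonneg) auto
      finally show ?thesis using M(2) norm_triangle_sub[of "f0 t" "f0 0"] by (simp add: C0_def)
    qed
    have "norm (g \<alpha> t) \<le> P + C0 + 1" if "\<alpha> \<in> I"
    proof -
      have "(cmod (g \<alpha> t))\<^sup>2 \<le> (\<Sum>\<alpha>\<in>I. (cmod (g \<alpha> t))\<^sup>2)"
        using that I by (intro member_le_sum) auto
      also have "\<dots> \<le> P + C0" using sq[of t] t r f0 abs_Re_le_cmod[of "f0 t"] by simp
      also have "\<dots> \<le> (P + C0 + 1)\<^sup>2" using P C0 by (simp add: power2_eq_square algebra_simps)
      finally show ?thesis by (rule power2_le_imp_le) (use P C0 in simp)
    qed
    then show "norm (f0 t) \<le> C \<and> norm (f1 t) \<le> C \<and> (\<alpha> \<in> I \<longrightarrow> norm (g \<alpha> t) \<le> C)"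
      using f0 f1[of t] t r by (auto simp: C_def)
  qed
qed

section \<open>Stability of the Kobayashi metric\<close>

text \<open>Agrees with \<open>model_function\<close> for coefficients of total degree at most
  \<open>N\<close>. A fixed range of summation, in place of the support of the coefficients, lets
  values converge termwise along a sequence of polynomials.\<close>

definition model_value ::
    "nat \<Rightarrow> 'n \<Rightarrow> 'n \<Rightarrow> (nat \<Rightarrow> nat \<Rightarrow> complex) \<Rightarrow> complex ^ 'n::finite \<Rightarrow> real" where
  "model_value N i0 i1 q z = disc_value N q (- {i0, i1}) (z $ i0) (z $ i1) (($) z)"

definition kobayashi_disc ::
    "(complex ^ 'n::finite) set \<Rightarrow> complex ^ 'n \<Rightarrow> complex ^ 'n \<Rightarrow> complex \<Rightarrow> (complex \<Rightarrow> complex ^ 'n) \<Rightarrow> bool" where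
  "kobayashi_disc D p X l f \<longleftrightarrow> (\<forall>i. (\<lambda>t. f t $ i) holomorphic_on ball 0 1) \<and> f ` ball 0 1 \<subseteq> D \<and>
     f 0 = p \<and> (\<forall>i. deriv (\<lambda>t. f t $ i) 0 * l = X $ i)"

lemma kobayashi_metric_eq: "kobayashi_metric D p X = Inf {cmod l | l f. kobayashi_disc D p X l f}"
  unfolding kobayashi_metric_def kobayashi_disc_def by simp

lemma kobayashi_metric_le: "kobayashi_disc D p X l f \<Longrightarrow> kobayashi_metric D p X \<le> cmod l"
  unfolding kobayashi_metric_eq by (rule cInf_lower) (auto intro: bdd_belowI[of _ 0])

text \<open>For reals \<open>Inf {}\<close> carries no information, so the existence of some
  competing disc is assumed.\<close>

lemma kobayashi_metric_less_obtains:
  assumes "kobayashi_metric D p X < \<Lambda>" "\<exists>l f. kobayashi_disc D p X l f"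
  obtains l f where "kobayashi_disc D p X l f" "cmod l < \<Lambda>"
proof -
  have "{cmod l | l f. kobayashi_disc D p X l f} \<noteq> {}" using assms(2) by blast
  from cInf_lessD[OF this] assms(1) show thesis
    unfolding kobayashi_metric_eq using that by blast
qed

section \<open>Perturbation of discs and upper semicontinuity\<close>

lemma frequently_obtains_subsequence:
  assumes "\<exists>\<^sub>F n in sequentially. P n"
  obtains r :: "nat \<Rightarrow> nat" where "strict_mono r" "\<And>n. P (r n)"
proof -
  have "infinite {n. P n}" using assms by (simp add: INFM_iff_infinite flip: cofinite_eq_sequentially)
  from infinite_enumerate[OF this] show thesis using that by blast
qed

lemma tendsto_model_value:
  fixes w :: "nat \<Rightarrow> complex ^ 'n::finite" and z :: "complex ^ 'n"
  assumes "\<And>j k. (\<lambda>n. Q n j k) \<longlonglongrightarrow> q j k" "\<And>i. (\<lambda>n. w n $ i) \<longlonglongrightarrow> z $ i"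
  shows "(\<lambda>n. model_value N i0 i1 (Q n) (w n)) \<longlonglongrightarrow> model_value N i0 i1 q z"
  unfolding model_value_def disc_value_def by (intro tendsto_intros tendsto_bieval assms)

text \<open>By compactness of the closed disc: bad parameters for infinitely many \<open>n\<close>
  would accumulate at some \<open>t'\<close> where the limit value is both negative and
  nonnegative.\<close>

lemma eventually_disc_in_model:
  fixes g :: "nat \<Rightarrow> complex \<Rightarrow> complex ^ 'n::finite" and G :: "complex \<Rightarrow> complex ^ 'n"
  assumes Q: "\<And>j k. (\<lambda>n. Q n j k) \<longlonglongrightarrow> q j k"
    and G: "\<And>i. continuous_on (cball 0 1) (\<lambda>t. G t $ i)" 
    and neg: "\<And>t. norm t \<le> 1 \<Longrightarrow> model_value N i0 i1 q (G t) < 0"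
    and close: "\<And>n t i. norm t \<le> 1 \<Longrightarrow> norm (g n t $ i - G t $ i) \<le> e n i" "\<And>i. (\<lambda>n. e n i) \<longlonglongrightarrow> 0"
  shows "\<forall>\<^sub>F n in sequentially. \<forall>t. norm t \<le> 1 \<longrightarrow> model_value N i0 i1 (Q n) (g n t) < 0"
proof (rule ccontr)
  assume "\<not> ?thesis"
  then have "\<exists>\<^sub>F n in sequentially. \<exists>t. norm t \<le> 1 \<and> 0 \<le> model_value N i0 i1 (Q n) (g n t)"
    by (simp add: not_eventually not_less)
  then obtain r :: "nat \<Rightarrow> nat" where r: "strict_mono r" "\<And>n. \<exists>t. norm t \<le> 1 \<and> 0 \<le> model_value N i0 i1 (Q (r n)) (g (r n) t)"
    by (rule frequently_obtains_subsequence) blast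
  then obtain t where t: "\<And>n. norm (t n) \<le> 1" "\<And>n. 0 \<le> model_value N i0 i1 (Q (r n)) (g (r n) (t n))"
    by metis
  obtain r' t' where r': "strict_mono r'" "(t \<circ> r') \<longlonglongrightarrow> t'"
    using bounded_complex_subsequence[of t 1] t(1) by blast
  have t': "norm t' \<le> 1"
    by (rule LIMSEQ_le_const2[OF tendsto_norm[OF r'(2)]]) (use t(1) in auto)
  have rr: "strict_mono (r \<circ> r')" using r r' by (simp add: strict_mono_o)
  have "(\<lambda>n. g (r (r' n)) (t (r' n)) $ i) \<longlonglongrightarrow> G t' $ i" for i
  proof -
    have "(\<lambda>n. G (t (r' n)) $ i) \<longlonglongrightarrow> G t' $ i"
      using continuous_on_tendsto_compose[OF G r'(2)] t t' by (simp add: o_def)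
    moreover have "(\<lambda>n. g (r (r' n)) (t (r' n)) $ i - G (t (r' n)) $ i) \<longlonglongrightarrow> 0"
    proof (rule Lim_null_comparison)
      show "(\<lambda>n. e (r (r' n)) i) \<longlonglongrightarrow> 0"
        using LIMSEQ_subseq_LIMSEQ[OF close(2) rr] by (simp add: o_def)
    qed (use close(1) t(1) in auto)
    ultimately show ?thesis using tendsto_add by fastforce
  qed
  moreover have "(\<lambda>n. Q (r (r' n)) j k) \<longlonglongrightarrow> q j k" for j k
    using LIMSEQ_subseq_LIMSEQ[OF Q rr] by (simp add: o_def)
  ultimately have "(\<lambda>n. model_value N i0 i1 (Q (r (r' n))) (g (r (r' n)) (t (r' n)))) \<longlonglongrightarrow> model_value N i0 i1 q (G t')"
    by (intro tendsto_model_value)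
  then have "0 \<le> model_value N i0 i1 q (G t')"
    by (rule LIMSEQ_le_const) (use t(2) in auto)
  with neg[OF t'] show False by simp
qed

lemma deriv_affine: "deriv (\<lambda>t. c + t * d) (0::complex) = d"
  by (rule DERIV_imp_deriv) (auto intro!: derivative_eq_intros)

text \<open>Makes the infimum meaningful. A short affine disc in direction \<open>X\<close> works,
  being close to the constant disc \<open>z\<close>.\<close>

lemma kobayashi_disc_exists:
  fixes z X :: "complex ^ 'n::finite"
  assumes z: "model_value N i0 i1 q z < 0"
  shows "\<exists>l f. kobayashi_disc {z. model_value N i0 i1 q z < 0} z X l f"
proof -
  define g where "g n t = (\<chi> i. z $ i + t * (X $ i / of_nat (Suc n)))" for n :: nat and t :: complex
  have "\<forall>\<^sub>F n in sequentially. \<forall>t. norm t \<le> 1 \<longrightarrow> model_value N i0 i1 q (g n t) < 0"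
  proof (rule eventually_disc_in_model[where G = "\<lambda>_. z" and e = "\<lambda>n i. norm (X $ i) * inverse (real (Suc n))"])
    show "norm (g n t $ i - z $ i) \<le> norm (X $ i) * inverse (real (Suc n))" if "norm t \<le> 1" for n t i
    proof -
      have "norm (g n t $ i - z $ i) = norm t * (norm (X $ i) * inverse (real (Suc n)))"
        by (simp add: g_def norm_mult norm_divide norm_inverse divide_inverse del: of_nat_Suc)
      also have "\<dots> \<le> 1 * (norm (X $ i) * inverse (real (Suc n)))"
        using that by (intro mult_right_mono) auto
      finally show ?thesis by simp
    qed
    show "(\<lambda>n. norm (X $ i) * inverse (real (Suc n))) \<longlonglongrightarrow> 0" for i
      using tendsto_mult_left[OF LIMSEQ_inverse_real_of_nat, of "norm (X $ i)"] by simp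
  qed (use z in auto)
  then obtain n where n: "\<And>t. norm t \<le> 1 \<Longrightarrow> model_value N i0 i1 q (g n t) < 0"
    by (auto simp: eventually_sequentially)
  have "kobayashi_disc {z. model_value N i0 i1 q z < 0} z X (of_nat (Suc n)) (g n)"
    unfolding kobayashi_disc_def
  proof (intro conjI allI)
    show "(\<lambda>t. g n t $ i) holomorphic_on ball 0 1" for i
      unfolding g_def by (auto intro!: holomorphic_intros simp del: of_nat_Suc)
    show "g n ` ball 0 1 \<subseteq> {z. model_value N i0 i1 q z < 0}" using n by auto
    show "g n 0 = z" by (simp add: g_def vec_eq_iff)
    show "deriv (\<lambda>t. g n t $ i) 0 * of_nat (Suc n) = X $ i" for i
    proof -
      have "deriv (\<lambda>t. g n t $ i) 0 = X $ i / of_nat (Suc n)"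
        unfolding g_def vec_lambda_beta by (rule deriv_affine)
      then show ?thesis by (simp del: of_nat_Suc)
    qed
  qed
  then show ?thesis by blast
qed

lemma kobayashi_disc_perturb:
  fixes f :: "complex \<Rightarrow> complex ^ 'n::finite" and Z XX :: "nat \<Rightarrow> complex ^ 'n" and z X :: "complex ^ 'n"
  assumes Q: "\<And>j k. (\<lambda>n. Q n j k) \<longlonglongrightarrow> q j k" and z: "Z \<longlonglongrightarrow> z" and X: "XX \<longlonglongrightarrow> X"
    and f: "kobayashi_disc {z. model_value N i0 i1 q z < 0} z X l f" and l: "cmod l < \<Lambda>"
  shows "\<forall>\<^sub>F n in sequentially. \<exists>f. kobayashi_disc {z. model_value N i0 i1 (Q n) z < 0} (Z n) (XX n) (of_real \<Lambda>) f"
proof -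
  have \<Lambda>: "0 < \<Lambda>" using l norm_ge_zero le_less_trans by blast
  have hol: "(\<lambda>t. f t $ i) holomorphic_on ball 0 1" for i using f by (simp add: kobayashi_disc_def)
  have fD: "model_value N i0 i1 q (f t) < 0" if "norm t < 1" for t
    using f that unfolding kobayashi_disc_def image_subset_iff by simp
  have f0: "f 0 = z" and fd: "deriv (\<lambda>t. f t $ i) 0 * l = X $ i" for i
    using f by (auto simp: kobayashi_disc_def)
  \<comment> \<open>As \<open>norm s < 1\<close>, the disc \<open>f (s * t)\<close> is defined
    beyond the closed unit disc. Since \<open>s * \<Lambda> = l\<close>, the complex factor also
    replaces the multiplier \<open>l\<close> by the positive number
    \<open>\<Lambda>\<close>.\<close>
  define s where "s = l / of_real \<Lambda>"
  have s: "norm s < 1" using l \<Lambda> by (simp add: s_def norm_divide)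
  have st: "norm (s * t) < 1" if "norm t \<le> 1" for t
    using s that mult_left_le[of "norm t" "norm s"] by (simp add: norm_mult)
  define G where "G t = f (s * t)" for t
  \<comment> \<open>The two correction terms move the centre to \<open>Z n\<close> and the
    derivative to the one required by \<open>XX n\<close>; both are small uniformly in
    \<open>t\<close>.\<close>
  define g where "g n t = (\<chi> i. f (s * t) $ i + (Z n $ i - z $ i) + t * ((XX n $ i - X $ i) / of_real \<Lambda>))" for n t
  have Gc: "continuous_on (cball 0 1) (\<lambda>t. G t $ i)" for i
    unfolding G_def 
    by (rule continuous_on_compose2[OF holomorphic_on_imp_continuous_on[OF hol[of i]]]) 
       (auto intro!: continuous_intros simp: st)
  have "\<forall>\<^sub>F n in sequentially. \<forall>t. norm t \<le> 1 \<longrightarrow> model_value N i0 i1 (Q n) (g n t) < 0"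
  proof (rule eventually_disc_in_model[OF Q Gc,
      where e = "\<lambda>n i. norm (Z n $ i - z $ i) + norm (XX n $ i - X $ i) / \<Lambda>"])
    show "model_value N i0 i1 q (G t) < 0" if "norm t \<le> 1" for t
      unfolding G_def by (rule fD[OF st[OF that]])
    show "norm (g n t $ i - G t $ i) \<le> norm (Z n $ i - z $ i) + norm (XX n $ i - X $ i) / \<Lambda>" if "norm t \<le> 1" for n t i
    proof -
      have "norm (g n t $ i - G t $ i) = norm ((Z n $ i - z $ i) + t * ((XX n $ i - X $ i) / of_real \<Lambda>))"
        by (rule arg_cong[where f = norm]) (simp add: g_def G_def algebra_simps)
      also have "\<dots> \<le> norm (Z n $ i - z $ i) + norm (t * ((XX n $ i - X $ i) / of_real \<Lambda>))"
        by (rule norm_triangle_ineq)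
      also have "norm (t * ((XX n $ i - X $ i) / of_real \<Lambda>)) \<le> norm (XX n $ i - X $ i) / \<Lambda>"
        using that \<Lambda> mult_left_le_one_le[of "norm (XX n $ i - X $ i) / \<Lambda>" "norm t"] by (simp add: norm_mult norm_divide)
      finally show ?thesis by simp
    qed
    have "(\<lambda>n. norm (Z n $ i - z $ i) + norm (XX n $ i - X $ i) / \<Lambda>) \<longlonglongrightarrow> norm (z $ i - z $ i) + norm (X $ i - X $ i) / \<Lambda>" for i
      using \<Lambda> by (intro tendsto_intros z X) auto
    then show "(\<lambda>n. norm (Z n $ i - z $ i) + norm (XX n $ i - X $ i) / \<Lambda>) \<longlonglongrightarrow> 0" for i
      by simp
  qed
  then show ?thesis
  proof eventually_elim
    case (elim n)
    have hs: "(\<lambda>t. f (s * t) $ i) holomorphic_on ball 0 1" for i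
    proof -
      have "((\<lambda>t. f t $ i) \<circ> (\<lambda>t. s * t)) holomorphic_on ball 0 1"
        by (rule holomorphic_on_compose_gen[OF _ hol]) (auto intro!: holomorphic_intros st)
      then show ?thesis by (simp add: o_def)
    qed
    have "kobayashi_disc {z. model_value N i0 i1 (Q n) z < 0} (Z n) (XX n) (of_real \<Lambda>) (g n)"
      unfolding kobayashi_disc_def
    proof (intro conjI allI)
      show "(\<lambda>t. g n t $ i) holomorphic_on ball 0 1" for i
        unfolding g_def using \<Lambda> by (auto intro!: holomorphic_intros hs)
      show "g n ` ball 0 1 \<subseteq> {z. model_value N i0 i1 (Q n) z < 0}" using elim by auto
      show "g n 0 = Z n" by (simp add: g_def vec_eq_iff f0)
      show "deriv (\<lambda>t. g n t $ i) 0 * of_real \<Lambda> = XX n $ i" for i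
      proof -
        have "((\<lambda>t. f t $ i) has_field_derivative deriv (\<lambda>t. f t $ i) 0) (at (s * 0))"
          using holomorphic_derivI[OF hol[of i] open_ball, of 0] by simp
        then have d: "((\<lambda>t. f (s * t) $ i) has_field_derivative deriv (\<lambda>t. f t $ i) 0 * s) (at 0)"
          by (rule DERIV_chain2[where f = "\<lambda>t. f t $ i"]) (auto intro!: derivative_eq_intros)
        have "deriv (\<lambda>t. g n t $ i) 0 = deriv (\<lambda>t. f t $ i) 0 * s + (XX n $ i - X $ i) / of_real \<Lambda>"
          unfolding g_def using \<Lambda> by (intro DERIV_imp_deriv) (auto intro!: derivative_eq_intros d)
        then have "deriv (\<lambda>t. g n t $ i) 0 * of_real \<Lambda> = deriv (\<lambda>t. f t $ i) 0 * (s * of_real \<Lambda>) + (XX n $ i - X $ i)"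
          using \<Lambda> by (simp add: distrib_right mult.assoc)
        moreover have "s * of_real \<Lambda> = l" using \<Lambda> by (simp add: s_def)
        ultimately show ?thesis by (simp add: fd)
      qed
    qed
    then show ?case by blast
  qed
qed

text \<open>Consider a zero \<open>a\<close> of least modulus. The mean over a small circle about
  \<open>a\<close> is at least 0 while the values are at most 0, so they vanish on the circle, which
  has a point closer to the origin.\<close>

lemma disc_value_maximum_principle:
  assumes f: "f0 holomorphic_on ball 0 1" "f1 holomorphic_on ball 0 1" "\<forall>\<alpha>\<in>I. g \<alpha> holomorphic_on ball 0 1"
    and I: "finite I" and lap: "\<And>w. 0 \<le> bilap N q w"
    and le: "\<And>t. norm t < 1 \<Longrightarrow> disc_value N q I (f0 t) (f1 t) (\<lambda>\<alpha>. g \<alpha> t) \<le> 0"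
    and neg: "disc_value N q I (f0 0) (f1 0) (\<lambda>\<alpha>. g \<alpha> 0) < 0" and t: "norm t < 1"
  shows "disc_value N q I (f0 t) (f1 t) (\<lambda>\<alpha>. g \<alpha> t) < 0"
proof (rule ccontr)
  define v where "v t = disc_value N q I (f0 t) (f1 t) (\<lambda>\<alpha>. g \<alpha> t)" for t
  assume "\<not> ?thesis"
  then have v0: "v t = 0" using le[OF t] by (simp add: v_def)
  have cv: "continuous_on (ball 0 1) v"
    unfolding v_def disc_value_def
    by (intro continuous_intros holomorphic_on_imp_continuous_on f bspec[OF f(3)])
  define S where "S = {a \<in> cball 0 (norm t). v a = 0}"
  have "closed S"
    unfolding S_def using t by (intro continuous_closed_preimage_constant continuous_on_subset[OF cv]) auto
  then have "compact S" unfolding S_def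
    by (metis (no_types, lifting) bounded_cball bounded_subset compact_eq_bounded_closed mem_Collect_eq subsetI)
  moreover have "t \<in> S" using v0 by (simp add: S_def)
  ultimately obtain a where a: "a \<in> S" "\<And>b. b \<in> S \<Longrightarrow> norm a \<le> norm b"
    using continuous_attains_inf[of S norm] continuous_on_norm_id by blast
  have na: "norm a < 1" "v a = 0" using a(1) t by (auto simp: S_def)
  have a0: "a \<noteq> 0" using na(2) neg by (auto simp: v_def)
  \<comment> \<open>At most \<open>norm a\<close>, so that the point of the circle nearest the
    origin has modulus \<open>norm a - s\<close>; less than \<open>1 - norm a\<close>, so that the
    circle stays in the disc.\<close>
  define s where "s = min (norm a) ((1 - norm a) / 2)"
  have s: "0 < s" "s \<le> norm a" "s < 1 - norm a" using na a0 by (auto simp: s_def min_def)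
  have sub: "ball a (1 - norm a) \<subseteq> ball 0 1" by (auto simp: ball_subset_ball_iff)
  have fa: "f0 holomorphic_on ball a (1 - norm a)" "f1 holomorphic_on ball a (1 - norm a)"
    "\<forall>\<alpha>\<in>I. g \<alpha> holomorphic_on ball a (1 - norm a)"
    using f sub holomorphic_on_subset by blast+
  have c: "continuous_on {0..2*pi} (\<lambda>\<theta>. v (a + of_real s * cis \<theta>))"
    using disc_value_circle_integral(1)[OF fa I s(1,3), where N = N and q = q] by (simp add: v_def)
  have le0: "v (a + of_real s * cis \<theta>) \<le> 0" for \<theta>
    unfolding v_def using sub circle_subset_ball[OF s(1,3), of a \<theta>] by (intro le) auto
  have "0 \<le> integral {0..2*pi} (\<lambda>\<theta>. v (a + of_real s * cis \<theta>))"
    using disc_value_submean[OF fa I s(1,3) lap] na(2) by (simp add: v_def)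
  moreover have "integral {0..2*pi} (\<lambda>\<theta>. v (a + of_real s * cis \<theta>)) \<le> integral {0..2*pi} (\<lambda>\<theta>. 0)"
    using le0 by (intro integral_le integrable_continuous_real c) auto
  ultimately have "integral {0..2*pi} (\<lambda>\<theta>. - v (a + of_real s * cis \<theta>)) = 0" by simp
  then have "\<forall>\<theta>\<in>{0..2*pi}. - v (a + of_real s * cis \<theta>) = 0"
    using le0 by (subst (asm) integral_eq_0_iff) (auto intro!: continuous_intros c)
  \<comment> \<open>The argument of \<open>- a\<close> is the direction from \<open>a\<close> to the
    origin.\<close>
  then have vz: "v (a + of_real s * cis (Arg2pi (- a))) = 0"
    using Arg2pi[of "- a"] by auto
  have "- a = of_real (norm a) * cis (Arg2pi (- a))"
    using Arg2pi_eq[of "- a"] by (simp add: cis_conv_exp)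
  then have ac: "a = - (of_real (norm a) * cis (Arg2pi (- a)))" by (metis minus_minus)
  have "a + of_real s * cis (Arg2pi (- a)) = of_real (s - norm a) * cis (Arg2pi (- a))"
    by (subst (1) ac) (simp add: algebra_simps)
  then have nn: "norm (a + of_real s * cis (Arg2pi (- a))) = norm a - s"
    using s by (simp add: norm_mult del: of_real_diff)
  have "a + of_real s * cis (Arg2pi (- a)) \<in> S"
    using vz nn a(1) s by (simp add: S_def)
  from a(2)[OF this] nn s show False by simp
qed

section \<open>Normal families and lower semicontinuity\<close>

lemma convergent_coefficients_bounded:
  assumes "\<And>j k. (\<lambda>n. Q n j k) \<longlonglongrightarrow> q j k" "\<And>n. hermitian_upto N (Q n)"
  shows "\<exists>M. \<forall>n j k. norm (Q n j k :: complex) \<le> M"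
proof -
  have "\<exists>M. \<forall>n. norm (Q n j k) \<le> M" for j k
    using convergent_imp_Bseq[OF convergentI[OF assms(1)[of j k]]] by (auto simp: Bseq_def)
  then obtain M where M: "\<And>n j k. norm (Q n j k) \<le> M j k" by metis
  have nn: "0 \<le> M j k" for j k
    using order_trans[OF norm_ge_zero M[of 0 j k]] .
  have "norm (Q n j k) \<le> (\<Sum>j\<le>N. \<Sum>k\<le>N. M j k)" for n j k
  proof (cases "j \<le> N \<and> k \<le> N")
    case True
    have "norm (Q n j k) \<le> M j k" by (rule M)
    also have "\<dots> \<le> (\<Sum>k\<le>N. M j k)" using True nn by (intro member_le_sum) auto
    also have "\<dots> \<le> (\<Sum>j\<le>N. \<Sum>k\<le>N. M j k)"
      using True nn by (intro member_le_sum[where f = "\<lambda>j. \<Sum>k\<le>N. M j k"] sum_nonneg) auto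
    finally show ?thesis .
  next
    case False
    then have "N < j + k" by auto
    then have "Q n j k = 0" using assms(2)[of n] unfolding hermitian_upto_def by blast
    moreover have "0 \<le> (\<Sum>j\<le>N. \<Sum>k\<le>N. M j k)" by (intro sum_nonneg nn)
    ultimately show ?thesis by simp
  qed
  then show ?thesis by blast
qed

text \<open>Convergence of \<open>Q\<close> and \<open>Z\<close> gives the discs a common depth and
  common bounds at the centre, so Montel's theorem applies to each component. The limit disc at
  first satisfies only \<open>\<le> 0\<close>; as its centre \<open>z\<close> lies inside, the
  maximum principle restores the strict inequality.\<close>

lemma kobayashi_disc_limit:
  fixes f :: "nat \<Rightarrow> complex \<Rightarrow> complex ^ 'n::finite" and Z XX :: "nat \<Rightarrow> complex ^ 'n" and z X :: "complex ^ 'n"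
  assumes Q: "\<And>j k. (\<lambda>n. Q n j k) \<longlonglongrightarrow> q j k" "\<And>n. hermitian_upto N (Q n)" "\<And>n w. 0 \<le> bilap N (Q n) w"
    and jk: "1 \<le> j0" "1 \<le> k0" "j0 + k0 = N" and \<kappa>: "0 < \<kappa>" "\<And>n. \<kappa> \<le> norm (Q n j0 k0)"
    and Z: "Z \<longlonglongrightarrow> z" and X: "XX \<longlonglongrightarrow> X" and z: "model_value N i0 i1 q z < 0"
    and f: "\<And>n. kobayashi_disc {z. model_value N i0 i1 (Q n) z < 0} (Z n) (XX n) (l n) (f n)" 
    and l: "\<And>n. cmod (l n) \<le> \<Lambda>"
  shows "\<exists>l f. kobayashi_disc {z. model_value N i0 i1 q z < 0} z X l f \<and> cmod l \<le> \<Lambda>"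
proof -
  let ?I = "- {i0, i1}"
  have hol: "(\<lambda>t. f n t $ i) holomorphic_on ball 0 1" and f0: "f n 0 = Z n"
    and fd: "deriv (\<lambda>t. f n t $ i) 0 * l n = XX n $ i" for n i
    using f[of n] by (auto simp: kobayashi_disc_def)
  have neg: "model_value N i0 i1 (Q n) (f n t) < 0" if "norm t < 1" for n t
    using f[of n] that unfolding kobayashi_disc_def image_subset_iff by simp
  obtain M1 where M1: "\<And>n j k. norm (Q n j k) \<le> M1"
    using convergent_coefficients_bounded[OF Q(1,2)] by blast
  obtain M2 where M2: "\<And>n. norm (Z n) \<le> M2"
    using convergent_imp_Bseq[OF convergentI[OF Z]] by (auto simp: Bseq_def)
  define M where "M = max M1 M2"
  have "(\<lambda>n. model_value N i0 i1 (Q n) (Z n)) \<longlonglongrightarrow> model_value N i0 i1 q z"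
    by (rule tendsto_model_value[OF Q(1)]) (intro tendsto_intros Z)
  then obtain B where B: "\<And>n. norm (model_value N i0 i1 (Q n) (Z n)) \<le> B"
    using convergent_imp_Bseq[OF convergentI] by (force simp: Bseq_def)
  have adm: "admissible_disc N B (Q n) ?I (\<lambda>t. f n t $ i0) (\<lambda>t. f n t $ i1) (\<lambda>\<alpha> t. f n t $ \<alpha>)" for n
    unfolding admissible_disc_def
  proof (intro conjI allI ballI impI)
    show "disc_value N (Q n) ?I (f n t $ i0) (f n t $ i1) (\<lambda>\<alpha>. f n t $ \<alpha>) < 0" if "norm t < 1" for t
      using neg[OF that] by (simp add: model_value_def)
    show "- B \<le> disc_value N (Q n) ?I (f n 0 $ i0) (f n 0 $ i1) (\<lambda>\<alpha>. f n 0 $ \<alpha>)"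
      using B[of n] by (simp add: model_value_def f0 abs_le_iff)
  qed (use Q hol in auto)
  have bound: "\<exists>C. \<forall>n i t. norm t \<le> s \<longrightarrow> norm (f n t $ i) \<le> C" if s: "0 \<le> s" "s < 1" for s
  proof -
    obtain C where C: "\<And>q (I::'n set) f0 f1 g t \<alpha>. admissible_disc N B q I f0 f1 g \<Longrightarrow> \<kappa> \<le> norm (q j0 k0) \<Longrightarrow>
        (\<forall>j k. norm (q j k) \<le> M) \<Longrightarrow> norm (f0 0) \<le> M \<Longrightarrow> norm (f1 0) \<le> M \<Longrightarrow> norm t \<le> s \<Longrightarrow>
        norm (f0 t) \<le> C \<and> norm (f1 t) \<le> C \<and> (\<alpha> \<in> I \<longrightarrow> norm (g \<alpha> t) \<le> C)"
      using admissible_disc_bound[OF jk \<kappa>(1) s, where B = B and M = M and ?'i = 'n] by blast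
    have "norm (f n t $ i) \<le> C" if t: "norm t \<le> s" for n i t
    proof -
      have "norm (f n t $ i0) \<le> C \<and> norm (f n t $ i1) \<le> C \<and> (i \<in> ?I \<longrightarrow> norm (f n t $ i) \<le> C)"
      proof (rule C[OF adm \<kappa>(2) _ _ _ t])
        show "\<forall>j k. norm (Q n j k) \<le> M" using M1 by (auto simp: M_def intro: order_trans[OF _ max.cobounded1])
        have "norm (Z n $ i) \<le> M" for i
          using Finite_Cartesian_Product.norm_nth_le[where x = "Z n" and i = i] M2[of n] by (simp add: M_def)
        then show "norm (f n 0 $ i0) \<le> M" "norm (f n 0 $ i1) \<le> M" by (simp_all add: f0)
      qed
      then show ?thesis by (cases "i = i0"; cases "i = i1") auto
    qed
    then show ?thesis by blast
  qed
  obtain r0 l' where r0: "strict_mono r0" and l': "(l \<circ> r0) \<longlonglongrightarrow> l'"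
    using bounded_complex_subsequence[of l \<Lambda>] l by blast
  \<comment> \<open>The derivative at 0 is recorded with the limit because the condition relating it
    to \<open>l\<close> and \<open>X\<close> must pass to the limit too.\<close>
  define C where "C i s \<longleftrightarrow> (\<exists>g. g holomorphic_on ball 0 1 \<and> (\<forall>t\<in>ball 0 1. (\<lambda>n. f (s n) t $ i) \<longlonglongrightarrow> g t) \<and>
      (\<lambda>n. deriv (\<lambda>t. f (s n) t $ i) 0) \<longlonglongrightarrow> deriv g 0)" for i and s :: "nat \<Rightarrow> nat"
  have "\<exists>r. strict_mono r \<and> (\<forall>i\<in>UNIV. C i (r0 \<circ> r))"
  proof (rule common_subsequence[OF finite r0])
    show "\<exists>r. strict_mono r \<and> C i (s \<circ> r)" for i and s :: "nat \<Rightarrow> nat"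
    proof -
      obtain g r where g: "g holomorphic_on ball 0 1" "strict_mono (r :: nat \<Rightarrow> nat)"
        "\<And>x. x \<in> ball 0 1 \<Longrightarrow> (\<lambda>n. f (s (r n)) x $ i) \<longlonglongrightarrow> g x"
        "\<And>K. \<lbrakk>compact K; K \<subseteq> ball 0 1\<rbrakk> \<Longrightarrow> uniform_limit K ((\<lambda>n t. f (s n) t $ i) \<circ> r) g sequentially"
      proof (rule Montel[of "ball (0::complex) 1" "range (\<lambda>n t. f n t $ i)" "\<lambda>n t. f (s n) t $ i"])
        fix K :: "complex set" assume K: "compact K" "K \<subseteq> ball 0 1"
        obtain s where s: "0 \<le> s" "s < 1" "K \<subseteq> cball 0 s"
        proof (cases "K = {}")
          case False
          then obtain b where "b \<in> K" "\<And>x. x \<in> K \<Longrightarrow> norm x \<le> norm b"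
            using continuous_attains_sup[OF K(1) _ continuous_on_norm_id] by blast
          moreover from this have "K \<subseteq> cball 0 (norm b)" by auto
          moreover have "norm b < 1" using \<open>b \<in> K\<close> K(2) by auto
          ultimately show thesis using that[of "norm b"] by simp
        qed (use that[of 0] in auto)
        obtain C where "\<forall>n i t. norm t \<le> s \<longrightarrow> norm (f n t $ i) \<le> C" using bound[OF s(1,2)] by blast
        with s(3) show "\<exists>B. \<forall>h\<in>range (\<lambda>n t. f n t $ i). \<forall>z\<in>K. norm (h z) \<le> B"
          by (intro exI[of _ C]) auto
      qed (use hol in auto)
      have "(\<lambda>n. deriv (\<lambda>t. f (s (r n)) t $ i) 0) \<longlonglongrightarrow> deriv g 0"
      proof -
        have "uniform_limit (ball 0 (1/2)) (\<lambda>n t. f (s (r n)) t $ i) g sequentially"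
          using uniform_limit_on_subset[OF g(4)[of "cball 0 (1/2)"], of "ball 0 (1/2)"] by (simp add: o_def cball_subset_ball_iff)
        from higher_deriv_complex_uniform_limit[OF this, of 0 1] show ?thesis
          using holomorphic_on_subset[OF hol, of "ball 0 (1/2)"] by (simp add: ball_subset_ball_iff)
      qed
      with g(1,3) have "C i (s \<circ> r)" unfolding C_def o_apply by blast
      with g(2) show ?thesis by blast
    qed
    show "C i (s \<circ> r)" if "C i s" "strict_mono r" for i and s r :: "nat \<Rightarrow> nat"
    proof -
      obtain g where g: "g holomorphic_on ball 0 1" "\<forall>t\<in>ball 0 1. (\<lambda>n. f (s n) t $ i) \<longlonglongrightarrow> g t"
        "(\<lambda>n. deriv (\<lambda>t. f (s n) t $ i) 0) \<longlonglongrightarrow> deriv g 0" using \<open>C i s\<close> unfolding C_def by blast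
      have "(\<lambda>n. f (s (r n)) t $ i) \<longlonglongrightarrow> g t" if "t \<in> ball 0 1" for t
        using LIMSEQ_subseq_LIMSEQ[OF bspec[OF g(2) that] \<open>strict_mono r\<close>] by (simp add: o_def)
      moreover have "(\<lambda>n. deriv (\<lambda>t. f (s (r n)) t $ i) 0) \<longlonglongrightarrow> deriv g 0"
        using LIMSEQ_subseq_LIMSEQ[OF g(3) \<open>strict_mono r\<close>] by (simp add: o_def)
      ultimately show ?thesis using g(1) unfolding C_def by auto
    qed
  qed
  then obtain r where r: "strict_mono r" "\<And>i. C i (r0 \<circ> r)" by blast
  define p where "p = r0 \<circ> r"
  have p: "strict_mono p" unfolding p_def by (rule strict_mono_o[OF r0 r(1)])
  obtain g where g: "\<And>i. g i holomorphic_on ball 0 1" "\<And>i t. t \<in> ball 0 1 \<Longrightarrow> (\<lambda>n. f (p n) t $ i) \<longlonglongrightarrow> g i t"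
    "\<And>i. (\<lambda>n. deriv (\<lambda>t. f (p n) t $ i) 0) \<longlonglongrightarrow> deriv (g i) 0"
    using r(2) unfolding C_def p_def by metis
  define F where "F t = (\<chi> i. g i t)" for t
  have lp: "(\<lambda>n. l (p n)) \<longlonglongrightarrow> l'"
    using LIMSEQ_subseq_LIMSEQ[OF l' r(1)] by (simp add: o_def p_def)
  have Qp: "(\<lambda>n. Q (p n) j k) \<longlonglongrightarrow> q j k" for j k
    using LIMSEQ_subseq_LIMSEQ[OF Q(1) p] by (simp add: o_def)
  have F0: "F 0 = z"
  proof (rule vec_eq_iff[THEN iffD2], intro allI)
    fix i
    have "(\<lambda>n. Z (p n) $ i) \<longlonglongrightarrow> z $ i"
      using LIMSEQ_subseq_LIMSEQ[OF Z p] by (intro tendsto_intros) (simp add: o_def)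
    moreover have "(\<lambda>n. Z (p n) $ i) \<longlonglongrightarrow> g i 0" using g(2)[of 0 i] by (simp add: f0)
    ultimately show "F 0 $ i = z $ i" using LIMSEQ_unique by (fastforce simp: F_def)
  qed
  have le: "model_value N i0 i1 q (F t) \<le> 0" if t: "norm t < 1" for t
  proof (rule LIMSEQ_le_const2)
    show "(\<lambda>n. model_value N i0 i1 (Q (p n)) (f (p n) t)) \<longlonglongrightarrow> model_value N i0 i1 q (F t)"
      by (rule tendsto_model_value[OF Qp]) (use g(2) t in \<open>simp add: F_def\<close>)
  qed (use neg[OF t] less_imp_le in blast)
  have lapq: "0 \<le> bilap N q w" for w
    by (rule LIMSEQ_le_const[OF tendsto_bilap[of N Q q]]) (use Q in auto)
  have lt: "model_value N i0 i1 q (F t) < 0" if t: "norm t < 1" for t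
  proof -
    have val: "model_value N i0 i1 q (F u) = disc_value N q ?I (g i0 u) (g i1 u) (\<lambda>\<alpha>. g \<alpha> u)" for u
      by (simp add: model_value_def disc_value_def F_def)
    show ?thesis
      unfolding val
    proof (rule disc_value_maximum_principle[OF g(1) g(1) _ _ lapq _ _ t])
      show "\<forall>\<alpha>\<in>?I. g \<alpha> holomorphic_on ball 0 1" using g(1) by blast
      show "disc_value N q ?I (g i0 u) (g i1 u) (\<lambda>\<alpha>. g \<alpha> u) \<le> 0" if "norm u < 1" for u
        using le[OF that] unfolding val .
      show "disc_value N q ?I (g i0 0) (g i1 0) (\<lambda>\<alpha>. g \<alpha> 0) < 0"
        using z unfolding F0[symmetric] val .
    qed simp
  qed
  have "kobayashi_disc {z. model_value N i0 i1 q z < 0} z X l' F"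
    unfolding kobayashi_disc_def
  proof (intro conjI allI)
    show "(\<lambda>t. F t $ i) holomorphic_on ball 0 1" for i using g(1) by (simp add: F_def)
    show "F ` ball 0 1 \<subseteq> {z. model_value N i0 i1 q z < 0}" using lt by auto
    show "deriv (\<lambda>t. F t $ i) 0 * l' = X $ i" for i
    proof (rule LIMSEQ_unique)
      show "(\<lambda>n. deriv (\<lambda>t. f (p n) t $ i) 0 * l (p n)) \<longlonglongrightarrow> deriv (\<lambda>t. F t $ i) 0 * l'"
        using g(3)[of i] by (intro tendsto_mult lp) (simp add: F_def)
      have "(\<lambda>n. XX (p n) $ i) \<longlonglongrightarrow> X $ i"
        using LIMSEQ_subseq_LIMSEQ[OF X p] by (intro tendsto_intros) (simp add: o_def)
      then show "(\<lambda>n. deriv (\<lambda>t. f (p n) t $ i) 0 * l (p n)) \<longlonglongrightarrow> X $ i" by (simp add: fd)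
    qed
  qed (rule F0)
  moreover have "cmod l' \<le> \<Lambda>"
    by (rule LIMSEQ_le_const2[OF tendsto_norm[OF lp]]) (use l in auto)
  ultimately show ?thesis by blast
qed

text \<open>Domains, points and vectors vary at once. With constant \<open>Q\<close> this also gives
  continuity of the limit metric, and both uses together yield uniform convergence.\<close>

lemma kobayashi_metric_tendsto:
  fixes Z XX :: "nat \<Rightarrow> complex ^ 'n::finite" and z X :: "complex ^ 'n"
  assumes Q: "\<And>j k. (\<lambda>n. Q n j k) \<longlonglongrightarrow> q j k" "\<And>n. hermitian_upto N (Q n)" "\<And>n w. 0 \<le> bilap N (Q n) w"
    and jk: "1 \<le> j0" "1 \<le> k0" "j0 + k0 = N" "q j0 k0 \<noteq> 0"
    and Z: "Z \<longlonglongrightarrow> z" and X: "XX \<longlonglongrightarrow> X" and z: "model_value N i0 i1 q z < 0"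
  shows "(\<lambda>n. kobayashi_metric {z. model_value N i0 i1 (Q n) z < 0} (Z n) (XX n))
     \<longlonglongrightarrow> kobayashi_metric {z. model_value N i0 i1 q z < 0} z X"
proof -
  define D where "D n = {z. model_value N i0 i1 (Q n) z < 0}" for n
  define D' where "D' = {z. model_value N i0 i1 q z < 0}"
  have ex: "\<exists>l f. kobayashi_disc D' z X l f" unfolding D'_def by (rule kobayashi_disc_exists[OF z])
  have upper: "\<forall>\<^sub>F n in sequentially. \<exists>f. kobayashi_disc (D n) (Z n) (XX n) (of_real \<Lambda>) f"
    if less: "kobayashi_metric D' z X < \<Lambda>" for \<Lambda>
  proof -
    obtain l f where "kobayashi_disc D' z X l f" "cmod l < \<Lambda>"
      using kobayashi_metric_less_obtains[OF less ex] by blast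
    then show ?thesis unfolding D_def D'_def by (intro kobayashi_disc_perturb[OF Q(1) Z X])
  qed
  have nn: "0 \<le> kobayashi_metric D' z X"
    unfolding kobayashi_metric_eq using ex by (intro cInf_greatest) auto
  have "(\<lambda>n. kobayashi_metric (D n) (Z n) (XX n)) \<longlonglongrightarrow> kobayashi_metric D' z X"
  proof (rule order_tendstoI)
    fix y assume "kobayashi_metric D' z X < y"
    then obtain \<Lambda> where \<Lambda>: "kobayashi_metric D' z X < \<Lambda>" "\<Lambda> < y" using dense by blast
    from upper[OF \<Lambda>(1)] show "\<forall>\<^sub>F n in sequentially. kobayashi_metric (D n) (Z n) (XX n) < y"
    proof eventually_elim
      case (elim n)
      then obtain f where "kobayashi_disc (D n) (Z n) (XX n) (of_real \<Lambda>) f" by blast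
      from kobayashi_metric_le[OF this] show ?case using \<Lambda> nn by simp
    qed
  next
    fix y assume y: "y < kobayashi_metric D' z X"
    then obtain \<Lambda> where \<Lambda>: "y < \<Lambda>" "\<Lambda> < kobayashi_metric D' z X" using dense by blast
    define \<kappa> where "\<kappa> = norm (q j0 k0) / 2"
    have \<kappa>: "0 < \<kappa>" using jk by (simp add: \<kappa>_def)
    have ev: "\<forall>\<^sub>F n in sequentially. \<kappa> < norm (Q n j0 k0)"
      by (rule order_tendstoD(1)[OF tendsto_norm[OF Q(1)]]) (use jk in \<open>simp add: \<kappa>_def\<close>)
    \<comment> \<open>Without a competitor for the index \<open>n\<close> a small value of
      \<open>Inf\<close> would yield no disc; the upper estimate supplies one for large
      \<open>n\<close>.\<close>
    have ev2: "\<forall>\<^sub>F n in sequentially. \<exists>l f. kobayashi_disc (D n) (Z n) (XX n) l f"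
      by (rule eventually_mono[OF upper[of "kobayashi_metric D' z X + 1"]]) auto
    show "\<forall>\<^sub>F n in sequentially. y < kobayashi_metric (D n) (Z n) (XX n)"
    proof (rule ccontr)
      assume "\<not> ?thesis"
      then have fr: "\<exists>\<^sub>F n in sequentially. kobayashi_metric (D n) (Z n) (XX n) \<le> y"
        by (simp add: not_eventually not_less)
      define bad where "bad n \<longleftrightarrow> kobayashi_metric (D n) (Z n) (XX n) \<le> y \<and>
          (\<kappa> < norm (Q n j0 k0) \<and> (\<exists>l f. kobayashi_disc (D n) (Z n) (XX n) l f))" for n
      have "\<exists>\<^sub>F n in sequentially. bad n"
        unfolding bad_def using fr by (rule frequently_eventually_frequently[OF _ eventually_conj[OF ev ev2]])
      then obtain r :: "nat \<Rightarrow> nat" where r: "strict_mono r" "\<And>n. bad (r n)"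
        by (rule frequently_obtains_subsequence) blast
      have "\<exists>l f. kobayashi_disc (D (r n)) (Z (r n)) (XX (r n)) l f \<and> cmod l < \<Lambda>" for n
      proof -
        have "kobayashi_metric (D (r n)) (Z (r n)) (XX (r n)) < \<Lambda>" "\<exists>l f. kobayashi_disc (D (r n)) (Z (r n)) (XX (r n)) l f"
          using r(2)[of n] \<Lambda> unfolding bad_def by auto
        from kobayashi_metric_less_obtains[OF this] show ?thesis by blast
      qed
      then obtain l f where lf: "\<And>n. kobayashi_disc (D (r n)) (Z (r n)) (XX (r n)) (l n) (f n)" "\<And>n. cmod (l n) < \<Lambda>"
        by metis
      have "\<exists>l f. kobayashi_disc {z. model_value N i0 i1 q z < 0} z X l f \<and> cmod l \<le> \<Lambda>"
      proof (rule kobayashi_disc_limit[where Q = "\<lambda>n. Q (r n)", OF _ Q(2,3) jk(1-3) \<kappa> _ _ _ z])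
        show "(\<lambda>n. Q (r n) j k) \<longlonglongrightarrow> q j k" for j k
          using LIMSEQ_subseq_LIMSEQ[OF Q(1) r(1)] by (simp add: o_def)
        show "\<kappa> \<le> norm (Q (r n) j0 k0)" for n using r(2)[of n] unfolding bad_def by simp
        show "(\<lambda>n. Z (r n)) \<longlonglongrightarrow> z" "(\<lambda>n. XX (r n)) \<longlonglongrightarrow> X"
          using LIMSEQ_subseq_LIMSEQ[OF Z r(1)] LIMSEQ_subseq_LIMSEQ[OF X r(1)] by (simp_all add: o_def)
        show "kobayashi_disc {z. model_value N i0 i1 (Q (r n)) z < 0} (Z (r n)) (XX (r n)) (l n) (f n)" for n
          using lf(1)[of n] by (simp add: D_def)
        show "cmod (l n) \<le> \<Lambda>" for n using lf(2)[of n] by simp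
      qed
      then obtain l' f' where "kobayashi_disc D' z X l' f'" "cmod l' \<le> \<Lambda>" unfolding D'_def by blast
      with kobayashi_metric_le[OF this(1)] \<Lambda> show False by simp
    qed
  qed
  then show ?thesis unfolding D_def D'_def .
qed

section \<open>Dilations of the limit domain\<close>

lemma bipoly_eval_eq_bieval:
  assumes "\<And>j k. N < j + k \<Longrightarrow> c j k = 0"
  shows "bipoly_eval c t = bieval N c t"
proof -
  have "(\<Sum>(j, k)\<in>{(j, k). c j k \<noteq> 0}. c j k * t ^ j * cnj t ^ k)
      = (\<Sum>(j, k)\<in>{..N} \<times> {..N}. c j k * t ^ j * cnj t ^ k)"
  proof (rule sum.mono_neutral_left)
    show "{(j, k). c j k \<noteq> 0} \<subseteq> {..N} \<times> {..N}"
      using assms by (force simp: not_le)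
  qed auto
  then show ?thesis
    by (simp add: bipoly_eval_def bieval_def sum.cartesian_product)
qed

lemma model_domain_eq:
  assumes "\<And>j k. N < j + k \<Longrightarrow> c j k = 0"
  shows "model_domain i0 i1 c = {z. model_value N i0 i1 c z < 0}"
  unfolding model_domain_def model_function_def model_value_def disc_value_def
  by (simp add: bipoly_eval_eq_bieval[OF assms])

lemma bilap_nonneg_if_subharmonic:
  assumes "\<And>j k. N < j + k \<Longrightarrow> c j k = 0" "subharmonic_on UNIV (bipoly_eval c)"
  shows "0 \<le> bilap N c w"
proof (rule submean_imp_bilap_nonneg)
  fix z :: complex and R :: real assume R: "0 < R"
  have "\<forall>z R. 0 < R \<longrightarrow> cball z R \<subseteq> UNIV \<longrightarrow>
      bipoly_eval c z \<le> integral {0..2*pi} (\<lambda>\<theta>. bipoly_eval c (z + of_real R * cis \<theta>)) / (2 * pi)"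
    using assms(2) unfolding subharmonic_on_def by (rule conjunct2)
  with R have "bipoly_eval c z \<le> integral {0..2*pi} (\<lambda>\<theta>. bipoly_eval c (z + of_real R * cis \<theta>)) / (2 * pi)"
    by simp
  then have "bieval N c z \<le> integral {0..2*pi} (\<lambda>\<theta>. bieval N c (z + of_real R * cis \<theta>)) / (2 * pi)"
    by (simp only: bipoly_eval_eq_bieval[of N c, OF assms(1)])
  then show "2 * pi * bieval N c z \<le> integral {0..2*pi} (\<lambda>\<theta>. bieval N c (z + of_real R * cis \<theta>))"
    by (simp add: field_simps)
qed

text \<open>The coefficients of \<open>P\<^sub>n(t) = P(n\<^bsup>1/N\<^esup> t) / n\<close>; they all vanish for \<open>n = 0\<close>.\<close>

definition dilated_coeffs :: "nat \<Rightarrow> (nat \<Rightarrow> nat \<Rightarrow> complex) \<Rightarrow> nat \<Rightarrow> nat \<Rightarrow> nat \<Rightarrow> complex" where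
  "dilated_coeffs N c n j k = c j k * of_real ((real n powr (1 / real N)) ^ (j + k) / real n)"

lemma hermitian_dilated_coeffs:
  assumes "hermitian_upto N c"
  shows "hermitian_upto N (dilated_coeffs N c n)"
  unfolding hermitian_upto_def
proof (intro conjI allI impI)
  have cjk: "c k j = cnj (c j k)" for j k using assms unfolding hermitian_upto_def by blast
  show "dilated_coeffs N c n k j = cnj (dilated_coeffs N c n j k)" for j k
    unfolding dilated_coeffs_def add.commute[of k j] complex_cnj_mult complex_cnj_complex_of_real cjk[of k j] ..
  show "dilated_coeffs N c n j k = 0" if "N < j + k" for j k
  proof -
    have "c j k = 0" using assms that unfolding hermitian_upto_def by blast
    then show ?thesis by (simp add: dilated_coeffs_def)
  qed
qed

text \<open>The chain rule: the Laplacian of \<open>P (A * t) / n\<close> is \<open>A^2 / n\<close>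
  times that of \<open>P\<close> at \<open>A * t\<close>. For \<open>n = 0\<close> the factor is 0,
  since division by 0 gives 0.\<close>

lemma bilap_dilated_coeffs_nonneg:
  assumes "\<And>w. 0 \<le> bilap N c w"
  shows "0 \<le> bilap N (dilated_coeffs N c n) w"
proof -
  define A where "A = real n powr (1 / real N)"
  \<comment> \<open>The case distinction is due to \<open>j - 1\<close> and \<open>k - 1\<close>,
    which are truncated at 0; both sides vanish there.\<close>
  have summand: "dilated_coeffs N c n j k * (of_nat j * w ^ (j - 1)) * cnj (of_nat k * w ^ (k - 1))
      = of_real (A\<^sup>2 / real n) * (c j k * (of_nat j * (of_real A * w) ^ (j - 1)) * cnj (of_nat k * (of_real A * w) ^ (k - 1)))" for j k
  proof (cases "j = 0 \<or> k = 0")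
    case False
    then obtain j' k' where "j = Suc j'" "k = Suc k'" by (metis not0_implies_Suc)
    then show ?thesis
      by (simp add: dilated_coeffs_def A_def[symmetric] power_mult_distrib power_add power2_eq_square mult_ac del: of_nat_Suc)
  qed auto
  have Re_mult: "Re (of_real x * z) = x * Re z" for x z by simp
  have "bilap N (dilated_coeffs N c n) w = A\<^sup>2 / real n * bilap N c (of_real A * w)"
    unfolding bilap_def summand sum_distrib_left[symmetric] by (rule Re_mult)
  then show ?thesis using assms by simp
qed

text \<open>For \<open>n > 0\<close> the factor of \<open>c j k\<close> is \<open>n\<close> to the
  power \<open>(j + k) / N - 1\<close>: equal to 1 in top degree, and tending to 0 below it.\<close>

lemma dilated_coeffs_tendsto:
  assumes "hermitian_upto N c" "0 < N"
  shows "(\<lambda>n. dilated_coeffs N c n j k) \<longlonglongrightarrow> homogeneous_part N c j k"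
proof -
  define A where "A n = real n powr (1 / real N)" for n
  have AN: "A n ^ N = real n" "0 < A n" if "0 < n" for n
    using that assms(2) by (simp_all add: A_def powr_powr flip: powr_realpow)
  have ev: "\<forall>\<^sub>F n in sequentially. (0::nat) < n" by (rule eventually_gt_at_top)
  consider "j + k = N" | "j + k < N" | "N < j + k" by linarith
  then show ?thesis
  proof cases
    case 1
    have "\<forall>\<^sub>F n in sequentially. c j k = dilated_coeffs N c n j k"
      using ev
    proof eventually_elim
      case (elim n)
      then show ?case using AN(1)[OF elim] by (simp add: dilated_coeffs_def 1 A_def)
    qed
    from Lim_transform_eventually[OF tendsto_const this] show ?thesis
      using 1 by (simp add: homogeneous_part_def)
  next
    case 2
    define d where "d = N - (j + k)"
    have d: "0 < d" "j + k + d = N" using 2 by (auto simp: d_def)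
    have "((\<lambda>n. real n powr (- (1 / real N))) \<longlongrightarrow> 0) sequentially"
      using assms(2) by (intro tendsto_neg_powr filterlim_real_sequentially) auto
    then have "(\<lambda>n. c j k * of_real ((real n powr (- (1 / real N))) ^ d)) \<longlonglongrightarrow> c j k * of_real (0 ^ d)"
      by (intro tendsto_intros)
    moreover have "\<forall>\<^sub>F n in sequentially. c j k * of_real ((real n powr (- (1 / real N))) ^ d) = dilated_coeffs N c n j k"
      using ev
    proof eventually_elim
      case (elim n)
      have "real n = A n ^ (j + k) * A n ^ d" using AN(1)[OF elim] d by (simp flip: power_add)
      then have "A n ^ (j + k) / real n = inverse (A n) ^ d"
        using AN(2)[OF elim] by (simp add: field_simps)
      then show ?case by (simp add: dilated_coeffs_def A_def powr_minus)
    qed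
    ultimately have "(\<lambda>n. dilated_coeffs N c n j k) \<longlonglongrightarrow> c j k * of_real (0 ^ d)"
      by (rule Lim_transform_eventually)
    then show ?thesis using 2 d by (simp add: homogeneous_part_def zero_power)
  next
    case 3
    then have "c j k = 0" using assms(1) unfolding hermitian_upto_def by blast
    then show ?thesis by (simp add: dilated_coeffs_def homogeneous_part_def)
  qed
qed

text \<open>The weights of the dilation divide the real part and every square by \<open>n\<close>,
  and \<open>dilated_coeffs\<close> makes the polynomial scale in the same way; so the sign of the
  defining function is preserved. At \<open>n = 0\<close> every \<open>powr\<close> factor is 0 and
  the dilation is not surjective.\<close>

lemma dilation_image_model_domain:
  fixes i0 i1 :: "'n::finite"
  assumes i: "i0 \<noteq> i1" and N: "N = 2 * m'" "0 < m'" and n: "0 < n"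
  shows "dilation i0 i1 m' n ` {z. model_value N i0 i1 c z < 0} = {z. model_value N i0 i1 (dilated_coeffs N c n) z < 0}"
proof -
  define A where "A = real n powr (1 / real N)"
  have A: "0 < A" "A ^ N = real n"
    using n N by (simp_all add: A_def powr_powr flip: powr_realpow)
  have AN: "real n powr (- 1 / (2 * real m')) = 1 / A"
    using N by (simp add: A_def powr_minus_divide)
  have n1: "real n powr (- 1) = 1 / real n" using n by (simp add: powr_minus_divide)
  have nh: "real n powr (- 1 / 2) = 1 / sqrt (real n)"
    using n by (simp add: powr_minus_divide powr_half_sqrt)
  have scale: "bieval N (dilated_coeffs N c n) (w / of_real A) = bieval N c w / real n" for w
  proof -
    have "dilated_coeffs N c n j k * (w / of_real A) ^ j * cnj (w / of_real A) ^ k = c j k * w ^ j * cnj w ^ k / of_real (real n)" for j k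
      using A(1) by (simp add: dilated_coeffs_def A_def[symmetric] power_divide power_add)
    then show ?thesis unfolding bieval_def by (simp add: sum_divide_distrib)
  qed
  have comp: "dilation i0 i1 m' n z $ i0 = z $ i0 / of_real (real n)" "dilation i0 i1 m' n z $ i1 = z $ i1 / of_real A"
    "\<alpha> \<in> - {i0, i1} \<Longrightarrow> dilation i0 i1 m' n z $ \<alpha> = z $ \<alpha> / of_real (sqrt (real n))" for z \<alpha>
    using i unfolding dilation_def AN n1 nh by auto
  have val: "model_value N i0 i1 (dilated_coeffs N c n) (dilation i0 i1 m' n z) = model_value N i0 i1 c z / real n" for z
  proof -
    have "(\<Sum>\<alpha>\<in>- {i0, i1}. (cmod (dilation i0 i1 m' n z $ \<alpha>))\<^sup>2) = (\<Sum>\<alpha>\<in>- {i0, i1}. (cmod (z $ \<alpha>))\<^sup>2 / real n)"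
      by (intro sum.cong refl) (simp add: comp(3) norm_divide power_divide)
    then show ?thesis
      unfolding model_value_def disc_value_def comp(1,2) scale
      by (simp add: add_divide_distrib sum_divide_distrib)
  qed
  have surj: "\<exists>z. dilation i0 i1 m' n z = w" for w
  proof
    let ?z = "\<chi> i. if i = i0 then w $ i * of_real (real n) else if i = i1 then w $ i * of_real A
        else w $ i * of_real (sqrt (real n))"
    have "dilation i0 i1 m' n ?z $ i = w $ i" for i
      using n A(1) i comp(1)[of ?z] comp(2)[of ?z] comp(3)[of i ?z] by (cases "i = i0"; cases "i = i1") auto
    then show "dilation i0 i1 m' n ?z = w" by (simp add: vec_eq_iff)
  qed
  show ?thesis
  proof (intro equalityI subsetI)
    fix w assume "w \<in> {z. model_value N i0 i1 (dilated_coeffs N c n) z < 0}"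
    moreover obtain z where "w = dilation i0 i1 m' n z" using surj by metis
    ultimately show "w \<in> dilation i0 i1 m' n ` {z. model_value N i0 i1 c z < 0}"
      using n by (auto simp: val divide_less_0_iff)
  qed (use n in \<open>auto simp: val divide_less_0_iff\<close>)
qed

text \<open>Continuous convergence gives uniformity: points of \<open>K\<close> where the error is
  at least \<open>e\<close> accumulate at some \<open>y\<close> in \<open>K\<close>. Along them both
  \<open>F n\<close> and \<open>F'\<close> tend to \<open>F' y\<close>; for \<open>F'\<close> this
  is the convergence result with constant coefficients, for which \<open>q\<close> must inherit the
  symmetry and the nonnegative Laplacian.\<close>

lemma kobayashi_metric_uniform_limit:
  fixes i0 i1 :: "'n::finite"
  assumes Q: "\<And>j k. (\<lambda>n. Q n j k) \<longlonglongrightarrow> q j k" "\<And>n. hermitian_upto N (Q n)" "\<And>n w. 0 \<le> bilap N (Q n) w"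
    and jk: "1 \<le> j0" "1 \<le> k0" "j0 + k0 = N" "q j0 k0 \<noteq> 0"
    and K: "compact K" "K \<subseteq> {z. model_value N i0 i1 q z < 0} \<times> UNIV"
  shows "uniform_limit K (\<lambda>n (z, X). kobayashi_metric {z. model_value N i0 i1 (Q n) z < 0} z X)
      (\<lambda>(z, X). kobayashi_metric {z. model_value N i0 i1 q z < 0} z X) sequentially"
proof (rule ccontr)
  define F where "F n x = kobayashi_metric {z. model_value N i0 i1 (Q n) z < 0} (fst x) (snd x)" for n and x :: "(complex ^ 'n) \<times> (complex ^ 'n)"
  define F' where "F' x = kobayashi_metric {z. model_value N i0 i1 q z < 0} (fst x) (snd x)" for x :: "(complex ^ 'n) \<times> (complex ^ 'n)"
  assume "\<not> ?thesis"
  then have "\<not> uniform_limit K F F' sequentially"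
    by (simp add: F_def[abs_def] F'_def[abs_def] case_prod_beta')
  then obtain e where e: "0 < e" "\<not> (\<forall>\<^sub>F n in sequentially. \<forall>x\<in>K. dist (F n x) (F' x) < e)"
    unfolding uniform_limit_iff by blast
  then have "\<exists>\<^sub>F n in sequentially. \<exists>x\<in>K. e \<le> dist (F n x) (F' x)"
    by (simp add: not_eventually not_less)
  then obtain r :: "nat \<Rightarrow> nat" where r: "strict_mono r" "\<And>n. \<exists>x\<in>K. e \<le> dist (F (r n) x) (F' x)"
    by (rule frequently_obtains_subsequence) blast
  then obtain x where x: "\<And>n. x n \<in> K" "\<And>n. e \<le> dist (F (r n) (x n)) (F' (x n))" by metis
  obtain y r' where y: "y \<in> K" "strict_mono r'" "(x \<circ> r') \<longlonglongrightarrow> y"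
    using compact_imp_seq_compact[OF K(1)] x(1) unfolding seq_compact_def by metis
  have rr: "strict_mono (r \<circ> r')" by (rule strict_mono_o[OF r(1) y(2)])
  have lim: "(\<lambda>n. fst (x (r' n))) \<longlonglongrightarrow> fst y" "(\<lambda>n. snd (x (r' n))) \<longlonglongrightarrow> snd y"
    using tendsto_fst[OF y(3)] tendsto_snd[OF y(3)] by (simp_all add: o_def)
  have neg: "model_value N i0 i1 q (fst y) < 0" using y(1) K(2) by (cases y) auto
  have Qr: "(\<lambda>n. Q ((r \<circ> r') n) j k) \<longlonglongrightarrow> q j k" for j k
    using LIMSEQ_subseq_LIMSEQ[OF Q(1) rr] by (simp add: o_def)
  have qh: "hermitian_upto N q"
  proof -
    have "q k j = cnj (q j k)" for j k
    proof (rule LIMSEQ_unique[OF Q(1)])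
      have "Q n k j = cnj (Q n j k)" for n using Q(2)[of n] unfolding hermitian_upto_def by blast
      then have "(\<lambda>n. Q n k j) = (\<lambda>n. cnj (Q n j k))" by blast
      then show "(\<lambda>n. Q n k j) \<longlonglongrightarrow> cnj (q j k)" using tendsto_cnj[OF Q(1)] by simp
    qed
    moreover have "q j k = 0" if "N < j + k" for j k
    proof -
      have "Q n j k = 0" for n using Q(2)[of n] that unfolding hermitian_upto_def by blast
      then show ?thesis using Q(1)[of j k] by (simp add: LIMSEQ_const_iff)
    qed
    ultimately show ?thesis unfolding hermitian_upto_def by blast
  qed
  have qlap: "0 \<le> bilap N q w" for w
    by (rule LIMSEQ_le_const[OF tendsto_bilap[of N Q q]]) (use Q in auto)
  have "(\<lambda>n. F ((r \<circ> r') n) (x (r' n))) \<longlonglongrightarrow> F' y"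
    unfolding F_def F'_def by (rule kobayashi_metric_tendsto[OF Qr Q(2,3) jk lim neg])
  moreover have "(\<lambda>n. F' (x (r' n))) \<longlonglongrightarrow> F' y"
    unfolding F'_def by (rule kobayashi_metric_tendsto[OF tendsto_const qh qlap jk lim neg])
  ultimately have "(\<lambda>n. dist (F ((r \<circ> r') n) (x (r' n))) (F' (x (r' n)))) \<longlonglongrightarrow> dist (F' y) (F' y)"
    by (rule tendsto_dist)
  then have "e \<le> dist (F' y) (F' y)"
    by (rule LIMSEQ_le_const) (use x(2) in auto)
  with e(1) show False by simp
qed

theorem proposition8p4:
  fixes i0 i1 :: "'n::finite"
    and \<Omega> :: "(complex ^ 'n) set"
    and \<Omega>_hat \<Omega>_tilde :: "(complex ^ 'n) set"
  assumes "scaling_construction i0 i1 \<Omega> u m W r \<Phi> a b \<epsilon> s c m'"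
  defines "\<Omega>_hat \<equiv> model_domain i0 i1 c"
    and "\<Omega>_tilde \<equiv> model_domain i0 i1 (homogeneous_part (2 * m') c)"
  shows "(\<forall>z\<in>\<Omega>_tilde. \<forall>X.
            (\<lambda>n. kobayashi_metric (dilation i0 i1 m' n ` \<Omega>_hat) z X)
              \<longlonglongrightarrow> kobayashi_metric \<Omega>_tilde z X) \<and>
         (\<forall>K. compact K \<longrightarrow> K \<subseteq> \<Omega>_tilde \<times> UNIV \<longrightarrow>
            uniform_limit K
              (\<lambda>n (z, X). kobayashi_metric (dilation i0 i1 m' n ` \<Omega>_hat) z X)
              (\<lambda>(z, X). kobayashi_metric \<Omega>_tilde z X) sequentially)"
proof -
  interpret scaling_construction i0 i1 \<Omega> u m W r \<Phi> a b \<epsilon> s c m' by fact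
  define N where "N = 2 * m'"
  have fin: "finite {j + k | j k. c j k \<noteq> 0}"
  proof -
    have "{j + k | j k. c j k \<noteq> 0} = (\<lambda>(j, k). j + k) ` {(j, k). c j k \<noteq> 0}" by auto
    moreover have "finite {(j, k). c j k \<noteq> 0}"
      using P_polynomial(1) unfolding real_bipoly_def by blast
    ultimately show ?thesis by simp
  qed
  have supp: "c j k = 0" if "N < j + k" for j k
  proof (rule ccontr)
    assume "c j k \<noteq> 0"
    then have "j + k \<le> bipoly_degree c"
      unfolding bipoly_degree_def using fin by (intro Max_ge) auto
    with that show False by (simp add: P_degree N_def)
  qed
  have herm: "hermitian_upto N c"
    using P_polynomial(1) supp unfolding hermitian_upto_def real_bipoly_def by blast
  have lap: "0 \<le> bilap N c w" for w
    by (rule bilap_nonneg_if_subharmonic[OF supp P_subharmonic])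
  have "bipoly_degree c \<in> {j + k | j k. c j k \<noteq> 0}"
    unfolding bipoly_degree_def using fin P_polynomial(2) by (intro Max_in) auto
  then obtain j0 k0 where top: "j0 + k0 = N" "c j0 k0 \<noteq> 0"
    by (auto simp: P_degree N_def)
  \<comment> \<open>With exactly one index 0 this would be a harmonic term, with both the constant
    term. So the top coefficient is mixed, and the degree is positive.\<close>
  have "j0 \<noteq> 0" "k0 \<noteq> 0"
    using top(2) P_polynomial(3,4) unfolding no_harmonic_terms_def by (metis gr0I)+
  then have jk: "1 \<le> j0" "1 \<le> k0" "j0 + k0 = N" "homogeneous_part N c j0 k0 \<noteq> 0"
    using top by (auto simp: homogeneous_part_def)
  have N: "0 < N" "0 < m'" using jk by (auto simp: N_def)
  have tilde: "\<Omega>_tilde = {z. model_value N i0 i1 (homogeneous_part N c) z < 0}"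
    unfolding \<Omega>_tilde_def N_def[symmetric] by (rule model_domain_eq) (simp add: homogeneous_part_def)
  have hat_eq: "\<Omega>_hat = {z. model_value N i0 i1 c z < 0}"
    unfolding \<Omega>_hat_def by (rule model_domain_eq[OF supp])
  have hat: "dilation i0 i1 m' n ` \<Omega>_hat = {z. model_value N i0 i1 (dilated_coeffs N c n) z < 0}" if "0 < n" for n
    unfolding hat_eq by (rule dilation_image_model_domain[OF indices N_def N(2) that])
  have unif: "uniform_limit K (\<lambda>n (z, X). kobayashi_metric (dilation i0 i1 m' n ` \<Omega>_hat) z X)
      (\<lambda>(z, X). kobayashi_metric \<Omega>_tilde z X) sequentially" if K: "compact K" "K \<subseteq> \<Omega>_tilde \<times> UNIV" for K
  proof -
    have "uniform_limit K (\<lambda>n (z, X). kobayashi_metric {z. model_value N i0 i1 (dilated_coeffs N c n) z < 0} z X)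
      (\<lambda>(z, X). kobayashi_metric {z. model_value N i0 i1 (homogeneous_part N c) z < 0} z X) sequentially"
      using K unfolding tilde
      by (intro kobayashi_metric_uniform_limit[OF dilated_coeffs_tendsto[OF herm N(1)] hermitian_dilated_coeffs[OF herm]
            bilap_dilated_coeffs_nonneg[OF lap] jk])
    \<comment> \<open>The degenerate dilation at \<open>n = 0\<close> does not affect the
      limit.\<close>
    moreover have "\<forall>\<^sub>F n in sequentially. \<forall>x\<in>K.
        (\<lambda>(z, X). kobayashi_metric {z. model_value N i0 i1 (dilated_coeffs N c n) z < 0} z X) x
        = (\<lambda>(z, X). kobayashi_metric (dilation i0 i1 m' n ` \<Omega>_hat) z X) x"
      by (rule eventually_mono[OF eventually_gt_at_top[of 0]]) (simp add: hat)
    ultimately show ?thesis unfolding tilde by (subst (asm) uniform_limit_cong) auto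
  qed
  have "(\<lambda>n. kobayashi_metric (dilation i0 i1 m' n ` \<Omega>_hat) z X) \<longlonglongrightarrow> kobayashi_metric \<Omega>_tilde z X" if "z \<in> \<Omega>_tilde" for z X
    using tendsto_uniform_limitI[OF unif[of "{(z, X)}"], of "(z, X)"] that by simp
  with unif show ?thesis by blast
qed

end
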